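(* Let $\theta\in\mathbb{C}$, $q=\exp(\tfrac{\mathrm{i}}{2}\theta)$, $V=\mathbb{C}^k$, $W=\mathbb{C}^r$. The tangent space $T_{[E]}\mathcal M_\theta(r,k)$ to the instanton moduli space at a closed point $[E]=[(B,I,J)]$ is isomorphic to the cohomology group $H^1(\underline{\mathscr I}_\bullet(E))$ (cohomology at the middle term) of the complex $$\underline{\mathscr I}_\bullet(E):\quad 0\longrightarrow\mathrm{End}(V)\xrightarrow{\ \mathrm d\tilde\varphi\ }\begin{matrix}(\mathcal A_\ell^!)_1\otimes\mathrm{End}(V)\\ \oplus\\ (\mathcal A_\ell^!)_2\otimes\mathrm{Hom}(W,V)\\ \oplus\\ \mathrm{Hom}(V,W)\end{matrix}\xrightarrow{\ \mathrm d\tilde\mu_c\ }(\mathcal A_\ell^!)_2\otimes\mathrm{End}(V)\longrightarrow0 .$$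
   Context: **ADHM data.** $\mathcal A_\ell^!$ is the graded algebra generated by degree-one $\check w_1,\check w_2$ with $\check w_1^2=\check w_2^2=0$, $\check w_1\check w_2=-q^2\check w_2\check w_1$, so $(\mathcal A_\ell^!)_1=\mathbb{C}\check w_1\oplus\mathbb{C}\check w_2$ and $(\mathcal A_\ell^!)_2=\mathbb{C}\check w_1\check w_2\cong\mathbb{C}$. $\mathcal X(W,V)=\mathrm{Hom}(V,V\otimes(\mathcal A_\ell^!)_1)\oplus\mathrm{Hom}(W,V\otimes(\mathcal A_\ell^!)_2)\oplus\mathrm{Hom}(V,W)\ni(B,I,J)$, with $B=B_1\otimes\check w_1+B_2\otimes\check w_2$. For $B,B'\in\mathrm{Hom}(V,V\otimes(\mathcal A_\ell^!)_1)$ put $B\wedge_\theta B'=(\mathrm{id}_V\otimes\mu)\circ(B\otimes\mathrm{id})\circ B'=(B_1B_2'-q^{-2}B_2B_1')\otimes\check w_1\check w_2$, where $\mu$ is the product of $\mathcal A_\ell^!$. Let $\mu_c(B,I,J)=B\wedge_\theta B+I\circ J$. A triple is stable if no proper subspace $V'\subsetneq V$ satisfies $B(V')\subset V'\otimes(\mathcal A_\ell^!)_1$ and $I(W)\subset V'\otimes(\mathcal A_\ell^!)_2$. $GL(V)$ acts by $g\cdot(B,I,J)=(\tilde gBg^{-1},\tilde gI,Jg^{-1})$, $\tilde g=g\otimes\mathrm{id}_{\mathcal A_\ell^!}$. $\tilde\mu_c$ denotes the restriction of $\mu_c$ to stable triples. **Differentials** at the stable point $(B,I,J)$ with $\mu_c(B,I,J)=0$: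 $\mathrm d\tilde\mu_c(b,i,j)=b\wedge_\theta B+B\wedge_\theta b+i\circ J+I\circ j$, and $\mathrm d\tilde\varphi$ is the differential at the identity of the orbit map $g\mapsto g\cdot(B,I,J)$: $\mathrm d\tilde\varphi(\xi)=\big([\xi,B],(\xi\otimes\mathrm{id})I,-J\xi\big)$, where $[\xi,B]=[\xi,B_1]\otimes\check w_1+[\xi,B_2]\otimes\check w_2$. **Moduli space.** $\mathcal M_\theta(r,k)$ is the fine moduli space of $(W,V)$-framed torsion free sheaves $E$ on the noncommutative projective plane $\mathbb{CP}^2_\theta$ (the category of finitely generated graded right modules, modulo finite-dimensional ones, over the algebra generated by degree-one $w_1,w_2,w_3$ with $w_1w_2=q^2w_2w_1$ and $w_3$ central), realized as the geometric invariant theory quotient $\tilde\mu_c^{-1}(0)/GL(V)$; $[E]=[(B,I,J)]$ denotes corresponding points. *)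

theory Defs
  imports
    "HOL-Analysis.Analysis"
    "HOL-Algebra.Ideal_Product"
    "Jordan_Normal_Form.Missing_VectorSpace"
begin

section \<open>Complex vector spaces as modules over the field of complex numbers\<close>

text \<open>
  Vector spaces are HOL-Algebra module records; fields of such a record that play no role for a
  module (the ring multiplication and unit) are \<open>undefined\<close>.
\<close>

definition complex_field :: "complex ring" where
  "complex_field = \<lparr>carrier = UNIV, mult = (*), one = 1, zero = 0, add = (+)\<rparr>"

definition complex_line :: "(complex, complex) module" where
  "complex_line =
    \<lparr>carrier = UNIV, mult = (*), one = 1, zero = 0, add = (+), smult = (*)\<rparr>"

text \<open>The summand \<open>N\<close> in the scalar multiplication matters only for the scalar \<open>0\<close>.\<close>

definition quotient_module :: "(complex, 'a) module \<Rightarrow> 'a set \<Rightarrow> (complex, 'a set) module" where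
  "quotient_module M N =
    \<lparr>carrier = a_rcosets\<^bsub>M\<^esub> N, mult = undefined, one = undefined,
     zero = N, add = (\<lambda>X Y. X <+>\<^bsub>M\<^esub> Y),
     smult = (\<lambda>c X. ((\<lambda>x. c \<odot>\<^bsub>M\<^esub> x) ` X) <+>\<^bsub>M\<^esub> N)\<rparr>"

definition dual_module :: "(complex, 'a) module \<Rightarrow> (complex, 'a \<Rightarrow> complex) module" where
  "dual_module M =
    \<lparr>carrier = module_hom complex_field M complex_line \<inter> extensional (carrier M),
     mult = undefined, one = undefined,
     zero = restrict (\<lambda>x. 0) (carrier M),
     add = (\<lambda>\<delta> \<epsilon>. restrict (\<lambda>x. \<delta> x + \<epsilon> x) (carrier M)),
     smult = (\<lambda>c \<delta>. restrict (\<lambda>x. c * \<delta> x) (carrier M))\<rparr>"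

definition isomorphic_spaces :: "(complex, 'a) module \<Rightarrow> (complex, 'b) module \<Rightarrow> bool" where
  "isomorphic_spaces M N \<longleftrightarrow>
    (\<exists>h. linear_map complex_field M N h \<and> bij_betw h (carrier M) (carrier N))"

text \<open>
  Zariski tangent space \<open>(m / m\<^sup>2)\<^sup>*\<close> of a local algebra \<open>R\<close> with residue field the complex numbers;
  the maximal ideal \<open>m\<close> of a local ring is the set of its non-units.
\<close>

definition nonunits :: "('a, 'b) ring_scheme \<Rightarrow> 'a set" where
  "nonunits R = carrier R - Units R"

definition zariski_tangent :: "(complex, 'a) module \<Rightarrow> (complex, 'a set \<Rightarrow> complex) module" where
  "zariski_tangent R =
    dual_module (quotient_module (R\<lparr>carrier := nonunits R\<rparr>) (nonunits R \<cdot>\<^bsub>R\<^esub> nonunits R))"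


section \<open>ADHM data\<close>

text \<open>
  \<open>V = \<complex>\<^sup>k\<close> and \<open>W = \<complex>\<^sup>r\<close> are indexed by finite types. A triple \<open>(B, I, J)\<close> is given in the bases
  \<open>w\<^sub>1, w\<^sub>2\<close> of degree one and \<open>w\<^sub>1 w\<^sub>2\<close> of degree two of the quadratic dual algebra, i.e. as
  \<open>(B\<^sub>1, B\<^sub>2, I, J)\<close> with \<open>B\<^sub>1, B\<^sub>2 : V \<rightarrow> V\<close>, \<open>I : W \<rightarrow> V\<close> and \<open>J : V \<rightarrow> W\<close>.
\<close>

type_synonym ('k, 'r) adhm =
  "(complex^'k^'k) \<times> (complex^'k^'k) \<times> (complex^'r^'k) \<times> (complex^'k^'r)"

definition mscale :: "complex \<Rightarrow> complex^'n^'m \<Rightarrow> complex^'n^'m" where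
  "mscale c A = (\<chi> i. c *s (A $ i))"

fun adhm_scale :: "complex \<Rightarrow> ('k::finite, 'r::finite) adhm \<Rightarrow> ('k, 'r) adhm" where
  "adhm_scale c (B1, B2, I, J) = (mscale c B1, mscale c B2, mscale c I, mscale c J)"

text \<open>
  The coefficient of \<open>w\<^sub>1 w\<^sub>2\<close>: the relations \<open>w\<^sub>1\<^sup>2 = w\<^sub>2\<^sup>2 = 0\<close> and \<open>w\<^sub>1 w\<^sub>2 = - q\<^sup>2 w\<^sub>2 w\<^sub>1\<close> turn
  the \<open>w\<^sub>2 w\<^sub>1\<close> term \<open>B\<^sub>2 C\<^sub>1\<close> into \<open>- q\<^sup>-\<^sup>2 B\<^sub>2 C\<^sub>1\<close>.
\<close>

fun wedge :: "complex \<Rightarrow> (complex^'k^'k) \<times> (complex^'k^'k) \<Rightarrow>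
    (complex^'k^'k) \<times> (complex^'k^'k) \<Rightarrow> complex^'k::finite^'k" where
  "wedge q (B1, B2) (C1, C2) = B1 ** C2 - mscale (inverse (q\<^sup>2)) (B2 ** C1)"

fun mu_c :: "complex \<Rightarrow> ('k::finite, 'r::finite) adhm \<Rightarrow> complex^'k^'k" where
  "mu_c q (B1, B2, I, J) = wedge q (B1, B2) (B1, B2) + I ** J"

fun stable :: "('k::finite, 'r::finite) adhm \<Rightarrow> bool" where
  "stable (B1, B2, I, J) \<longleftrightarrow>
    \<not> (\<exists>S. vec.subspace S \<and> S \<noteq> UNIV \<and>
        (\<forall>v\<in>S. B1 *v v \<in> S \<and> B2 *v v \<in> S) \<and> (\<forall>w. I *v w \<in> S))"

fun act :: "complex^'k^'k \<Rightarrow> ('k::finite, 'r::finite) adhm \<Rightarrow> ('k, 'r) adhm" where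
  "act g (B1, B2, I, J) =
    (g ** B1 ** matrix_inv g, g ** B2 ** matrix_inv g, g ** I, J ** matrix_inv g)"

definition orbit :: "('k::finite, 'r::finite) adhm \<Rightarrow> ('k, 'r) adhm set" where
  "orbit x = {act g x | g. invertible g}"


section \<open>The moduli space as a geometric invariant theory quotient\<close>

text \<open>
  The closed points are the orbits of the stable triples on which \<open>mu_c\<close> vanishes.
\<close>

definition moduli_space :: "complex \<Rightarrow> ('k::finite, 'r::finite) adhm set set" where
  "moduli_space q = {orbit x | x. stable x \<and> mu_c q x = 0}"

text \<open>
  The coordinate ring of the affine space of triples; as the field is infinite, polynomials are
  identified with polynomial functions.
\<close>

inductive_set polys :: "(('k::finite, 'r::finite) adhm \<Rightarrow> complex) set" where
  const: "(\<lambda>x. c) \<in> polys"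
| coord_B1: "(\<lambda>(B1, B2, I, J). B1 $ i $ j) \<in> polys"
| coord_B2: "(\<lambda>(B1, B2, I, J). B2 $ i $ j) \<in> polys"
| coord_I: "(\<lambda>(B1, B2, I, J). I $ i $ s) \<in> polys"
| coord_J: "(\<lambda>(B1, B2, I, J). J $ s $ i) \<in> polys"
| add: "f \<in> polys \<Longrightarrow> g \<in> polys \<Longrightarrow> (\<lambda>x. f x + g x) \<in> polys"
| mult: "f \<in> polys \<Longrightarrow> g \<in> polys \<Longrightarrow> (\<lambda>x. f x * g x) \<in> polys"

text \<open>
  The ideal generated by the matrix entries of \<open>mu_c q\<close>, that is, the ideal of the scheme-theoretic
  fibre over \<open>0\<close> (no radical is taken). The coordinate ring of the fibre is \<open>polys / mu_ideal q\<close>.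
\<close>

definition mu_ideal :: "complex \<Rightarrow> (('k::finite, 'r::finite) adhm \<Rightarrow> complex) set" where
  "mu_ideal q =
    {\<lambda>x. \<Sum>i\<in>UNIV. \<Sum>j\<in>UNIV. c i j x * mu_c q x $ i $ j | c. \<forall>i j. c i j \<in> polys}"

text \<open>
  Representatives of the elements of weight \<open>det\<^sup>n\<close> in the coordinate ring of the fibre. These are
  the homogeneous elements of degree \<open>n\<close> of the graded ring whose Proj is the quotient; the sign
  of the character is the one for which semistability is the stability defined above.
\<close>

definition semi_inv :: "complex \<Rightarrow> nat \<Rightarrow> (('k::finite, 'r::finite) adhm \<Rightarrow> complex) set" where
  "semi_inv q n = {f \<in> polys. \<forall>g. invertible g \<longrightarrow>
     (\<lambda>x. f (act g x) - det g ^ n * f x) \<in> mu_ideal q}"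

text \<open>
  The local ring of Proj at a closed point \<open>p\<close> (an orbit): the degree zero part of the localisation
  at the homogeneous elements not vanishing at \<open>p\<close>. A pair \<open>(a, f)\<close> stands for \<open>a / f\<close>.
\<close>

definition fractions :: "complex \<Rightarrow> ('k::finite, 'r::finite) adhm set \<Rightarrow>
    ((('k, 'r) adhm \<Rightarrow> complex) \<times> (('k, 'r) adhm \<Rightarrow> complex)) set" where
  "fractions q p =
    {(a, f). \<exists>n. a \<in> semi_inv q n \<and> f \<in> semi_inv q n \<and> (\<forall>y\<in>p. f y \<noteq> 0)}"

definition frac_rel :: "complex \<Rightarrow> ('k::finite, 'r::finite) adhm set \<Rightarrow>
    ((('k, 'r) adhm \<Rightarrow> complex) \<times> (('k, 'r) adhm \<Rightarrow> complex)) rel" where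
  "frac_rel q p =
    {((a, f), (b, g)). (a, f) \<in> fractions q p \<and> (b, g) \<in> fractions q p \<and>
       (\<exists>n h. h \<in> semi_inv q n \<and> (\<forall>y\<in>p. h y \<noteq> 0) \<and>
          (\<lambda>x. h x * (a x * g x - b x * f x)) \<in> mu_ideal q)}"

type_synonym ('k, 'r) germ =
  "((('k, 'r) adhm \<Rightarrow> complex) \<times> (('k, 'r) adhm \<Rightarrow> complex)) set"

definition local_ring :: "complex \<Rightarrow> ('k::finite, 'r::finite) adhm set \<Rightarrow>
    (complex, ('k, 'r) germ) module" where
  "local_ring q p =
    \<lparr>carrier = fractions q p // frac_rel q p,
     mult = (\<lambda>A C. \<Union>(a, f)\<in>A. \<Union>(b, g)\<in>C. frac_rel q p `` {(\<lambda>x. a x * b x, \<lambda>x. f x * g x)}),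
     one = frac_rel q p `` {(\<lambda>x. 1, \<lambda>x. 1)},
     zero = frac_rel q p `` {(\<lambda>x. 0, \<lambda>x. 1)},
     add = (\<lambda>A C. \<Union>(a, f)\<in>A. \<Union>(b, g)\<in>C.
       frac_rel q p `` {(\<lambda>x. a x * g x + b x * f x, \<lambda>x. f x * g x)}),
     smult = (\<lambda>c A. \<Union>(a, f)\<in>A. frac_rel q p `` {(\<lambda>x. c * a x, f)})\<rparr>"

definition tangent_space :: "complex \<Rightarrow> ('k::finite, 'r::finite) adhm set \<Rightarrow>
    (complex, ('k, 'r) germ set \<Rightarrow> complex) module" where
  "tangent_space q p = zariski_tangent (local_ring q p)"


section \<open>The instanton deformation complex\<close>

fun d_phi :: "('k::finite, 'r::finite) adhm \<Rightarrow> complex^'k^'k \<Rightarrow> ('k, 'r) adhm" where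
  "d_phi (B1, B2, I, J) \<xi> =
    (\<xi> ** B1 - B1 ** \<xi>, \<xi> ** B2 - B2 ** \<xi>, \<xi> ** I, - (J ** \<xi>))"

fun d_mu :: "complex \<Rightarrow> ('k::finite, 'r::finite) adhm \<Rightarrow> ('k, 'r) adhm \<Rightarrow> complex^'k^'k" where
  "d_mu q (B1, B2, I, J) (b1, b2, i, j) =
    wedge q (b1, b2) (B1, B2) + wedge q (B1, B2) (b1, b2) + i ** J + I ** j"

definition adhm_kernel :: "complex \<Rightarrow> ('k::finite, 'r::finite) adhm \<Rightarrow>
    (complex, ('k, 'r) adhm) module" where
  "adhm_kernel q x =
    \<lparr>carrier = {v. d_mu q x v = 0}, mult = undefined, one = undefined,
     zero = 0, add = (+), smult = adhm_scale\<rparr>"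

definition H1 :: "complex \<Rightarrow> ('k::finite, 'r::finite) adhm \<Rightarrow>
    (complex, ('k, 'r) adhm set) module" where
  "H1 q x = quotient_module (adhm_kernel q x) (range (d_phi x))"

lemma mscale_nth [simp]: "mscale c A $ i $ j = c * A $ i $ j"
  by (simp add: mscale_def)

lemma mscale_mult_left: "mscale c A ** B = mscale c (A ** B)"
  and mscale_mult_right: "A ** mscale c B = mscale c (A ** B)"
  by (simp_all add: vec_eq_iff matrix_matrix_mult_def sum_distrib_left mult_ac)

lemma matrix_mult_uminus_right: "A ** (- B) = - (A ** (B :: complex^'n^'m))"
  by (simp add: vec_eq_iff matrix_matrix_mult_def sum_negf)

lemma matrix_mult_diff_left: "(A - A') ** B = A ** B - A' ** (B :: complex^'n^'m)"
  and matrix_mult_diff_right: "C ** (B - B') = C ** B - C ** (B' :: complex^'n^'m)"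
  by (simp_all add: vec_eq_iff matrix_matrix_mult_def sum_subtractf algebra_simps)

lemma matrix_mult_add_left: "(A + A') ** B = A ** B + A' ** (B :: complex^'n^'m)"
  by (simp add: vec_eq_iff matrix_matrix_mult_def sum.distrib algebra_simps)

text \<open>The differentials compose to zero, so that the quotient in \<open>H1\<close> is by a subspace.\<close>

lemma d_mu_d_phi:
  fixes x :: "('k::finite, 'r::finite) adhm"
  assumes "mu_c q x = 0"
  shows "d_mu q x (d_phi x \<xi>) = 0"
proof -
  obtain B1 B2 I J where x: "x = (B1, B2, I, J)"
    by (cases x) auto
  have scale_diff: "mscale c (A - B) = mscale c A - mscale c B" for c and A B :: "complex^'k^'k"
    by (simp add: vec_eq_iff algebra_simps)
  have "d_mu q x (d_phi x \<xi>) = \<xi> ** mu_c q x - mu_c q x ** \<xi>"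
    by (simp add: x matrix_mult_diff_left matrix_mult_diff_right matrix_mult_uminus_right
        mscale_mult_left mscale_mult_right scale_diff matrix_mul_assoc
        matrix_add_ldistrib matrix_mult_add_left)
  then show ?thesis
    using assms by simp
qed

end

theory Submission
  imports Defs
begin

text \<open>
  Stability of \<open>x\<close> provides a polynomial matrix \<open>M\<close> on the space of triples with \<open>M (g \<cdot> y) = g M y\<close> and
  \<open>M x = 1\<close>. On the open set where \<open>D = det M\<close> does not vanish, \<open>N y = (M y)\<^sup>-\<^sup>1 \<cdot> y\<close> is therefore an
  invariant retraction onto the slice \<open>M = 1\<close>, and every semi-invariant \<open>a\<close> of weight \<open>n\<close> satisfies
  \<open>a / D\<^sup>n = a \<circ> N\<close> in the local ring. Hence the map sending \<open>v \<in> ker d\<mu>\<close> to the tangent vector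
  \<open>a / f \<mapsto> da(v) / f(x)\<close> is onto: a given tangent vector is recovered from its values on the coordinates
  of \<open>N\<close>, and it comes from \<open>ker d\<mu>\<close> because the entries of \<open>\<mu> \<circ> N = M\<^sup>-\<^sup>1 \<mu> M\<close> are zero in the local
  ring. If \<open>v\<close> is mapped to zero, then \<open>dN(v) = 0\<close>, and differentiating \<open>M y \<cdot> N y = y\<close> yields
  \<open>v = d\<phi>(dM(v))\<close>; conversely semi-invariants vanishing at \<open>x\<close> are constant along the orbit.
\<close>

section \<open>Quotients and duals of complex vector spaces\<close>

text \<open>The obstacle is that identities in the local ring cannot be checked pointwise. No
  radical of \<open>mu_ideal\<close> is taken, so equality of fractions means membership in this
  very ideal, and a semi-invariant obeys its transformation law only modulo it, separately for each
  constant \<open>g\<close>. The identity \<open>a / D^n = a o N\<close>, however, asks for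
  \<open>g = (M y)^-1\<close>, which varies with \<open>y\<close>. It is reached by writing
  \<open>a (act g y) - det g ^ n * a y\<close> as a finite sum of products of a function of
  \<open>g\<close> and a polynomial in \<open>y\<close>, and by arranging through Gaussian
  elimination that all these polynomials lie in \<open>mu_ideal\<close>; only then is the varying
  \<open>g\<close> inserted. The second constraint is that \<open>a o N\<close> is rational in
  \<open>y\<close>, while fractions are built from polynomials defined on all triples. It is
  therefore represented by polynomial lifts \<open>b = D^n * (a o N)\<close>, whose exponent is
  large enough to clear the denominators and to make \<open>b\<close> vanish where \<open>D\<close>
  does. Their transformation law is exact, and they are closed under sums and products, which allows
  induction over polynomials.\<close>

lemma complex_field_simps [simp]:
  "carrier complex_field = UNIV" "mult complex_field = (*)" "one complex_field = 1"
  "zero complex_field = 0" "add complex_field = (+)"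
  by (simp_all add: complex_field_def)

lemma complex_line_simps [simp]:
  "carrier complex_line = UNIV" "zero complex_line = 0" "add complex_line = (+)"
  "smult complex_line = (*)"
  by (simp_all add: complex_line_def)

lemma field_complex_field: "field complex_field"
proof -
  have "cring complex_field"
    by (unfold_locales) (auto simp: Units_def algebra_simps intro: exI[of _ "- _"] right_minus)
  then show ?thesis
  proof (rule cring.cring_fieldI2)
    show "\<exists>b\<in>carrier complex_field. a \<otimes>\<^bsub>complex_field\<^esub> b = \<one>\<^bsub>complex_field\<^esub>"
      if "a \<noteq> \<zero>\<^bsub>complex_field\<^esub>" for a
      using that by (intro bexI[of _ "inverse a"]) auto
  qed simp
qed

section \<open>Complex vector spaces through elementary axioms\<close>

definition cmodule :: "(complex, 'a) module \<Rightarrow> bool" where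
  "cmodule M \<longleftrightarrow> Module.module complex_field M"

lemma vectorspace_iff_cmodule: "vectorspace complex_field M \<longleftrightarrow> cmodule M"
  by (simp add: vectorspace_def cmodule_def field_complex_field)

lemma cmoduleI:
  assumes "\<And>x y. x \<in> carrier M \<Longrightarrow> y \<in> carrier M \<Longrightarrow> x \<oplus>\<^bsub>M\<^esub> y \<in> carrier M"
    and "\<zero>\<^bsub>M\<^esub> \<in> carrier M"
    and "\<And>x y z. x \<in> carrier M \<Longrightarrow> y \<in> carrier M \<Longrightarrow> z \<in> carrier M \<Longrightarrow>
      (x \<oplus>\<^bsub>M\<^esub> y) \<oplus>\<^bsub>M\<^esub> z = x \<oplus>\<^bsub>M\<^esub> (y \<oplus>\<^bsub>M\<^esub> z)"
    and "\<And>x y. x \<in> carrier M \<Longrightarrow> y \<in> carrier M \<Longrightarrow> x \<oplus>\<^bsub>M\<^esub> y = y \<oplus>\<^bsub>M\<^esub> x"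
    and "\<And>x. x \<in> carrier M \<Longrightarrow> \<zero>\<^bsub>M\<^esub> \<oplus>\<^bsub>M\<^esub> x = x"
    and smult: "\<And>c x. x \<in> carrier M \<Longrightarrow> c \<odot>\<^bsub>M\<^esub> x \<in> carrier M"
    and null: "\<And>x. x \<in> carrier M \<Longrightarrow> 0 \<odot>\<^bsub>M\<^esub> x = \<zero>\<^bsub>M\<^esub>"
    and ldistr: "\<And>c d x. x \<in> carrier M \<Longrightarrow> (c + d) \<odot>\<^bsub>M\<^esub> x = c \<odot>\<^bsub>M\<^esub> x \<oplus>\<^bsub>M\<^esub> d \<odot>\<^bsub>M\<^esub> x"
    and "\<And>c x y. x \<in> carrier M \<Longrightarrow> y \<in> carrier M \<Longrightarrow>
      c \<odot>\<^bsub>M\<^esub> (x \<oplus>\<^bsub>M\<^esub> y) = c \<odot>\<^bsub>M\<^esub> x \<oplus>\<^bsub>M\<^esub> c \<odot>\<^bsub>M\<^esub> y"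
    and "\<And>c d x. x \<in> carrier M \<Longrightarrow> (c * d) \<odot>\<^bsub>M\<^esub> x = c \<odot>\<^bsub>M\<^esub> (d \<odot>\<^bsub>M\<^esub> x)"
    and one: "\<And>x. x \<in> carrier M \<Longrightarrow> 1 \<odot>\<^bsub>M\<^esub> x = x"
  shows "cmodule M"
  unfolding cmodule_def
proof (rule moduleI)
  show "cring complex_field"
    using field_complex_field by (simp add: field_def domain_def)
  show "abelian_group M"
  proof (rule abelian_groupI)
    fix x assume x: "x \<in> carrier M"
    \<comment> \<open>The additive inverse is multiplication by the scalar -1, which is why the
      assumptions ask for none.\<close>
    have "(- 1) \<odot>\<^bsub>M\<^esub> x \<oplus>\<^bsub>M\<^esub> x = \<zero>\<^bsub>M\<^esub>"
      using ldistr[OF x, of "-1" 1] null[OF x] one[OF x] by simp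
    then show "\<exists>y\<in>carrier M. y \<oplus>\<^bsub>M\<^esub> x = \<zero>\<^bsub>M\<^esub>"
      using smult[OF x] by blast
  qed (use assms in auto)
qed (use assms in auto)

lemma cmoduleD:
  assumes "cmodule M"
  shows "\<And>x y. x \<in> carrier M \<Longrightarrow> y \<in> carrier M \<Longrightarrow> x \<oplus>\<^bsub>M\<^esub> y \<in> carrier M"
    and "\<zero>\<^bsub>M\<^esub> \<in> carrier M"
    and "\<And>x y z. x \<in> carrier M \<Longrightarrow> y \<in> carrier M \<Longrightarrow> z \<in> carrier M \<Longrightarrow>
      (x \<oplus>\<^bsub>M\<^esub> y) \<oplus>\<^bsub>M\<^esub> z = x \<oplus>\<^bsub>M\<^esub> (y \<oplus>\<^bsub>M\<^esub> z)"
    and "\<And>x y. x \<in> carrier M \<Longrightarrow> y \<in> carrier M \<Longrightarrow> x \<oplus>\<^bsub>M\<^esub> y = y \<oplus>\<^bsub>M\<^esub> x"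
    and "\<And>x. x \<in> carrier M \<Longrightarrow> \<zero>\<^bsub>M\<^esub> \<oplus>\<^bsub>M\<^esub> x = x"
    and "\<And>c x. x \<in> carrier M \<Longrightarrow> c \<odot>\<^bsub>M\<^esub> x \<in> carrier M"
    and "\<And>x. x \<in> carrier M \<Longrightarrow> 0 \<odot>\<^bsub>M\<^esub> x = \<zero>\<^bsub>M\<^esub>"
    and "\<And>c d x. x \<in> carrier M \<Longrightarrow> (c + d) \<odot>\<^bsub>M\<^esub> x = c \<odot>\<^bsub>M\<^esub> x \<oplus>\<^bsub>M\<^esub> d \<odot>\<^bsub>M\<^esub> x"
    and "\<And>c x y. x \<in> carrier M \<Longrightarrow> y \<in> carrier M \<Longrightarrow>
      c \<odot>\<^bsub>M\<^esub> (x \<oplus>\<^bsub>M\<^esub> y) = c \<odot>\<^bsub>M\<^esub> x \<oplus>\<^bsub>M\<^esub> c \<odot>\<^bsub>M\<^esub> y"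
    and "\<And>c d x. x \<in> carrier M \<Longrightarrow> (c * d) \<odot>\<^bsub>M\<^esub> x = c \<odot>\<^bsub>M\<^esub> (d \<odot>\<^bsub>M\<^esub> x)"
    and "\<And>x. x \<in> carrier M \<Longrightarrow> 1 \<odot>\<^bsub>M\<^esub> x = x"
    and "abelian_group M"
proof -
  interpret Module.module complex_field M using assms by (simp add: cmodule_def)
  show "\<And>x y. x \<in> carrier M \<Longrightarrow> y \<in> carrier M \<Longrightarrow> x \<oplus>\<^bsub>M\<^esub> y \<in> carrier M"
    and "\<zero>\<^bsub>M\<^esub> \<in> carrier M"
    and "\<And>x y z. x \<in> carrier M \<Longrightarrow> y \<in> carrier M \<Longrightarrow> z \<in> carrier M \<Longrightarrow>
      (x \<oplus>\<^bsub>M\<^esub> y) \<oplus>\<^bsub>M\<^esub> z = x \<oplus>\<^bsub>M\<^esub> (y \<oplus>\<^bsub>M\<^esub> z)"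
    and "\<And>x y. x \<in> carrier M \<Longrightarrow> y \<in> carrier M \<Longrightarrow> x \<oplus>\<^bsub>M\<^esub> y = y \<oplus>\<^bsub>M\<^esub> x"
    and "\<And>x. x \<in> carrier M \<Longrightarrow> \<zero>\<^bsub>M\<^esub> \<oplus>\<^bsub>M\<^esub> x = x"
    by (simp_all add: M.a_assoc) (rule M.a_comm)
  show "c \<odot>\<^bsub>M\<^esub> x \<in> carrier M" if "x \<in> carrier M" for c x
    using smult_closed[of c x] that by simp
  show "0 \<odot>\<^bsub>M\<^esub> x = \<zero>\<^bsub>M\<^esub>" if "x \<in> carrier M" for x
    using smult_l_null[of x] that by simp
  show "(c + d) \<odot>\<^bsub>M\<^esub> x = c \<odot>\<^bsub>M\<^esub> x \<oplus>\<^bsub>M\<^esub> d \<odot>\<^bsub>M\<^esub> x" if "x \<in> carrier M" for c d x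
    using smult_l_distr[of c d x] that by simp
  show "c \<odot>\<^bsub>M\<^esub> (x \<oplus>\<^bsub>M\<^esub> y) = c \<odot>\<^bsub>M\<^esub> x \<oplus>\<^bsub>M\<^esub> c \<odot>\<^bsub>M\<^esub> y" if "x \<in> carrier M" "y \<in> carrier M" for c x y
    using smult_r_distr[of c x y] that by simp
  show "(c * d) \<odot>\<^bsub>M\<^esub> x = c \<odot>\<^bsub>M\<^esub> (d \<odot>\<^bsub>M\<^esub> x)" if "x \<in> carrier M" for c d x
    using smult_assoc1[of c d x] that by simp
  show "1 \<odot>\<^bsub>M\<^esub> x = x" if "x \<in> carrier M" for x
    using smult_one[of x] that by simp
  show "abelian_group M" by (rule M.abelian_group_axioms)
qed

section \<open>Subspaces, cosets and quotient spaces\<close>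

definition csubmodule :: "(complex, 'a) module \<Rightarrow> 'a set \<Rightarrow> bool" where
  "csubmodule M N \<longleftrightarrow> cmodule M \<and> N \<subseteq> carrier M \<and> \<zero>\<^bsub>M\<^esub> \<in> N \<and>
    (\<forall>x\<in>N. \<forall>y\<in>N. x \<oplus>\<^bsub>M\<^esub> y \<in> N) \<and> (\<forall>c. \<forall>x\<in>N. c \<odot>\<^bsub>M\<^esub> x \<in> N)"

lemma csubmoduleD:
  assumes "csubmodule M N"
  shows "cmodule M" "N \<subseteq> carrier M" "\<zero>\<^bsub>M\<^esub> \<in> N" "\<And>x y. x \<in> N \<Longrightarrow> y \<in> N \<Longrightarrow> x \<oplus>\<^bsub>M\<^esub> y \<in> N"
    "\<And>c x. x \<in> N \<Longrightarrow> c \<odot>\<^bsub>M\<^esub> x \<in> N"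
  using assms by (auto simp: csubmodule_def)

lemma cmodule_minus:
  assumes "cmodule M" "x \<in> carrier M"
  shows "\<ominus>\<^bsub>M\<^esub> x = (- 1) \<odot>\<^bsub>M\<^esub> x"
proof -
  note D = cmoduleD[OF assms(1)]
  interpret abelian_group M by (rule D(12))
  have "(- 1) \<odot>\<^bsub>M\<^esub> x \<oplus>\<^bsub>M\<^esub> x = \<zero>\<^bsub>M\<^esub>"
    using D(8)[OF assms(2), of "-1" 1] D(7)[OF assms(2)] D(11)[OF assms(2)] by simp
  then show ?thesis
    using minus_equality D(6) assms(2) by blast
qed

lemma csubmodule_abelian_subgroup:
  assumes "csubmodule M N"
  shows "abelian_subgroup N M"
proof (rule abelian_subgroupI3)
  note D = csubmoduleD[OF assms]
  interpret abelian_group M by (rule cmoduleD(12)[OF D(1)])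
  show "abelian_group M" ..
  show "additive_subgroup N M"
  proof (rule additive_subgroup.intro, rule add.subgroupI)
    show "N \<noteq> {}" using D(3) by blast
    show "\<ominus>\<^bsub>M\<^esub> a \<in> N" if "a \<in> N" for a
      using cmodule_minus[OF D(1), of a] D(2) D(5)[OF that] that by auto
  qed (use D in auto)
qed

lemma quotient_module_simps [simp]:
  "carrier (quotient_module M N) = a_rcosets\<^bsub>M\<^esub> N"
  "zero (quotient_module M N) = N"
  "add (quotient_module M N) X Y = X <+>\<^bsub>M\<^esub> Y"
  by (simp_all add: quotient_module_def)

lemma quotient_carrier: "a_rcosets\<^bsub>M\<^esub> N = (\<lambda>x. N +>\<^bsub>M\<^esub> x) ` carrier M"
  by (auto simp: A_RCOSETS_def')

lemma quotient_add:
  assumes "csubmodule M N" "x \<in> carrier M" "y \<in> carrier M"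
  shows "(N +>\<^bsub>M\<^esub> x) <+>\<^bsub>M\<^esub> (N +>\<^bsub>M\<^esub> y) = N +>\<^bsub>M\<^esub> (x \<oplus>\<^bsub>M\<^esub> y)"
  using abelian_subgroup.a_rcos_sum[OF csubmodule_abelian_subgroup[OF assms(1)]] assms by blast

text \<open>The summand \<open>N\<close> added by the scalar multiplication of the quotient is
  absorbed because \<open>N\<close> is closed under addition and scaling; for \<open>c = 0\<close>
  it is what enlarges the single point zero to the whole coset.\<close>

lemma quotient_smult:
  assumes "csubmodule M N" "x \<in> carrier M"
  shows "c \<odot>\<^bsub>quotient_module M N\<^esub> (N +>\<^bsub>M\<^esub> x) = N +>\<^bsub>M\<^esub> (c \<odot>\<^bsub>M\<^esub> x)"
proof -
  note D = csubmoduleD[OF assms(1)]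
  note M = cmoduleD[OF D(1)]
  have N: "n \<in> carrier M" if "n \<in> N" for n using D(2) that by auto
  have eq: "(c \<odot>\<^bsub>M\<^esub> (n \<oplus>\<^bsub>M\<^esub> x)) \<oplus>\<^bsub>M\<^esub> n' = (c \<odot>\<^bsub>M\<^esub> n \<oplus>\<^bsub>M\<^esub> n') \<oplus>\<^bsub>M\<^esub> c \<odot>\<^bsub>M\<^esub> x"
    if "n \<in> N" "n' \<in> N" for n n'
    using M(1,3,4,6,9) N[OF that(1)] N[OF that(2)] assms(2) by metis
  have "c \<odot>\<^bsub>quotient_module M N\<^esub> (N +>\<^bsub>M\<^esub> x) =
      {(c \<odot>\<^bsub>M\<^esub> (n \<oplus>\<^bsub>M\<^esub> x)) \<oplus>\<^bsub>M\<^esub> n' | n n'. n \<in> N \<and> n' \<in> N}"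
    by (auto simp: quotient_module_def set_add_def' a_r_coset_def')
  also have "\<dots> = {(c \<odot>\<^bsub>M\<^esub> n \<oplus>\<^bsub>M\<^esub> n') \<oplus>\<^bsub>M\<^esub> c \<odot>\<^bsub>M\<^esub> x | n n'. n \<in> N \<and> n' \<in> N}"
    using eq by (auto; metis)
  also have "\<dots> = N +>\<^bsub>M\<^esub> (c \<odot>\<^bsub>M\<^esub> x)"
  proof -
    \<comment> \<open>Take zero for \<open>n\<close> and \<open>h\<close> for \<open>n'\<close>; a
      multiple of zero is zero because zero is itself \<open>0\<close> times zero.\<close>
    have "\<exists>n n'. h \<oplus>\<^bsub>M\<^esub> z = (c \<odot>\<^bsub>M\<^esub> n \<oplus>\<^bsub>M\<^esub> n') \<oplus>\<^bsub>M\<^esub> z \<and> n \<in> N \<and> n' \<in> N" if "h \<in> N" for h z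
      using that D(3) D(5)[OF D(3), of c] M(2,4,5,7,10) N
      by (metis mult_zero_right)
    moreover have "c \<odot>\<^bsub>M\<^esub> n \<oplus>\<^bsub>M\<^esub> n' \<in> N" if "n \<in> N" "n' \<in> N" for n n'
      using that D by blast
    ultimately show ?thesis
      unfolding a_r_coset_def' by blast
  qed
  finally show ?thesis .
qed

lemma coset_eq_iff:
  assumes "csubmodule M N" "x \<in> carrier M" "y \<in> carrier M"
  shows "N +>\<^bsub>M\<^esub> x = N +>\<^bsub>M\<^esub> y \<longleftrightarrow> x \<oplus>\<^bsub>M\<^esub> (- 1) \<odot>\<^bsub>M\<^esub> y \<in> N"
proof -
  note D = csubmoduleD[OF assms(1)]
  note M = cmoduleD[OF D(1)]
  interpret abelian_subgroup N M by (rule csubmodule_abelian_subgroup[OF assms(1)])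
  have "x \<oplus>\<^bsub>M\<^esub> (- 1) \<odot>\<^bsub>M\<^esub> y = x \<ominus>\<^bsub>M\<^esub> y"
    using cmodule_minus[OF D(1) assms(3)] by (simp add: a_minus_def)
  then show ?thesis
    using a_rcos_module[OF assms(3), of x] assms a_repr_independence' a_rcos_self
    by (metis a_minus_def a_repr_independence a_subgroup)
qed

lemma cmodule_quotient:
  assumes "csubmodule M N"
  shows "cmodule (quotient_module M N)"
proof -
  note D = csubmoduleD[OF assms]
  note M = cmoduleD[OF D(1)]
  have N: "N = N +>\<^bsub>M\<^esub> \<zero>\<^bsub>M\<^esub>"
    using abelian_group.a_coset_add_zero[OF M(12) D(2)] by simp
  have *: "\<zero>\<^bsub>quotient_module M N\<^esub> = N +>\<^bsub>M\<^esub> \<zero>\<^bsub>M\<^esub>"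
    using N by simp
  show ?thesis
    by (rule cmoduleI)
      (auto simp only: quotient_module_simps(1,3) * quotient_carrier quotient_add[OF assms]
        quotient_smult[OF assms] M(1-3,5-11) intro!: image_eqI, (metis M(4))+)
qed

section \<open>Linear functionals and duals of quotients\<close>

definition functional :: "(complex, 'a) module \<Rightarrow> ('a \<Rightarrow> complex) \<Rightarrow> bool" where
  "functional M \<phi> \<longleftrightarrow> (\<forall>x\<in>carrier M. \<forall>y\<in>carrier M. \<phi> (x \<oplus>\<^bsub>M\<^esub> y) = \<phi> x + \<phi> y) \<and>
    (\<forall>c. \<forall>x\<in>carrier M. \<phi> (c \<odot>\<^bsub>M\<^esub> x) = c * \<phi> x)"

lemma dual_carrier: "carrier (dual_module M) = {\<phi>. functional M \<phi>} \<inter> extensional (carrier M)"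
  by (auto simp: dual_module_def module_hom_def functional_def)

lemma dual_module_simps [simp]:
  "zero (dual_module M) = restrict (\<lambda>x. 0) (carrier M)"
  "add (dual_module M) \<delta> \<epsilon> = restrict (\<lambda>x. \<delta> x + \<epsilon> x) (carrier M)"
  "smult (dual_module M) c \<delta> = restrict (\<lambda>x. c * \<delta> x) (carrier M)"
  by (simp_all add: dual_module_def)

lemma cmodule_dual:
  assumes "cmodule M"
  shows "cmodule (dual_module M)"
proof -
  note M = cmoduleD[OF assms]
  show ?thesis
    by (rule cmoduleI)
      (auto simp: dual_carrier functional_def fun_eq_iff M(1,6) algebra_simps extensional_def restrict_def)
qed

text \<open>The value is read off an arbitrary representative, so it is meaningful only if
  \<open>\<phi>\<close> vanishes on \<open>N\<close>. The restriction makes the result extensional,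
  as membership in \<open>dual_module\<close> demands.\<close>

definition quotient_lift :: "(complex, 'a) module \<Rightarrow> 'a set \<Rightarrow> ('a \<Rightarrow> complex) \<Rightarrow> 'a set \<Rightarrow> complex" where
  "quotient_lift M N \<phi> = restrict (\<lambda>X. \<phi> (SOME y. y \<in> X)) (a_rcosets\<^bsub>M\<^esub> N)"

lemma functional_zero:
  assumes "cmodule M" "functional M \<phi>"
  shows "\<phi> \<zero>\<^bsub>M\<^esub> = 0"
  using cmoduleD(2,7)[OF assms(1)] assms(2) unfolding functional_def by (metis mult_zero_left)

lemma quotient_lift_coset:
  assumes "csubmodule M N" "functional M \<phi>" "\<And>n. n \<in> N \<Longrightarrow> \<phi> n = 0" "x \<in> carrier M"
  shows "quotient_lift M N \<phi> (N +>\<^bsub>M\<^esub> x) = \<phi> x"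
proof -
  note D = csubmoduleD[OF assms(1)]
  have "\<phi> y = \<phi> x" if y: "y \<in> N +>\<^bsub>M\<^esub> x" for y
    using y assms(2-4) D(2) unfolding a_r_coset_def' functional_def
    by auto
  moreover have "\<exists>y. y \<in> N +>\<^bsub>M\<^esub> x"
    using D(3) by (auto simp: a_r_coset_def')
  ultimately have "\<phi> (SOME y. y \<in> N +>\<^bsub>M\<^esub> x) = \<phi> x"
    by (metis someI_ex)
  then show ?thesis
    using assms(4) by (simp add: quotient_lift_def quotient_carrier)
qed

lemma quotient_lift_dual:
  assumes "csubmodule M N" "functional M \<phi>" "\<And>n. n \<in> N \<Longrightarrow> \<phi> n = 0"
  shows "quotient_lift M N \<phi> \<in> carrier (dual_module (quotient_module M N))"
proof -
  note D = csubmoduleD[OF assms(1)]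
  note M = cmoduleD[OF D(1)]
  note L = quotient_lift_coset[OF assms]
  have "functional (quotient_module M N) (quotient_lift M N \<phi>)"
    using assms(2) unfolding functional_def
    by (auto simp: quotient_carrier quotient_add[OF assms(1)] quotient_smult[OF assms(1)] L M(1,6))
  then show ?thesis
    by (auto simp: dual_carrier quotient_lift_def)
qed

lemma dual_quotient_eqI:
  assumes "\<delta> \<in> carrier (dual_module (quotient_module M N))"
    and "\<epsilon> \<in> carrier (dual_module (quotient_module M N))"
    and "\<And>x. x \<in> carrier M \<Longrightarrow> \<delta> (N +>\<^bsub>M\<^esub> x) = \<epsilon> (N +>\<^bsub>M\<^esub> x)"
  shows "\<delta> = \<epsilon>"
  using assms unfolding dual_carrier
  by (intro extensionalityI[of _ "a_rcosets\<^bsub>M\<^esub> N"]) (auto simp: quotient_carrier)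

text \<open>Pullback along the projection, the converse of \<open>quotient_lift\<close>: the dual of
  a quotient is the space of functionals killing \<open>N\<close>.\<close>

lemma dual_quotient_functional:
  assumes "csubmodule M N" "\<delta> \<in> carrier (dual_module (quotient_module M N))"
  shows "functional M (\<lambda>x. \<delta> (N +>\<^bsub>M\<^esub> x))" "\<And>n. n \<in> N \<Longrightarrow> \<delta> (N +>\<^bsub>M\<^esub> n) = 0"
proof -
  note D = csubmoduleD[OF assms(1)]
  note M = cmoduleD[OF D(1)]
  have \<delta>: "functional (quotient_module M N) \<delta>"
    using assms(2) by (simp add: dual_carrier)
  have add: "\<delta> ((N +>\<^bsub>M\<^esub> x) <+>\<^bsub>M\<^esub> (N +>\<^bsub>M\<^esub> y)) = \<delta> (N +>\<^bsub>M\<^esub> x) + \<delta> (N +>\<^bsub>M\<^esub> y)"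
    if "x \<in> carrier M" "y \<in> carrier M" for x y
    using \<delta> that unfolding functional_def by (auto simp: quotient_carrier)
  have smult: "\<delta> (c \<odot>\<^bsub>quotient_module M N\<^esub> (N +>\<^bsub>M\<^esub> x)) = c * \<delta> (N +>\<^bsub>M\<^esub> x)"
    if "x \<in> carrier M" for c x
    using \<delta> that unfolding functional_def by (auto simp: quotient_carrier)
  show "functional M (\<lambda>x. \<delta> (N +>\<^bsub>M\<^esub> x))"
    using add smult unfolding functional_def
    by (simp add: quotient_add[OF assms(1)] quotient_smult[OF assms(1)])
  fix n assume n: "n \<in> N"
  interpret abelian_subgroup N M by (rule csubmodule_abelian_subgroup[OF assms(1)])
  have "N +>\<^bsub>M\<^esub> n = N"
    using a_coset_join2 a_subgroup n D(2) by blast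
  then show "\<delta> (N +>\<^bsub>M\<^esub> n) = 0"
    using functional_zero[OF cmodule_quotient[OF assms(1)] \<delta>] by simp
qed

text \<open>First isomorphism theorem, stated so that the isomorphism runs from the target
  \<open>T\<close> back to the quotient. That \<open>N\<close> is a subspace follows from its being
  a kernel.\<close>

lemma isomorphic_spaces_quotient:
  assumes M: "cmodule M" and T: "cmodule T"
    and closed: "\<And>x. x \<in> carrier M \<Longrightarrow> \<Psi> x \<in> carrier T"
    and add: "\<And>x y. x \<in> carrier M \<Longrightarrow> y \<in> carrier M \<Longrightarrow> \<Psi> (x \<oplus>\<^bsub>M\<^esub> y) = \<Psi> x \<oplus>\<^bsub>T\<^esub> \<Psi> y"
    and smult: "\<And>c x. x \<in> carrier M \<Longrightarrow> \<Psi> (c \<odot>\<^bsub>M\<^esub> x) = c \<odot>\<^bsub>T\<^esub> \<Psi> x"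
    and surj: "\<And>t. t \<in> carrier T \<Longrightarrow> \<exists>x\<in>carrier M. \<Psi> x = t"
    and ker: "N = {x \<in> carrier M. \<Psi> x = \<zero>\<^bsub>T\<^esub>}"
  shows "isomorphic_spaces T (quotient_module M N)"
proof -
  note MD = cmoduleD[OF M] and TD = cmoduleD[OF T]
  have zero: "\<Psi> \<zero>\<^bsub>M\<^esub> = \<zero>\<^bsub>T\<^esub>"
    using smult[OF MD(2), of 0] MD(7)[OF MD(2)] TD(7)[OF closed[OF MD(2)]] by simp
  have TZ: "c \<odot>\<^bsub>T\<^esub> \<zero>\<^bsub>T\<^esub> = \<zero>\<^bsub>T\<^esub>" for c
    using TD(7,10)[OF TD(2)] by (metis mult_zero_right)
  have sub: "csubmodule M N"
    unfolding csubmodule_def ker using M MD TD zero TZ by (auto simp: add smult)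
  note D = csubmoduleD[OF sub]
  \<comment> \<open>The inverse of the map induced by \<open>\<Psi>\<close>; different choices of a
    preimage differ by an element of the kernel and give the same coset.\<close>
  define h where "h t = N +>\<^bsub>M\<^esub> (SOME x. x \<in> carrier M \<and> \<Psi> x = t)" for t
  have eq_iff: "N +>\<^bsub>M\<^esub> x = N +>\<^bsub>M\<^esub> y \<longleftrightarrow> \<Psi> x = \<Psi> y" if "x \<in> carrier M" "y \<in> carrier M" for x y
  proof -
    have "\<Psi> (x \<oplus>\<^bsub>M\<^esub> (- 1) \<odot>\<^bsub>M\<^esub> y) = \<Psi> x \<oplus>\<^bsub>T\<^esub> (- 1) \<odot>\<^bsub>T\<^esub> \<Psi> y"
      using that MD(6) by (simp add: add smult)
    also have "\<dots> = \<Psi> x \<ominus>\<^bsub>T\<^esub> \<Psi> y"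
      using cmodule_minus[OF T closed[OF that(2)]] by (simp add: a_minus_def)
    also have "\<dots> = \<zero>\<^bsub>T\<^esub> \<longleftrightarrow> \<Psi> x = \<Psi> y"
    proof -
      interpret abelian_group T by (rule TD(12))
      show ?thesis
        using closed[OF that(1)] closed[OF that(2)] minus_equality[of "\<Psi> x" "\<ominus>\<^bsub>T\<^esub> \<Psi> y"]
        by (auto simp: a_minus_def r_neg)
    qed
    finally have "\<Psi> (x \<oplus>\<^bsub>M\<^esub> (- 1) \<odot>\<^bsub>M\<^esub> y) = \<zero>\<^bsub>T\<^esub> \<longleftrightarrow> \<Psi> x = \<Psi> y" .
    then show ?thesis
      using coset_eq_iff[OF sub that] that MD(1,6) by (simp add: ker)
  qed
  have h: "h (\<Psi> x) = N +>\<^bsub>M\<^esub> x" if "x \<in> carrier M" for x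
  proof -
    have "(SOME y. y \<in> carrier M \<and> \<Psi> y = \<Psi> x) \<in> carrier M \<and>
        \<Psi> (SOME y. y \<in> carrier M \<and> \<Psi> y = \<Psi> x) = \<Psi> x"
      by (rule someI[of _ x]) (use that in auto)
    then show ?thesis
      unfolding h_def using eq_iff that by blast
  qed
  have Q: "cmodule (quotient_module M N)"
    by (rule cmodule_quotient[OF sub])
  have "h \<in> module_hom complex_field T (quotient_module M N)"
  proof -
    have "h (s \<oplus>\<^bsub>T\<^esub> t) = h s <+>\<^bsub>M\<^esub> h t" if st: "s \<in> carrier T" "t \<in> carrier T" for s t
    proof -
      obtain x y where "x \<in> carrier M" "y \<in> carrier M" "s = \<Psi> x" "t = \<Psi> y"
        using surj st by metis
      then show ?thesis
        by (simp add: add[symmetric] h MD(1) quotient_add[OF sub])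
    qed
    moreover have "h (c \<odot>\<^bsub>T\<^esub> s) = c \<odot>\<^bsub>quotient_module M N\<^esub> h s" if st: "s \<in> carrier T" for c s
    proof -
      obtain x where "x \<in> carrier M" "s = \<Psi> x"
        using surj st by metis
      then show ?thesis
        by (simp add: smult[symmetric] h MD(6) quotient_smult[OF sub])
    qed
    moreover have "h s \<in> carrier (quotient_module M N)" if st: "s \<in> carrier T" for s
      using surj[OF st] h by (auto simp: quotient_carrier)
    ultimately show ?thesis
      by (auto simp: module_hom_def)
  qed
  then have "linear_map complex_field T (quotient_module M N) h"
    using T Q by (simp add: linear_map_def mod_hom_def mod_hom_axioms_def
        vectorspace_iff_cmodule) (simp add: cmodule_def)
  moreover have "bij_betw h (carrier T) (carrier (quotient_module M N))"
  proof -
    have "inj_on h (carrier T)"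
      using surj h eq_iff by (intro inj_onI) metis
    moreover have "h ` carrier T = carrier (quotient_module M N)"
    proof -
      have "carrier T = \<Psi> ` carrier M" using surj closed by blast
      then show ?thesis by (auto simp: h image_image quotient_carrier)
    qed
    ultimately show ?thesis by (simp add: bij_betw_def)
  qed
  ultimately show ?thesis
    unfolding isomorphic_spaces_def by blast
qed

declare split_paired_All [simp del] split_paired_Ex [simp del]

section \<open>Polynomials on the space of triples\<close>

text \<open>Projections, instead of tuple patterns, let a triple remain a single variable that can
  be replaced by \<open>act g y\<close> or by a point of a curve.\<close>

abbreviation adhm_B1 :: "('k::finite, 'r::finite) adhm \<Rightarrow> complex^'k^'k" where
  "adhm_B1 y \<equiv> fst y"

abbreviation adhm_B2 :: "('k::finite, 'r::finite) adhm \<Rightarrow> complex^'k^'k" where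
  "adhm_B2 y \<equiv> fst (snd y)"

abbreviation adhm_I :: "('k::finite, 'r::finite) adhm \<Rightarrow> complex^'r^'k" where
  "adhm_I y \<equiv> fst (snd (snd y))"

abbreviation adhm_J :: "('k::finite, 'r::finite) adhm \<Rightarrow> complex^'k^'r" where
  "adhm_J y \<equiv> snd (snd (snd y))"

lemma act_def:
  "act g y = (g ** adhm_B1 y ** matrix_inv g, g ** adhm_B2 y ** matrix_inv g, g ** adhm_I y,
    adhm_J y ** matrix_inv g)"
  by (cases y) simp

lemma mu_c_def:
  "mu_c q y = adhm_B1 y ** adhm_B2 y - mscale (inverse (q\<^sup>2)) (adhm_B2 y ** adhm_B1 y)
    + adhm_I y ** adhm_J y"
  by (cases y) simp

lemma adhm_scale_def:
  "adhm_scale c y = (mscale c (adhm_B1 y), mscale c (adhm_B2 y), mscale c (adhm_I y), mscale c (adhm_J y))"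
  by (cases y) simp

lemma polys_coord [simp]:
  "(\<lambda>y. adhm_B1 y $ i $ j) \<in> polys" "(\<lambda>y. adhm_B2 y $ i $ j) \<in> polys"
  "(\<lambda>y. adhm_I y $ i $ s) \<in> polys" "(\<lambda>y. adhm_J y $ s $ i) \<in> polys"
  using polys.coord_B1[of i j] polys.coord_B2[of i j] polys.coord_I[of i s] polys.coord_J[of s i]
  by (simp_all add: case_prod_unfold)

lemma polys_induct [consumes 1, case_names const B1 B2 I J add mult]:
  assumes "f \<in> polys"
    and "\<And>c. P (\<lambda>y. c)"
    and "\<And>i j. P (\<lambda>y. adhm_B1 y $ i $ j)" "\<And>i j. P (\<lambda>y. adhm_B2 y $ i $ j)"
    and "\<And>i s. P (\<lambda>y. adhm_I y $ i $ s)" "\<And>s i. P (\<lambda>y. adhm_J y $ s $ i)"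
    and "\<And>f g. f \<in> polys \<Longrightarrow> P f \<Longrightarrow> g \<in> polys \<Longrightarrow> P g \<Longrightarrow> P (\<lambda>y. f y + g y)"
    and "\<And>f g. f \<in> polys \<Longrightarrow> P f \<Longrightarrow> g \<in> polys \<Longrightarrow> P g \<Longrightarrow> P (\<lambda>y. f y * g y)"
  shows "P f"
  using assms(1)
proof induction
  case (coord_B1 i j) then show ?case using assms(3)[of i j] by (simp add: case_prod_unfold)
next
  case (coord_B2 i j) then show ?case using assms(4)[of i j] by (simp add: case_prod_unfold)
next
  case (coord_I i s) then show ?case using assms(5)[of i s] by (simp add: case_prod_unfold)
next
  case (coord_J s i) then show ?case using assms(6)[of s i] by (simp add: case_prod_unfold)
qed (use assms in auto)

lemmas polys_intros [simp, intro] = polys.const polys.add polys.mult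

lemma polys_uminus [simp, intro]: "f \<in> polys \<Longrightarrow> (\<lambda>y. - f y) \<in> polys"
  using polys.mult[OF polys.const[of "-1"]] by force

lemma polys_diff [simp, intro]: "f \<in> polys \<Longrightarrow> g \<in> polys \<Longrightarrow> (\<lambda>y. f y - g y) \<in> polys"
  using polys.add[OF _ polys_uminus, of f g] by simp

lemma polys_sum [simp, intro]: "(\<And>i. i \<in> S \<Longrightarrow> f i \<in> polys) \<Longrightarrow> (\<lambda>y. \<Sum>i\<in>S. f i y) \<in> polys"
  by (induction S rule: infinite_finite_induct) auto

lemma polys_prod [simp, intro]: "(\<And>i. i \<in> S \<Longrightarrow> f i \<in> polys) \<Longrightarrow> (\<lambda>y. \<Prod>i\<in>S. f i y) \<in> polys"
  by (induction S rule: infinite_finite_induct) auto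

lemma polys_power [simp, intro]: "f \<in> polys \<Longrightarrow> (\<lambda>y. f y ^ n) \<in> polys"
  by (induction n) auto

section \<open>Matrices with polynomial entries\<close>

definition poly_matrix :: "(('k::finite, 'r::finite) adhm \<Rightarrow> complex^'n^'m) \<Rightarrow> bool" where
  "poly_matrix A \<longleftrightarrow> (\<forall>i j. (\<lambda>y. A y $ i $ j) \<in> polys)"

lemma poly_matrix_const [simp]: "poly_matrix (\<lambda>y. C)"
  by (simp add: poly_matrix_def)

lemma poly_matrix_coord [simp]:
  "poly_matrix (\<lambda>y. adhm_B1 y)" "poly_matrix (\<lambda>y. adhm_B2 y)"
  "poly_matrix (\<lambda>y. adhm_I y)" "poly_matrix (\<lambda>y. adhm_J y)"
  by (simp_all add: poly_matrix_def)

lemma poly_matrix_mult [intro]: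
  "poly_matrix A \<Longrightarrow> poly_matrix B \<Longrightarrow> poly_matrix (\<lambda>y. A y ** B y)"
  by (auto simp: poly_matrix_def matrix_matrix_mult_def)

lemma poly_matrix_add [intro]:
  "poly_matrix A \<Longrightarrow> poly_matrix B \<Longrightarrow> poly_matrix (\<lambda>y. A y + B y)"
  by (auto simp: poly_matrix_def)

lemma poly_matrix_diff [intro]:
  "poly_matrix A \<Longrightarrow> poly_matrix B \<Longrightarrow> poly_matrix (\<lambda>y. A y - B y)"
  by (auto simp: poly_matrix_def)

lemma poly_matrix_mscale [intro]:
  "f \<in> polys \<Longrightarrow> poly_matrix A \<Longrightarrow> poly_matrix (\<lambda>y. mscale (f y) (A y))"
  by (auto simp: poly_matrix_def)

lemma polys_det: "poly_matrix A \<Longrightarrow> (\<lambda>y. det (A y)) \<in> polys"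
  by (auto simp: det_def poly_matrix_def)

lemma poly_matrix_mu_c: "poly_matrix (mu_c q)"
  unfolding mu_c_def[abs_def] by (intro poly_matrix_add poly_matrix_diff poly_matrix_mult poly_matrix_mscale) auto

text \<open>For fixed \<open>g\<close> the matrix \<open>matrix_inv g\<close> is a constant, so
  every coordinate of \<open>act g y\<close> is linear in \<open>y\<close>.\<close>

lemma polys_act:
  fixes f :: "('k::finite, 'r::finite) adhm \<Rightarrow> complex"
  assumes "f \<in> polys"
  shows "(\<lambda>y. f (act g y)) \<in> polys"
  using assms
proof (induction rule: polys_induct)
  case (B1 i j)
  have "poly_matrix (\<lambda>y :: ('k, 'r) adhm. g ** adhm_B1 y ** matrix_inv g)"
    by (intro poly_matrix_mult) auto
  then show ?case by (simp add: act_def poly_matrix_def)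
next
  case (B2 i j)
  have "poly_matrix (\<lambda>y :: ('k, 'r) adhm. g ** adhm_B2 y ** matrix_inv g)"
    by (intro poly_matrix_mult) auto
  then show ?case by (simp add: act_def poly_matrix_def)
next
  case (I i s)
  have "poly_matrix (\<lambda>y :: ('k, 'r) adhm. g ** adhm_I y)"
    by (intro poly_matrix_mult) auto
  then show ?case by (simp add: act_def poly_matrix_def)
next
  case (J s i)
  have "poly_matrix (\<lambda>y :: ('k, 'r) adhm. adhm_J y ** matrix_inv g)"
    by (intro poly_matrix_mult) auto
  then show ?case by (simp add: act_def poly_matrix_def)
qed auto

section \<open>The ideal of the scheme-theoretic fibre\<close>

lemma mu_idealI: "(\<And>i j. c i j \<in> polys) \<Longrightarrow> (\<lambda>y. \<Sum>i\<in>UNIV. \<Sum>j\<in>UNIV. c i j y * mu_c q y $ i $ j) \<in> mu_ideal q"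
  by (auto simp: mu_ideal_def)

lemma mu_ideal_add [intro]:
  assumes "f \<in> mu_ideal q" "g \<in> mu_ideal q"
  shows "(\<lambda>y. f y + g y) \<in> mu_ideal q"
proof -
  obtain c d where c: "\<And>i j. c i j \<in> polys" "f = (\<lambda>x. \<Sum>i\<in>UNIV. \<Sum>j\<in>UNIV. c i j x * mu_c q x $ i $ j)"
    and d: "\<And>i j. d i j \<in> polys" "g = (\<lambda>x. \<Sum>i\<in>UNIV. \<Sum>j\<in>UNIV. d i j x * mu_c q x $ i $ j)"
    using assms unfolding mu_ideal_def by blast
  have "(\<lambda>y. \<Sum>i\<in>UNIV. \<Sum>j\<in>UNIV. (c i j y + d i j y) * mu_c q y $ i $ j) \<in> mu_ideal q"
    using c d by (intro mu_idealI) auto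
  then show ?thesis
    by (simp add: c d algebra_simps sum.distrib)
qed

lemma mu_ideal_mult [intro]:
  assumes "p \<in> polys" "f \<in> mu_ideal q"
  shows "(\<lambda>y. p y * f y) \<in> mu_ideal q"
proof -
  obtain c where c: "\<And>i j. c i j \<in> polys" "f = (\<lambda>x. \<Sum>i\<in>UNIV. \<Sum>j\<in>UNIV. c i j x * mu_c q x $ i $ j)"
    using assms unfolding mu_ideal_def by blast
  have "(\<lambda>y. \<Sum>i\<in>UNIV. \<Sum>j\<in>UNIV. (p y * c i j y) * mu_c q y $ i $ j) \<in> mu_ideal q"
    using c assms(1) by (intro mu_idealI) auto
  then show ?thesis
    by (simp add: c sum_distrib_left mult_ac)
qed

lemma mu_ideal_zero [simp]: "(\<lambda>y. 0) \<in> mu_ideal q"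
  using mu_idealI[of "\<lambda>i j y. 0" q] by simp

lemma mu_ideal_scale [intro]: "f \<in> mu_ideal q \<Longrightarrow> (\<lambda>y. c * f y) \<in> mu_ideal q"
  using mu_ideal_mult[OF polys.const[of c]] by auto

lemma mu_ideal_diff [intro]:
  "f \<in> mu_ideal q \<Longrightarrow> g \<in> mu_ideal q \<Longrightarrow> (\<lambda>y. f y - g y) \<in> mu_ideal q"
  using mu_ideal_add[OF _ mu_ideal_scale[of g q "-1"], of f] by simp

lemma mu_ideal_sum [intro]:
  "(\<And>i. i \<in> S \<Longrightarrow> f i \<in> mu_ideal q) \<Longrightarrow> (\<lambda>y. \<Sum>i\<in>S. f i y) \<in> mu_ideal q"
  by (induction S rule: infinite_finite_induct) auto

lemma mu_ideal_entry: "(\<lambda>y. mu_c q y $ i $ j) \<in> mu_ideal q"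
proof -
  have *: "(\<Sum>i'\<in>UNIV. \<Sum>j'\<in>UNIV. (if i' = i \<and> j' = j then 1 else 0) * mu_c q y $ i' $ j') = mu_c q y $ i $ j" for y
  proof -
    have "(\<Sum>i'\<in>UNIV. \<Sum>j'\<in>UNIV. (if i' = i \<and> j' = j then 1 else 0) * mu_c q y $ i' $ j')
       = (\<Sum>i'\<in>UNIV. if i' = i then \<Sum>j'\<in>UNIV. if j' = j then mu_c q y $ i' $ j' else 0 else 0)"
      by (intro sum.cong) (auto simp: mult_delta_left)
    then show ?thesis by simp
  qed
  show ?thesis
    using mu_idealI[of "\<lambda>i' j' y. if i' = i \<and> j' = j then 1 else 0" q] by (simp add: *)
qed

lemma polys_mu_c [simp]: "(\<lambda>y. mu_c q y $ i $ j) \<in> polys"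
  by (rule poly_matrix_mu_c[unfolded poly_matrix_def, rule_format])

lemma mu_ideal_vanish: "f \<in> mu_ideal q \<Longrightarrow> mu_c q x = 0 \<Longrightarrow> f x = 0"
  by (auto simp: mu_ideal_def)

section \<open>Directional derivatives\<close>

definition matrix_deriv :: "(complex \<Rightarrow> complex^'n^'m) \<Rightarrow> complex^'n^'m \<Rightarrow> bool" where
  "matrix_deriv A A' \<longleftrightarrow> (\<forall>i j. ((\<lambda>t. A t $ i $ j) has_field_derivative A' $ i $ j) (at 0))"

lemma matrix_deriv_mult:
  assumes "matrix_deriv A A'" "matrix_deriv B B'"
  shows "matrix_deriv (\<lambda>t. A t ** B t) (A' ** B 0 + A 0 ** B')"
proof -
  have "((\<lambda>t. \<Sum>k\<in>UNIV. A t $ i $ k * B t $ k $ j) has_field_derivative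
      (\<Sum>k\<in>UNIV. A' $ i $ k * B 0 $ k $ j + B' $ k $ j * A 0 $ i $ k)) (at 0)" for i j
    using assms unfolding matrix_deriv_def
    by (intro DERIV_sum DERIV_mult) auto
  then show ?thesis
    unfolding matrix_deriv_def matrix_matrix_mult_def by (simp add: sum.distrib mult_ac)
qed

lemma matrix_deriv_const [simp]: "matrix_deriv (\<lambda>t. C) 0"
  by (simp add: matrix_deriv_def)

text \<open>Only the first-order behaviour at 0 is recorded. Straight lines do not suffice, since
  the motion along an orbit is not a line in the space of triples.\<close>

definition curve :: "(complex \<Rightarrow> ('k::finite, 'r::finite) adhm) \<Rightarrow> ('k, 'r) adhm \<Rightarrow> ('k, 'r) adhm \<Rightarrow> bool" where
  "curve y x v \<longleftrightarrow> y 0 = x \<and> matrix_deriv (\<lambda>t. adhm_B1 (y t)) (adhm_B1 v) \<and>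
    matrix_deriv (\<lambda>t. adhm_B2 (y t)) (adhm_B2 v) \<and> matrix_deriv (\<lambda>t. adhm_I (y t)) (adhm_I v) \<and>
    matrix_deriv (\<lambda>t. adhm_J (y t)) (adhm_J v)"

definition dir_deriv :: "(('k::finite, 'r::finite) adhm \<Rightarrow> complex) \<Rightarrow> ('k, 'r) adhm \<Rightarrow> ('k, 'r) adhm \<Rightarrow> complex" where
  "dir_deriv f x v = deriv (\<lambda>t. f (x + adhm_scale t v)) 0"

lemma curve_line: "curve (\<lambda>t. x + adhm_scale t v) x v"
proof -
  have "((\<lambda>t. a + t * b) has_field_derivative b) (at 0)" for a b :: complex
    by (auto intro!: derivative_eq_intros)
  then show ?thesis
    by (auto simp: curve_def matrix_deriv_def adhm_scale_def prod_eq_iff vec_eq_iff)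
qed

text \<open>Chain rule: the derivative of a polynomial along a curve depends on the curve only
  through its starting point and velocity.\<close>

lemma dir_deriv_curve:
  assumes "f \<in> polys" "curve y x v"
  shows "((\<lambda>t. f (y t)) has_field_derivative dir_deriv f x v) (at 0)"
proof -
  \<comment> \<open>The number \<open>d\<close> is chosen before the curve, so evaluating on the
    straight line identifies it as \<open>dir_deriv f x v\<close>.\<close>
  have "\<exists>d. \<forall>y. curve y x v \<longrightarrow> ((\<lambda>t. f (y t)) has_field_derivative d) (at 0)"
    using assms(1)
  proof (induction rule: polys_induct)
    case (add f g)
    then obtain d e where "\<And>y. curve y x v \<Longrightarrow> ((\<lambda>t. f (y t)) has_field_derivative d) (at 0)"
      "\<And>y. curve y x v \<Longrightarrow> ((\<lambda>t. g (y t)) has_field_derivative e) (at 0)"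
      by blast
    then show ?case
      by (intro exI[of _ "d + e"] allI impI DERIV_add) auto
  next
    case (mult f g)
    then obtain d e where "\<And>y. curve y x v \<Longrightarrow> ((\<lambda>t. f (y t)) has_field_derivative d) (at 0)"
      "\<And>y. curve y x v \<Longrightarrow> ((\<lambda>t. g (y t)) has_field_derivative e) (at 0)"
      by blast
    then have "((\<lambda>t. f (y t) * g (y t)) has_field_derivative d * g x + e * f x) (at 0)"
      if "curve y x v" for y
      using DERIV_mult[of "\<lambda>t. f (y t)" d 0 UNIV "\<lambda>t. g (y t)" e] that by (simp add: curve_def)
    then show ?case by blast
  next
    case (const c)
    then show ?case by (intro exI[of _ 0]) auto
  next
    case (B1 i j)
    then show ?case by (auto simp: curve_def matrix_deriv_def intro!: exI[of _ "adhm_B1 v $ i $ j"])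
  next
    case (B2 i j)
    then show ?case by (auto simp: curve_def matrix_deriv_def intro!: exI[of _ "adhm_B2 v $ i $ j"])
  next
    case (I i s)
    then show ?case by (auto simp: curve_def matrix_deriv_def intro!: exI[of _ "adhm_I v $ i $ s"])
  next
    case (J s i)
    then show ?case by (auto simp: curve_def matrix_deriv_def intro!: exI[of _ "adhm_J v $ s $ i"])
  qed
  then obtain d where d: "\<And>y. curve y x v \<Longrightarrow> ((\<lambda>t. f (y t)) has_field_derivative d) (at 0)"
    by blast
  then have "dir_deriv f x v = d"
    unfolding dir_deriv_def by (intro DERIV_imp_deriv) (rule d[OF curve_line])
  then show ?thesis
    using d[OF assms(2)] by simp
qed

lemma dir_deriv_eqI:
  assumes "((\<lambda>t. f (x + adhm_scale t v)) has_field_derivative d) (at 0)"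
  shows "dir_deriv f x v = d"
  using assms unfolding dir_deriv_def by (rule DERIV_imp_deriv)

lemma dir_deriv_const [simp]: "dir_deriv (\<lambda>y. c) x v = 0"
  by (simp add: dir_deriv_def)

lemma dir_deriv_coord [simp]:
  "dir_deriv (\<lambda>y. adhm_B1 y $ i $ j) x v = adhm_B1 v $ i $ j"
  "dir_deriv (\<lambda>y. adhm_B2 y $ i $ j) x v = adhm_B2 v $ i $ j"
  "dir_deriv (\<lambda>y. adhm_I y $ i $ s) x v = adhm_I v $ i $ s"
  "dir_deriv (\<lambda>y. adhm_J y $ s $ i) x v = adhm_J v $ s $ i"
  using curve_line[of x v] by (auto intro!: dir_deriv_eqI simp: curve_def matrix_deriv_def)

lemma dir_deriv_add:
  assumes "f \<in> polys" "g \<in> polys"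
  shows "dir_deriv (\<lambda>y. f y + g y) x v = dir_deriv f x v + dir_deriv g x v"
  using assms by (intro dir_deriv_eqI DERIV_add dir_deriv_curve curve_line) auto

lemma dir_deriv_mult:
  assumes "f \<in> polys" "g \<in> polys"
  shows "dir_deriv (\<lambda>y. f y * g y) x v = dir_deriv f x v * g x + f x * dir_deriv g x v"
proof -
  have "x + adhm_scale 0 v = x" using curve_line[of x v] by (simp add: curve_def)
  then show ?thesis
    using DERIV_mult[OF dir_deriv_curve[OF assms(1) curve_line[of x v]]
        dir_deriv_curve[OF assms(2) curve_line[of x v]]] assms
    by (intro dir_deriv_eqI) (auto simp: mult.commute)
qed

lemma dir_deriv_scale:
  assumes "f \<in> polys"
  shows "dir_deriv (\<lambda>y. c * f y) x v = c * dir_deriv f x v"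
  using dir_deriv_mult[OF polys.const[of c] assms] by simp

lemma dir_deriv_diff:
  assumes "f \<in> polys" "g \<in> polys"
  shows "dir_deriv (\<lambda>y. f y - g y) x v = dir_deriv f x v - dir_deriv g x v"
  using dir_deriv_add[OF assms(1), of "\<lambda>y. - 1 * g y"] dir_deriv_scale[OF assms(2), of "-1"] assms(2)
  by simp

lemma dir_deriv_sum:
  assumes "\<And>i. i \<in> S \<Longrightarrow> f i \<in> polys"
  shows "dir_deriv (\<lambda>y. \<Sum>i\<in>S. f i y) x v = (\<Sum>i\<in>S. dir_deriv (f i) x v)"
  using assms by (induction S rule: infinite_finite_induct) (auto simp: dir_deriv_add)

lemma dir_deriv_vec_add:
  assumes "f \<in> polys"
  shows "dir_deriv f x (v + w) = dir_deriv f x v + dir_deriv f x w"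
  using assms by (induction rule: polys_induct) (auto simp: dir_deriv_add dir_deriv_mult algebra_simps)

lemma dir_deriv_vec_scale:
  assumes "f \<in> polys"
  shows "dir_deriv f x (adhm_scale c v) = c * dir_deriv f x v"
  using assms
  by (induction rule: polys_induct) (auto simp: dir_deriv_add dir_deriv_mult algebra_simps adhm_scale_def)

definition matrix_dir_deriv :: "(('k::finite, 'r::finite) adhm \<Rightarrow> complex^'n^'m) \<Rightarrow>
    ('k, 'r) adhm \<Rightarrow> ('k, 'r) adhm \<Rightarrow> complex^'n^'m" where
  "matrix_dir_deriv A x v = (\<chi> i j. dir_deriv (\<lambda>y. A y $ i $ j) x v)"

lemma matrix_dir_deriv_mult:
  assumes "poly_matrix A" "poly_matrix B"
  shows "matrix_dir_deriv (\<lambda>y. A y ** B y) x v =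
    matrix_dir_deriv A x v ** B x + A x ** matrix_dir_deriv B x v"
  using assms
  by (simp add: vec_eq_iff matrix_dir_deriv_def matrix_matrix_mult_def poly_matrix_def dir_deriv_sum
      dir_deriv_mult sum.distrib)

lemma matrix_dir_deriv_mscale:
  assumes "f \<in> polys" "poly_matrix A"
  shows "matrix_dir_deriv (\<lambda>y. mscale (f y) (A y)) x v =
    mscale (dir_deriv f x v) (A x) + mscale (f x) (matrix_dir_deriv A x v)"
  using assms
  by (simp add: vec_eq_iff matrix_dir_deriv_def poly_matrix_def dir_deriv_mult)

lemma matrix_dir_deriv_coord [simp]:
  "matrix_dir_deriv (\<lambda>y. adhm_B1 y) x v = adhm_B1 v"
  "matrix_dir_deriv (\<lambda>y. adhm_B2 y) x v = adhm_B2 v"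
  "matrix_dir_deriv (\<lambda>y. adhm_I y) x v = adhm_I v"
  "matrix_dir_deriv (\<lambda>y. adhm_J y) x v = adhm_J v"
  by (simp_all add: vec_eq_iff matrix_dir_deriv_def)

text \<open>Links the explicit formula of the deformation complex to calculus; the linearity of
  \<open>d_mu\<close> and its role for \<open>mu_ideal\<close> both come from here.\<close>

lemma matrix_dir_deriv_mu_c: "matrix_dir_deriv (mu_c q) x v = d_mu q x v"
proof -
  have add: "matrix_dir_deriv (\<lambda>y. A y + B y) x v = matrix_dir_deriv A x v + matrix_dir_deriv B x v"
    and diff: "matrix_dir_deriv (\<lambda>y. A y - B y) x v = matrix_dir_deriv A x v - matrix_dir_deriv B x v"
    if "poly_matrix A" "poly_matrix B" for A B :: "('a, 'b) adhm \<Rightarrow> complex^'a^'a"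
    using that by (simp_all add: vec_eq_iff matrix_dir_deriv_def poly_matrix_def dir_deriv_add dir_deriv_diff)
  have pm: "poly_matrix (\<lambda>y::('a, 'b) adhm. adhm_B1 y ** adhm_B2 y)"
    "poly_matrix (\<lambda>y::('a, 'b) adhm. adhm_B2 y ** adhm_B1 y)"
    "poly_matrix (\<lambda>y::('a, 'b) adhm. adhm_I y ** adhm_J y)"
    by (intro poly_matrix_mult; simp)+
  have pm2: "poly_matrix (\<lambda>y::('a, 'b) adhm. mscale c (adhm_B2 y ** adhm_B1 y))" for c
    by (intro poly_matrix_mscale pm) simp
  have "matrix_dir_deriv (mu_c q) x v =
    adhm_B1 v ** adhm_B2 x + adhm_B1 x ** adhm_B2 v -
    mscale (inverse (q\<^sup>2)) (adhm_B2 v ** adhm_B1 x + adhm_B2 x ** adhm_B1 v) +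
    (adhm_I v ** adhm_J x + adhm_I x ** adhm_J v)"
    unfolding mu_c_def[abs_def]
    by (simp add: add diff pm pm2 poly_matrix_diff matrix_dir_deriv_mult matrix_dir_deriv_mscale)
      (simp add: vec_eq_iff)
  also have "\<dots> = d_mu q x v"
    by (cases x; cases v) (simp add: vec_eq_iff algebra_simps)
  finally show ?thesis .
qed

text \<open>By the product rule a summand \<open>c * mu\<close> contributes
  \<open>dc * mu + c * dmu\<close> at \<open>x\<close>, and both \<open>mu\<close> and its
  derivative along \<open>v\<close> are zero. This makes derivatives along the kernel of
  \<open>d_mu\<close> well defined modulo the ideal.\<close>

lemma dir_deriv_mu_ideal:
  assumes "f \<in> mu_ideal q" "mu_c q x = 0" "d_mu q x v = 0"
  shows "dir_deriv f x v = 0"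
proof -
  obtain c where c: "\<And>i j. c i j \<in> polys" "f = (\<lambda>x. \<Sum>i\<in>UNIV. \<Sum>j\<in>UNIV. c i j x * mu_c q x $ i $ j)"
    using assms unfolding mu_ideal_def by blast
  have "dir_deriv (\<lambda>y. mu_c q y $ i $ j) x v = 0" for i j
    using assms(3) matrix_dir_deriv_mu_c[of q x v] by (simp add: vec_eq_iff matrix_dir_deriv_def)
  then show ?thesis
    by (simp add: c dir_deriv_sum dir_deriv_mult assms(2))
qed

section \<open>Equivariant frames\<close>

lemma matrix_inv_cancel:
  fixes A :: "complex^'n^'n"
  assumes "invertible A"
  shows "A ** matrix_inv A = mat 1" "matrix_inv A ** A = mat 1"
  using assms unfolding invertible_def matrix_inv_def
  by (metis (mono_tags, lifting) someI_ex)+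

lemma matrix_inv_eqI:
  fixes A :: "complex^'n^'n"
  assumes "A ** B = mat 1"
  shows "matrix_inv A = B"
proof -
  have "invertible A" using assms by (auto simp: invertible_right_inverse)
  then show ?thesis
    using assms matrix_inv_cancel(2) by (metis matrix_mul_assoc matrix_mul_lid matrix_mul_rid)
qed

lemma matrix_inv_mat_1: "matrix_inv (mat 1 :: complex^'n^'n) = mat 1"
  by (intro matrix_inv_eqI) simp

lemma invertible_matrix_inv:
  fixes A :: "complex^'n^'n"
  shows "invertible A \<Longrightarrow> invertible (matrix_inv A)"
  using matrix_inv_cancel unfolding invertible_def by blast

lemma matrix_inv_matrix_inv:
  fixes A :: "complex^'n^'n"
  shows "invertible A \<Longrightarrow> matrix_inv (matrix_inv A) = A"
  by (intro matrix_inv_eqI matrix_inv_cancel)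

lemma matrix_inv_mult:
  fixes A B :: "complex^'n^'n"
  assumes "invertible A" "invertible B"
  shows "matrix_inv (A ** B) = matrix_inv B ** matrix_inv A"
proof (rule matrix_inv_eqI)
  have "A ** B ** (matrix_inv B ** matrix_inv A) = A ** (B ** matrix_inv B) ** matrix_inv A"
    by (simp add: matrix_mul_assoc)
  then show "A ** B ** (matrix_inv B ** matrix_inv A) = mat 1"
    using assms by (simp add: matrix_inv_cancel)
qed

lemma invertible_mult_matrix:
  fixes A B :: "complex^'n^'n"
  shows "invertible A \<Longrightarrow> invertible B \<Longrightarrow> invertible (A ** B)"
  by (simp add: invertible_det_nz det_mul)

lemma act_act:
  assumes "invertible g" "invertible h"
  shows "act h (act g y) = act (h ** g) y"
  using assms by (simp add: act_def matrix_inv_mult matrix_mul_assoc)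

lemma mu_c_act:
  assumes "invertible g"
  shows "mu_c q (act g y) = g ** mu_c q y ** matrix_inv g"
proof -
  have *: "A ** matrix_inv g ** g = A" for A :: "complex^'a^'c"
    using matrix_inv_cancel(2)[OF assms] by (simp flip: matrix_mul_assoc)
  show ?thesis
    by (simp add: mu_c_def act_def matrix_mul_assoc * matrix_mult_add_left matrix_mult_diff_left
        matrix_mult_diff_right matrix_add_ldistrib mscale_mult_left mscale_mult_right)
qed

text \<open>The numerators of Cramer's rule: column \<open>k\<close> is replaced by the
  \<open>l\<close>-th unit vector. They are polynomial in the entries and hence usable where
  \<open>A\<close> is singular.\<close>

definition adjugate :: "complex^'n^'n \<Rightarrow> complex^'n^'n" where
  "adjugate A = (\<chi> k l. det (\<chi> i j. if j = k then axis l 1 $ i else A $ i $ j))"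

lemma adjugate_eq:
  assumes "invertible A"
  shows "adjugate A = mscale (det A) (matrix_inv A)"
proof -
  have d: "det A \<noteq> 0" using assms by (simp add: invertible_det_nz)
  have "matrix_inv A $ k $ l = det (\<chi> i j. if j = k then axis l 1 $ i else A $ i $ j) / det A" for k l
  proof -
    have "A *v (matrix_inv A *v axis l 1) = axis l 1"
      by (simp add: matrix_vector_mul_assoc matrix_inv_cancel[OF assms])
    then have "matrix_inv A *v axis l 1 =
        (\<chi> k. det (\<chi> i j. if j = k then axis l 1 $ i else A $ i $ j) / det A)"
      using cramer[OF d] by blast
    moreover have "(matrix_inv A *v axis l 1) $ k = matrix_inv A $ k $ l"
      by (simp add: matrix_vector_mult_def axis_def if_distrib cong: if_cong)
    ultimately show ?thesis by simp
  qed
  then show ?thesis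
    using d by (simp add: vec_eq_iff adjugate_def)
qed

lemma poly_matrix_adjugate:
  assumes "poly_matrix A"
  shows "poly_matrix (\<lambda>y. adjugate (A y))"
proof -
  have "poly_matrix (\<lambda>y. \<chi> i j. if j = k then axis l 1 $ i else A y $ i $ j)" for k l
    unfolding poly_matrix_def
  proof (intro allI)
    show "(\<lambda>y. (\<chi> i j. if j = k then axis l 1 $ i else A y $ i $ j) $ i $ j) \<in> polys" for i j
      using assms by (cases "j = k") (simp_all add: poly_matrix_def)
  qed
  from polys_det[OF this] show ?thesis
    by (simp add: adjugate_def poly_matrix_def)
qed

text \<open>The equivariant polynomial maps \<open>u\<close> from triples to \<open>V\<close> are
  closed under application of \<open>B1\<close> and \<open>B2\<close> and contain \<open>I\<close>
  applied to any constant vector. Their values at \<open>x\<close> thus form a subspace of the kind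
  excluded by stability unless it is all of \<open>V\<close>, so every basis vector is the value of
  such a map.\<close>

lemma equivariant_frame:
  fixes x :: "('k::finite, 'r::finite) adhm"
  assumes "stable x"
  shows "\<exists>M. poly_matrix M \<and> (\<forall>g y. invertible g \<longrightarrow> M (act g y) = g ** M y) \<and> M x = mat 1"
proof -
  define U :: "(('k, 'r) adhm \<Rightarrow> complex^'k) set" where
    "U = {u. (\<forall>i. (\<lambda>y. u y $ i) \<in> polys) \<and> (\<forall>g y. invertible g \<longrightarrow> u (act g y) = g *v u y)}"
  define S where "S = (\<lambda>u. u x) ` U"
  have inv: "A ** matrix_inv g ** g = A" if "invertible g" for A :: "complex^'k^'m" and g :: "complex^'k^'k"
    using matrix_inv_cancel(2)[OF that] by (simp flip: matrix_mul_assoc)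
  have mv: "(\<forall>i. (\<lambda>y. (A y *v u y) $ i) \<in> polys)" if "poly_matrix A" "\<forall>i. (\<lambda>y. u y $ i) \<in> polys"
    for A :: "('k, 'r) adhm \<Rightarrow> complex^'n^'k" and u
    using that by (auto simp: matrix_vector_mult_def poly_matrix_def)
  have "(\<lambda>y. 0) \<in> U"
    by (auto simp: U_def)
  moreover have "(\<lambda>y. u y + v y) \<in> U" if "u \<in> U" "v \<in> U" for u v
    using that by (auto simp: U_def matrix_vector_right_distrib)
  moreover have "(\<lambda>y. c *s u y) \<in> U" if "u \<in> U" for c u
    using that by (auto simp: U_def vec.scale)
  ultimately have sub: "vec.subspace S"
    unfolding vec.subspace_def S_def by (auto simp: image_iff)
  have B1: "(\<lambda>y. adhm_B1 y *v u y) \<in> U" and B2: "(\<lambda>y. adhm_B2 y *v u y) \<in> U" if "u \<in> U" for u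
    using that mv[OF poly_matrix_coord(1), of u] mv[OF poly_matrix_coord(2), of u]
    by (auto simp: U_def act_def matrix_vector_mul_assoc inv)
  have I: "(\<lambda>y. adhm_I y *v w) \<in> U" for w
    using mv[OF poly_matrix_coord(3), of "\<lambda>y. w"]
    by (auto simp: U_def act_def matrix_vector_mul_assoc)
  obtain X1 X2 X3 X4 where x: "x = (X1, X2, X3, X4)" by (cases x) auto
  have "S = UNIV"
  proof (rule ccontr)
    assume "S \<noteq> UNIV"
    moreover have "X1 *v v \<in> S \<and> X2 *v v \<in> S" if v: "v \<in> S" for v
    proof -
      obtain u where u: "u \<in> U" "v = u x" using v unfolding S_def by (elim imageE)
      show ?thesis
        using imageI[OF B1[OF u(1)], of "\<lambda>u. u x"] imageI[OF B2[OF u(1)], of "\<lambda>u. u x"]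
        by (simp add: S_def u(2) x)
    qed
    moreover have "X3 *v w \<in> S" for w
      using imageI[OF I[of w], of "\<lambda>u. u x"] by (simp add: S_def x)
    ultimately show False
      using assms sub unfolding x by (auto simp only: stable.simps)
  qed
  have "\<exists>u. u \<in> U \<and> u x = axis j 1" for j
  proof -
    have "axis j 1 \<in> S" by (simp add: \<open>S = UNIV\<close>)
    then obtain u where "u \<in> U" "axis j 1 = u x"
      unfolding S_def by (rule imageE)
    then show ?thesis by auto
  qed
  then obtain u where u: "\<And>j. u j \<in> U" "\<And>j. u j x = axis j 1"
    by metis
  \<comment> \<open>The columns are equivariant maps taking the standard basis vectors as values at
    \<open>x\<close>.\<close>
  define M where "M y = (\<chi> i j. u j y $ i)" for y
  have "poly_matrix M"
    using u(1) by (auto simp: M_def poly_matrix_def U_def)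
  moreover have "M (act g y) = g ** M y" if "invertible g" for g y
  proof -
    have "u j (act g y) = g *v u j y" for j
      using u(1)[of j] that by (auto simp: U_def)
    then show ?thesis
      by (simp add: M_def vec_eq_iff matrix_matrix_mult_def matrix_vector_mult_def)
  qed
  moreover have "M x = mat 1"
    by (simp add: M_def u(2) vec_eq_iff mat_def axis_def)
  ultimately show ?thesis by blast
qed

locale adhm_point =
  fixes q :: complex and x :: "('k::finite, 'r::finite) adhm"
  assumes stable: "stable x" and mu_zero: "mu_c q x = 0"
begin

definition frame :: "('k, 'r) adhm \<Rightarrow> complex^'k^'k" where
  "frame = (SOME M. poly_matrix M \<and> (\<forall>g y. invertible g \<longrightarrow> M (act g y) = g ** M y) \<and> M x = mat 1)"

lemma frame: "poly_matrix frame" "\<And>g y. invertible g \<Longrightarrow> frame (act g y) = g ** frame y" "frame x = mat 1"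
  using someI_ex[OF equivariant_frame[OF stable]] unfolding frame_def by blast+

text \<open>A semi-invariant of weight one with value 1 at \<open>x\<close>; its powers are the
  standard denominators for germs at the orbit.\<close>

definition frame_det :: "('k, 'r) adhm \<Rightarrow> complex" where
  "frame_det y = det (frame y)"

lemma polys_frame_det [simp]: "frame_det \<in> polys" "(\<lambda>y. frame_det y) \<in> polys"
  using polys_det[OF frame(1)] by (simp_all add: frame_det_def[abs_def])

lemma frame_det_act: "invertible g \<Longrightarrow> frame_det (act g y) = det g * frame_det y"
  by (simp add: frame_det_def frame(2) det_mul)

lemma frame_det_x [simp]: "frame_det x = 1"
  by (simp add: frame_det_def frame(3))

lemma invertible_frame: "frame_det y \<noteq> 0 \<Longrightarrow> invertible (frame y)"
  by (simp add: frame_det_def invertible_det_nz)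

section \<open>The retraction onto the slice and its polynomial lifts\<close>

definition normal_form :: "('k, 'r) adhm \<Rightarrow> ('k, 'r) adhm" where
  "normal_form y = act (matrix_inv (frame y)) y"

lemma normal_form_act:
  assumes "invertible g" "frame_det y \<noteq> 0"
  shows "normal_form (act g y) = normal_form y"
proof -
  note M = invertible_frame[OF assms(2)]
  have "matrix_inv (frame y) ** matrix_inv g ** g = matrix_inv (frame y)"
    using matrix_inv_cancel(2)[OF assms(1)] by (simp flip: matrix_mul_assoc)
  then show ?thesis
    using assms(1) M
    by (simp add: normal_form_def frame(2) matrix_inv_mult act_act invertible_mult_matrix invertible_matrix_inv)
qed

lemma normal_form_x: "normal_form x = x"
  by (simp add: normal_form_def frame(3) act_def matrix_inv_mat_1)

text \<open>
  \<open>b\<close> clears the denominators of \<open>a \<circ> normal_form\<close>. Off the open set \<open>frame_det \<noteq> 0\<close>, where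
  \<open>normal_form\<close> is junk, \<open>b\<close> has to vanish, so that it is a semi-invariant everywhere.
\<close>

definition normal_lift :: "(('k, 'r) adhm \<Rightarrow> complex) \<Rightarrow> (('k, 'r) adhm \<Rightarrow> complex) \<Rightarrow> nat \<Rightarrow> bool" where
  "normal_lift a b n \<longleftrightarrow> b \<in> polys \<and>
    (\<forall>y. b y = (if frame_det y = 0 then 0 else frame_det y ^ n * a (normal_form y)))"

lemma normal_liftI:
  assumes "b \<in> polys" "\<And>y. frame_det y = 0 \<Longrightarrow> b y = 0"
    "\<And>y. frame_det y \<noteq> 0 \<Longrightarrow> b y = frame_det y ^ n * a (normal_form y)"
  shows "normal_lift a b n"
  using assms by (simp add: normal_lift_def)

lemma normal_liftD:
  assumes "normal_lift a b n"
  shows "b \<in> polys" "\<And>y. frame_det y = 0 \<Longrightarrow> b y = 0"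
    "\<And>y. frame_det y \<noteq> 0 \<Longrightarrow> b y = frame_det y ^ n * a (normal_form y)"
  using assms by (simp_all add: normal_lift_def)

lemma normal_lift_x: "normal_lift a b n \<Longrightarrow> b x = a x"
  by (simp add: normal_liftD(3) normal_form_x)

text \<open>The weight comes from the power of \<open>frame_det\<close> alone, as
  \<open>normal_form\<close> is invariant. The locus \<open>frame_det = 0\<close> is preserved by
  the group, so the law holds there as well, exactly and not only modulo
  \<open>mu_ideal\<close>.\<close>

lemma normal_lift_act:
  assumes "normal_lift a b n" "invertible g"
  shows "b (act g y) = det g ^ n * b y"
proof -
  have "det g \<noteq> 0" using assms(2) by (simp add: invertible_det_nz)
  then show ?thesis
    using normal_liftD[OF assms(1)] assms(2)
    by (cases "frame_det y = 0") (simp_all add: frame_det_act normal_form_act power_mult_distrib)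
qed

text \<open>The exponent is 1 and not 0 because a lift must vanish where \<open>frame_det\<close>
  does.\<close>

lemma normal_lift_const: "normal_lift (\<lambda>y. c) (\<lambda>y. c * frame_det y) 1"
  by (rule normal_liftI) auto

lemma normal_lift_add:
  assumes "normal_lift a b n" "normal_lift a' b' n'"
  shows "normal_lift (\<lambda>y. a y + a' y) (\<lambda>y. frame_det y ^ n' * b y + frame_det y ^ n * b' y) (n + n')"
  using normal_liftD[OF assms(1)] normal_liftD[OF assms(2)]
  by (intro normal_liftI) (simp_all add: power_add algebra_simps)

lemma normal_lift_mult:
  assumes "normal_lift a b n" "normal_lift a' b' n'"
  shows "normal_lift (\<lambda>y. a y * a' y) (\<lambda>y. b y * b' y) (n + n')"
  using normal_liftD[OF assms(1)] normal_liftD[OF assms(2)]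
  by (intro normal_liftI) (simp_all add: power_add)

abbreviation frame_adj :: "('k, 'r) adhm \<Rightarrow> complex^'k^'k" where
  "frame_adj y \<equiv> adjugate (frame y)"

lemma poly_matrix_frame_adj: "poly_matrix (\<lambda>y. frame_adj y)"
  by (rule poly_matrix_adjugate[OF frame(1)])

lemma frame_adj_eq: "frame_det y \<noteq> 0 \<Longrightarrow> frame_adj y = mscale (frame_det y) (matrix_inv (frame y))"
  using adjugate_eq[OF invertible_frame] by (simp add: frame_det_def)

text \<open>The adjugate supplies one factor \<open>frame_det\<close> by clearing the inverse of the
  frame; the scalar in front supplies a second one, which forces vanishing where
  \<open>frame_det = 0\<close>. Hence the exponent 2 below.\<close>

definition endo_lift :: "(('k, 'r) adhm \<Rightarrow> complex^'k^'k) \<Rightarrow> ('k, 'r) adhm \<Rightarrow> complex^'k^'k" where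
  "endo_lift A y = mscale (frame_det y) (frame_adj y ** A y ** frame y)"

lemma poly_matrix_endo_lift: "poly_matrix A \<Longrightarrow> poly_matrix (endo_lift A)"
  unfolding endo_lift_def[abs_def]
  by (intro poly_matrix_mscale poly_matrix_mult poly_matrix_frame_adj frame) auto

text \<open>Serves \<open>B1\<close>, \<open>B2\<close> and \<open>mu_c\<close> alike, since the
  group conjugates all three.\<close>

lemma normal_lift_endo:
  assumes "poly_matrix A" "\<And>g y. invertible g \<Longrightarrow> A (act g y) = g ** A y ** matrix_inv g"
  shows "normal_lift (\<lambda>y. A y $ i $ j) (\<lambda>y. endo_lift A y $ i $ j) 2"
proof -
  have "endo_lift A y $ i $ j = (if frame_det y = 0 then 0 else frame_det y ^ 2 * A (normal_form y) $ i $ j)" for y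
    using invertible_frame[of y] invertible_matrix_inv[OF invertible_frame[of y]]
    by (simp add: endo_lift_def normal_form_def assms(2) frame_adj_eq mscale_mult_left
        matrix_inv_matrix_inv power2_eq_square)
  moreover have "(\<lambda>y. endo_lift A y $ i $ j) \<in> polys"
    using poly_matrix_endo_lift[OF assms(1)] by (simp add: poly_matrix_def)
  ultimately show ?thesis
    unfolding normal_lift_def by blast
qed

definition I_lift :: "('k, 'r) adhm \<Rightarrow> complex^'r^'k" where
  "I_lift y = mscale (frame_det y) (frame_adj y ** adhm_I y)"

text \<open>Acting by the inverse frame multiplies \<open>J\<close> by the frame itself, so there is
  no denominator to clear; the single factor \<open>frame_det\<close> is only there to force
  vanishing, and the exponent is 1.\<close>

definition J_lift :: "('k, 'r) adhm \<Rightarrow> complex^'k^'r" where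
  "J_lift y = mscale (frame_det y) (adhm_J y ** frame y)"

lemma poly_matrix_I_lift: "poly_matrix I_lift"
  and poly_matrix_J_lift: "poly_matrix J_lift"
  unfolding I_lift_def[abs_def] J_lift_def[abs_def]
  by (intro poly_matrix_mscale poly_matrix_mult poly_matrix_frame_adj frame; simp)+

lemma normal_lift_B1: "normal_lift (\<lambda>y. adhm_B1 y $ i $ j) (\<lambda>y. endo_lift adhm_B1 y $ i $ j) 2"
  by (rule normal_lift_endo) (simp_all add: act_def)

lemma normal_lift_B2:
  "normal_lift (\<lambda>y. adhm_B2 y $ i $ j) (\<lambda>y. endo_lift (\<lambda>y. adhm_B2 y) y $ i $ j) 2"
  by (rule normal_lift_endo) (simp_all add: act_def)

lemma normal_lift_mu: "normal_lift (\<lambda>y. mu_c q y $ i $ j) (\<lambda>y. endo_lift (mu_c q) y $ i $ j) 2"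
  by (rule normal_lift_endo) (simp_all add: mu_c_act poly_matrix_mu_c)

lemma normal_lift_I: "normal_lift (\<lambda>y. adhm_I y $ i $ s) (\<lambda>y. I_lift y $ i $ s) 2"
proof -
  have "I_lift y $ i $ s = (if frame_det y = 0 then 0 else frame_det y ^ 2 * adhm_I (normal_form y) $ i $ s)" for y
    by (simp add: I_lift_def normal_form_def act_def frame_adj_eq mscale_mult_left power2_eq_square)
  moreover have "(\<lambda>y. I_lift y $ i $ s) \<in> polys"
    using poly_matrix_I_lift by (simp add: poly_matrix_def)
  ultimately show ?thesis
    unfolding normal_lift_def by blast
qed

lemma normal_lift_J: "normal_lift (\<lambda>y. adhm_J y $ s $ i) (\<lambda>y. J_lift y $ s $ i) 1"
proof -
  have "J_lift y $ s $ i = (if frame_det y = 0 then 0 else frame_det y ^ 1 * adhm_J (normal_form y) $ s $ i)" for y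
    by (simp add: J_lift_def normal_form_def act_def matrix_inv_matrix_inv invertible_frame)
  moreover have "(\<lambda>y. J_lift y $ s $ i) \<in> polys"
    using poly_matrix_J_lift by (simp add: poly_matrix_def)
  ultimately show ?thesis
    unfolding normal_lift_def by blast
qed

lemma normal_lift_exists: "a \<in> polys \<Longrightarrow> \<exists>b n. normal_lift a b n"
proof (induction rule: polys_induct)
  case (const c) then show ?case using normal_lift_const by blast
next
  case (B1 i j) then show ?case using normal_lift_B1 by blast
next
  case (B2 i j) then show ?case using normal_lift_B2 by blast
next
  case (I i s) then show ?case using normal_lift_I by blast
next
  case (J s i) then show ?case using normal_lift_J by blast
next
  case (add f g)
  then obtain b n b' n' where "normal_lift f b n" "normal_lift g b' n'" by auto
  then show ?case using normal_lift_add by blast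
next
  case (mult f g)
  then obtain b n b' n' where "normal_lift f b n" "normal_lift g b' n'" by auto
  then show ?case using normal_lift_mult by blast
qed

text \<open>Each entry is a combination of entries of \<open>mu_c\<close> with coefficients made
  from the frame, its adjugate and \<open>frame_det\<close>, all polynomial. This is why the
  equations of the fibre, pulled back by \<open>normal_form\<close>, are zero in the local
  ring.\<close>

lemma endo_lift_mu_ideal: "(\<lambda>y. endo_lift (mu_c q) y $ i $ j) \<in> mu_ideal q"
proof -
  have adj: "(\<lambda>y. frame_adj y $ i $ k) \<in> polys" and fr: "(\<lambda>y. frame y $ l $ j) \<in> polys" for k l
    using poly_matrix_frame_adj frame(1) by (simp_all add: poly_matrix_def)
  have "(\<lambda>y. \<Sum>l\<in>UNIV. \<Sum>k\<in>UNIV. frame_det y * (frame_adj y $ i $ k * frame y $ l $ j) * mu_c q y $ k $ l) \<in> mu_ideal q"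
    using adj fr by (intro mu_ideal_sum mu_ideal_mult mu_ideal_entry) auto
  moreover have "endo_lift (mu_c q) y $ i $ j =
     (\<Sum>l\<in>UNIV. \<Sum>k\<in>UNIV. frame_det y * (frame_adj y $ i $ k * frame y $ l $ j) * mu_c q y $ k $ l)" for y
    by (simp add: endo_lift_def matrix_matrix_mult_def sum_distrib_left sum_distrib_right mult_ac)
  ultimately show ?thesis by simp
qed

end

section \<open>Semi-invariants on the slice\<close>

text \<open>
  Membership in \<open>A\<close> is only assumed for constant \<open>g\<close>; once all factors \<open>p\<close> lie in \<open>A\<close>, a value of \<open>g\<close>
  depending on \<open>y\<close> may be substituted.
\<close>

lemma tensor_elimination:
  fixes L :: "(('g \<Rightarrow> complex) \<times> ('y \<Rightarrow> complex)) list"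
  assumes A: "\<And>f c g. f \<in> A \<Longrightarrow> g \<in> A \<Longrightarrow> (\<lambda>y. f y - c * g y) \<in> A"
    and \<Phi>: "\<And>f c g. f \<in> \<Phi> \<Longrightarrow> g \<in> \<Phi> \<Longrightarrow> (\<lambda>y. f y - c * g y) \<in> \<Phi>"
      "\<And>c f. f \<in> \<Phi> \<Longrightarrow> (\<lambda>y. c * f y) \<in> \<Phi>"
    and "fst ` set L \<subseteq> \<Phi>"
    and "\<And>g. g \<in> G \<Longrightarrow> (\<lambda>y. \<Sum>(\<phi>, p)\<leftarrow>L. \<phi> g * p y) \<in> A"
  shows "\<exists>L'. set L' \<subseteq> \<Phi> \<times> A \<and>
    (\<forall>g\<in>G. \<forall>y. (\<Sum>(\<phi>, p)\<leftarrow>L. \<phi> g * p y) = (\<Sum>(\<phi>, p)\<leftarrow>L'. \<phi> g * p y))"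
  using assms(4,5)
proof (induction "length L" arbitrary: L)
  case 0
  then show ?case by (intro exI[of _ "[]"]) auto
next
  case (Suc n)
  then obtain \<phi>0 p0 R where L: "L = (\<phi>0, p0) # R"
    by (cases L) auto
  define F where "F L g y = (\<Sum>(\<phi>, p)\<leftarrow>L. \<phi> g * p y)" for L :: "(('g \<Rightarrow> complex) \<times> ('y \<Rightarrow> complex)) list" and g y
  have FL: "F L g y = \<phi>0 g * p0 y + F R g y" for g y
    by (simp add: F_def L)
  have F_A: "F L g \<in> A" if "g \<in> G" for g
    using Suc.prems(2)[OF that] by (simp add: F_def[abs_def])
  show ?case
  \<comment> \<open>If the leading function is zero on all of \<open>G\<close>, its pair contributes
    nothing and is dropped; otherwise it serves as a pivot.\<close>
  proof (cases "\<forall>g\<in>G. \<phi>0 g = 0")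
    case True
    then have eq: "F L g = F R g" if "g \<in> G" for g
      using that by (auto simp: FL)
    have "\<exists>L'. set L' \<subseteq> \<Phi> \<times> A \<and> (\<forall>g\<in>G. \<forall>y. F R g y = F L' g y)"
      unfolding F_def
    proof (rule Suc.hyps(1))
      show "(\<lambda>y. \<Sum>(\<phi>, p)\<leftarrow>R. \<phi> g * p y) \<in> A" if "g \<in> G" for g
        using F_A[OF that] eq[OF that] by (simp add: F_def[abs_def])
    qed (use Suc.hyps(2) Suc.prems(1) in \<open>auto simp: L\<close>)
    then show ?thesis
      using eq unfolding F_def[symmetric] by metis
  next
    case False
    then obtain g0 where g0: "g0 \<in> G" "\<phi>0 g0 \<noteq> 0" by blast
    \<comment> \<open>Elimination with pivot \<open>\<phi>0 g0\<close>: subtracting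
      \<open>\<phi>0 g / \<phi>0 g0\<close> times the sum at \<open>g0\<close> removes
      \<open>p0\<close>. For fixed \<open>g\<close> this factor is a constant, so the difference
      stays in \<open>A\<close>, while the list is shorter by one.\<close>
    define R' where "R' = map (\<lambda>(\<phi>, p). (\<lambda>g. \<phi> g - \<phi> g0 / \<phi>0 g0 * \<phi>0 g, p)) R"
    have R': "F R' g y = F R g y - \<phi>0 g / \<phi>0 g0 * F R g0 y" for g y
      unfolding R'_def F_def by (induction R) (auto simp: algebra_simps)
    have *: "F R' g y = F L g y - \<phi>0 g / \<phi>0 g0 * F L g0 y" for g y
      using g0(2) by (simp add: FL R' field_simps)
    have "\<exists>L'. set L' \<subseteq> \<Phi> \<times> A \<and> (\<forall>g\<in>G. \<forall>y. F R' g y = F L' g y)"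
      unfolding F_def
    proof (rule Suc.hyps(1))
      show "n = length R'" using Suc.hyps(2) by (simp add: L R'_def)
      show "fst ` set R' \<subseteq> \<Phi>"
      proof -
        have "(\<lambda>g. \<phi> g - \<phi> g0 / \<phi>0 g0 * \<phi>0 g) \<in> \<Phi>" if "(\<phi>, p) \<in> set R" for \<phi> p
          using Suc.prems(1) that by (intro \<Phi>(1)) (auto simp: L)
        then show ?thesis by (auto simp: R'_def)
      qed
      show "(\<lambda>y. \<Sum>(\<phi>, p)\<leftarrow>R'. \<phi> g * p y) \<in> A" if "g \<in> G" for g
        using A[OF F_A[OF that] F_A[OF g0(1)], of "\<phi>0 g / \<phi>0 g0"]
        unfolding F_def[symmetric] * .
    qed
    then obtain L' where L': "set L' \<subseteq> \<Phi> \<times> A" "\<And>g y. g \<in> G \<Longrightarrow> F R' g y = F L' g y"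
      by blast
    \<comment> \<open>The subtracted multiple is put back as one pair, whose second component is the
      sum at \<open>g0\<close> and therefore an element of \<open>A\<close>.\<close>
    define L'' where "L'' = (\<lambda>g. 1 / \<phi>0 g0 * \<phi>0 g, F L g0) # L'"
    have "F L'' g y = F L g y" if "g \<in> G" for g y
    proof -
      have "F L'' g y = 1 / \<phi>0 g0 * \<phi>0 g * F L g0 y + F L' g y"
        by (simp add: L''_def F_def)
      then show ?thesis
        using L'(2)[OF that, of y] *[of g y] by (simp add: diff_eq_eq add.commute)
    qed
    moreover have "set L'' \<subseteq> \<Phi> \<times> A"
      using L'(1) Suc.prems(1) \<Phi>(2)[of \<phi>0 "1 / \<phi>0 g0"] F_A[OF g0(1)] by (simp add: L''_def L)
    ultimately show ?thesis
      unfolding F_def[symmetric] by metis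
  qed
qed

section \<open>Functions on the group, and substitution of the inverse frame\<close>

context adhm_point
begin

text \<open>Stands in for the regular functions on the group: those that become polynomial in
  \<open>y\<close>, up to a power of \<open>frame_det\<close>, under the one substitution that is
  needed, \<open>g = matrix_inv (frame y)\<close>.\<close>

definition frame_regular :: "(complex^'k^'k \<Rightarrow> complex) set" where
  "frame_regular = {\<phi>. \<exists>e \<psi>. \<psi> \<in> polys \<and>
    (\<forall>y. frame_det y \<noteq> 0 \<longrightarrow> \<psi> y = frame_det y ^ e * \<phi> (matrix_inv (frame y)))}"

lemma frame_regularI:
  "\<psi> \<in> polys \<Longrightarrow> (\<And>y. frame_det y \<noteq> 0 \<Longrightarrow> \<psi> y = frame_det y ^ e * \<phi> (matrix_inv (frame y))) \<Longrightarrow>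
    \<phi> \<in> frame_regular"
  unfolding frame_regular_def by blast

lemma frame_regular_const: "(\<lambda>g. c) \<in> frame_regular"
  by (rule frame_regularI[of "\<lambda>y. c" 0]) auto

lemma frame_regular_mult:
  assumes "\<phi> \<in> frame_regular" "\<phi>' \<in> frame_regular"
  shows "(\<lambda>g. \<phi> g * \<phi>' g) \<in> frame_regular"
proof -
  obtain e \<psi> e' \<psi>' where "\<psi> \<in> polys" "\<psi>' \<in> polys"
    "\<And>y. frame_det y \<noteq> 0 \<Longrightarrow> \<psi> y = frame_det y ^ e * \<phi> (matrix_inv (frame y))"
    "\<And>y. frame_det y \<noteq> 0 \<Longrightarrow> \<psi>' y = frame_det y ^ e' * \<phi>' (matrix_inv (frame y))"
    using assms unfolding frame_regular_def by blast
  then show ?thesis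
    by (intro frame_regularI[of "\<lambda>y. \<psi> y * \<psi>' y" "e + e'"]) (auto simp: power_add)
qed

lemma frame_regular_add:
  assumes "\<phi> \<in> frame_regular" "\<phi>' \<in> frame_regular"
  shows "(\<lambda>g. \<phi> g + \<phi>' g) \<in> frame_regular"
proof -
  obtain e \<psi> e' \<psi>' where "\<psi> \<in> polys" "\<psi>' \<in> polys"
    "\<And>y. frame_det y \<noteq> 0 \<Longrightarrow> \<psi> y = frame_det y ^ e * \<phi> (matrix_inv (frame y))"
    "\<And>y. frame_det y \<noteq> 0 \<Longrightarrow> \<psi>' y = frame_det y ^ e' * \<phi>' (matrix_inv (frame y))"
    using assms unfolding frame_regular_def by blast
  then show ?thesis
    by (intro frame_regularI[of "\<lambda>y. frame_det y ^ e' * \<psi> y + frame_det y ^ e * \<psi>' y" "e + e'"])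
      (auto simp: power_add algebra_simps)
qed

lemma frame_regular_diff:
  assumes "\<phi> \<in> frame_regular" "\<phi>' \<in> frame_regular"
  shows "(\<lambda>g. \<phi> g - c * \<phi>' g) \<in> frame_regular"
  using frame_regular_add[OF assms(1) frame_regular_mult[OF frame_regular_const[of "- c"] assms(2)]] by simp

lemma frame_regular_entry: "(\<lambda>g. g $ i $ j) \<in> frame_regular"
proof (rule frame_regularI[of "\<lambda>y. frame_adj y $ i $ j" 1])
  show "(\<lambda>y. frame_adj y $ i $ j) \<in> polys"
    using poly_matrix_frame_adj by (simp add: poly_matrix_def)
qed (simp add: frame_adj_eq)

lemma frame_regular_inv_entry: "(\<lambda>g. matrix_inv g $ i $ j) \<in> frame_regular"
proof (rule frame_regularI[of "\<lambda>y. frame y $ i $ j" 0])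
  show "(\<lambda>y. frame y $ i $ j) \<in> polys"
    using frame(1) by (simp add: poly_matrix_def)
qed (simp add: matrix_inv_matrix_inv invertible_frame)

lemma det_frame_inv: "frame_det y \<noteq> 0 \<Longrightarrow> frame_det y * det (matrix_inv (frame y)) = 1"
  using matrix_inv_cancel(1)[OF invertible_frame, of y] by (simp add: frame_det_def flip: det_mul)

text \<open>After the substitution \<open>det g\<close> is the reciprocal of
  \<open>frame_det y\<close>, so multiplication by \<open>frame_det y ^ n\<close> leaves the
  constant \<open>c\<close>.\<close>

lemma frame_regular_det_power: "(\<lambda>g. c * det g ^ n) \<in> frame_regular"
  by (rule frame_regularI[of "\<lambda>y. c" n]) (simp_all add: det_frame_inv mult.left_commute flip: power_mult_distrib)

definition tensor_sum :: "((complex^'k^'k \<Rightarrow> complex) \<times> (('k, 'r) adhm \<Rightarrow> complex)) list \<Rightarrow>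
    complex^'k^'k \<Rightarrow> ('k, 'r) adhm \<Rightarrow> complex" where
  "tensor_sum L g y = (\<Sum>(\<phi>, p)\<leftarrow>L. \<phi> g * p y)"

text \<open>The tensor product of functions on the group with the coordinate ring. Finite lists are
  used because the elimination recurses on their length.\<close>

definition frame_tensors :: "(complex^'k^'k \<Rightarrow> ('k, 'r) adhm \<Rightarrow> complex) set" where
  "frame_tensors = {tensor_sum L | L. set L \<subseteq> frame_regular \<times> polys}"

lemma frame_tensors_single: "\<phi> \<in> frame_regular \<Longrightarrow> p \<in> polys \<Longrightarrow> (\<lambda>g y. \<phi> g * p y) \<in> frame_tensors"
  unfolding frame_tensors_def
  by (intro CollectI exI[of _ "[(\<phi>, p)]"]) (auto simp: tensor_sum_def fun_eq_iff)

lemma frame_tensors_add: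
  assumes "F \<in> frame_tensors" "G \<in> frame_tensors"
  shows "(\<lambda>g y. F g y + G g y) \<in> frame_tensors"
proof -
  obtain L L' where "F = tensor_sum L" "set L \<subseteq> frame_regular \<times> polys"
    "G = tensor_sum L'" "set L' \<subseteq> frame_regular \<times> polys"
    using assms unfolding frame_tensors_def by blast
  then show ?thesis
    unfolding frame_tensors_def
    by (intro CollectI exI[of _ "L @ L'"]) (auto simp: tensor_sum_def fun_eq_iff)
qed

lemma frame_tensors_sum: "(\<And>i. i \<in> S \<Longrightarrow> F i \<in> frame_tensors) \<Longrightarrow> (\<lambda>g y. \<Sum>i\<in>S. F i g y) \<in> frame_tensors"
proof (induction S rule: infinite_finite_induct)
  case (insert i S)
  then show ?case by (simp add: frame_tensors_add)
qed (use frame_tensors_single[OF frame_regular_const[of 0] polys.const[of 0]] in auto)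

lemma frame_tensors_mult:
  assumes "F \<in> frame_tensors" "G \<in> frame_tensors"
  shows "(\<lambda>g y. F g y * G g y) \<in> frame_tensors"
proof -
  obtain L where L: "F = tensor_sum L" "set L \<subseteq> frame_regular \<times> polys"
    using assms(1) unfolding frame_tensors_def by blast
  have 1: "(\<lambda>g y. (\<phi> g * p y) * G g y) \<in> frame_tensors" if "\<phi> \<in> frame_regular" "p \<in> polys" for \<phi> p
  proof -
    obtain L' where L': "G = tensor_sum L'" "set L' \<subseteq> frame_regular \<times> polys"
      using assms(2) unfolding frame_tensors_def by blast
    have "tensor_sum (map (\<lambda>(\<phi>', p'). (\<lambda>g. \<phi> g * \<phi>' g, \<lambda>y. p y * p' y)) L') = (\<lambda>g y. (\<phi> g * p y) * G g y)"
      unfolding L' tensor_sum_def fun_eq_iff by (induction L') (auto simp: algebra_simps)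
    moreover have "set (map (\<lambda>(\<phi>', p'). (\<lambda>g. \<phi> g * \<phi>' g, \<lambda>y. p y * p' y)) L') \<subseteq> frame_regular \<times> polys"
      using L'(2) that by (auto intro!: frame_regular_mult)
    ultimately show ?thesis
      unfolding frame_tensors_def by (metis (mono_tags, lifting) mem_Collect_eq)
  qed
  show ?thesis
    using L(2) unfolding L(1)
  proof (induction L)
    case Nil
    then show ?case
      using frame_tensors_single[OF frame_regular_const[of 0] polys.const[of 0]]
      by (simp add: tensor_sum_def)
  next
    case (Cons a L)
    obtain \<phi> p where a: "a = (\<phi>, p)" by force
    have "(\<lambda>g y. \<phi> g * p y * G g y + tensor_sum L g y * G g y) \<in> frame_tensors"
      using Cons a by (intro frame_tensors_add 1) auto
    then show ?case
      by (simp add: tensor_sum_def a algebra_simps)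
  qed
qed

text \<open>The coaction on polynomials: the coordinates of \<open>act g y\<close> are sums of
  products of entries of \<open>g\<close>, entries of \<open>matrix_inv g\<close> and coordinates of
  \<open>y\<close>.\<close>

lemma frame_tensors_act:
  assumes "a \<in> polys"
  shows "(\<lambda>g y. a (act g y)) \<in> frame_tensors"
proof -
  have cst: "(\<lambda>g y. c) \<in> frame_tensors" for c
    using frame_tensors_single[OF frame_regular_const[of c] polys.const[of 1]] by simp
  have g: "(\<lambda>g y. g $ i $ j) \<in> frame_tensors" "(\<lambda>g y. matrix_inv g $ i $ j) \<in> frame_tensors" for i j
    using frame_tensors_single[OF frame_regular_entry[of i j] polys.const[of 1]]
      frame_tensors_single[OF frame_regular_inv_entry[of i j] polys.const[of 1]] by simp_all
  have p: "(\<lambda>g. p) \<in> frame_tensors" if "p \<in> polys" for p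
    using frame_tensors_single[OF frame_regular_const[of 1] that] by simp
  note intros = frame_tensors_sum frame_tensors_mult g
    p[OF polys_coord(1)] p[OF polys_coord(2)] p[OF polys_coord(3)] p[OF polys_coord(4)]
  show ?thesis
    using assms
  proof (induction rule: polys_induct)
    case (const c) then show ?case by (rule cst)
  next
    case (add f g) then show ?case by (intro frame_tensors_add)
  next
    case (mult f g) then show ?case by (intro frame_tensors_mult)
  qed (simp_all add: act_def matrix_matrix_mult_def, (intro intros)+)
qed

text \<open>The factors depending on \<open>g\<close> turn into polynomials after the substitution
  and a common power of \<open>frame_det\<close>; as multipliers of elements of
  \<open>mu_ideal\<close> they do not leave it.\<close>

lemma frame_regular_clear:
  assumes "set L \<subseteq> frame_regular \<times> mu_ideal q"
  shows "\<exists>e \<psi>. \<psi> \<in> mu_ideal q \<and>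
    (\<forall>y. frame_det y \<noteq> 0 \<longrightarrow> \<psi> y = frame_det y ^ e * tensor_sum L (matrix_inv (frame y)) y)"
  using assms
proof (induction L)
  case Nil
  then show ?case by (intro exI[of _ 0] exI[of _ "\<lambda>y. 0"]) (simp add: tensor_sum_def)
next
  case (Cons b L)
  obtain \<phi> p where b: "b = (\<phi>, p)" by force
  obtain e \<psi> where 1: "\<psi> \<in> mu_ideal q"
    "\<And>y. frame_det y \<noteq> 0 \<Longrightarrow> \<psi> y = frame_det y ^ e * tensor_sum L (matrix_inv (frame y)) y"
    using Cons by auto
  obtain e' \<psi>' where 2: "\<psi>' \<in> polys"
    "\<And>y. frame_det y \<noteq> 0 \<Longrightarrow> \<psi>' y = frame_det y ^ e' * \<phi> (matrix_inv (frame y))"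
  proof -
    have "\<phi> \<in> frame_regular" using Cons.prems by (simp add: b)
    then show ?thesis using that unfolding frame_regular_def by blast
  qed
  have p: "p \<in> mu_ideal q" using Cons.prems b by auto
  have "(\<lambda>y. (frame_det y ^ e * \<psi>' y) * p y + frame_det y ^ e' * \<psi> y) \<in> mu_ideal q"
    using 1 2 p by (intro mu_ideal_add mu_ideal_mult) auto
  moreover have "(frame_det y ^ e * \<psi>' y) * p y + frame_det y ^ e' * \<psi> y =
      frame_det y ^ (e + e') * tensor_sum (b # L) (matrix_inv (frame y)) y" if "frame_det y \<noteq> 0" for y
    using 1(2)[OF that] 2(2)[OF that] by (simp add: tensor_sum_def b power_add algebra_simps)
  ultimately show ?case by blast
qed

text \<open>The equality of \<open>a / frame_det ^ n\<close> and \<open>b / frame_det ^ m\<close> in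
  the local ring, with a power of \<open>frame_det\<close> as the auxiliary multiplier. Elimination
  makes the defect of invariance a sum with coefficients in \<open>mu_ideal\<close>, and the inverse
  frame is then inserted for \<open>g\<close>.\<close>

lemma semi_inv_normal_lift:
  assumes a: "a \<in> semi_inv q n" and b: "normal_lift a b m"
  shows "\<exists>j. (\<lambda>y. frame_det y ^ j * (a y * frame_det y ^ m - b y * frame_det y ^ n)) \<in> mu_ideal q"
proof -
  have "a \<in> polys" using a by (simp add: semi_inv_def)
  have T: "(\<lambda>g y. a (act g y) + (- 1) * det g ^ n * a y) \<in> frame_tensors"
    by (intro frame_tensors_add frame_tensors_act frame_tensors_single frame_regular_det_power \<open>a \<in> polys\<close>)
  obtain L where L: "set L \<subseteq> frame_regular \<times> polys"
    "\<And>g y. tensor_sum L g y = a (act g y) - det g ^ n * a y"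
  proof -
    from T obtain L where L: "(\<lambda>g y. a (act g y) + (- 1) * det g ^ n * a y) = tensor_sum L"
      "set L \<subseteq> frame_regular \<times> polys"
      unfolding frame_tensors_def by blast
    have "tensor_sum L g y = a (act g y) - det g ^ n * a y" for g y
      using fun_cong[OF fun_cong[OF L(1)], of g y] by simp
    with L(2) show ?thesis by (rule that)
  qed
  have "\<exists>L'. set L' \<subseteq> frame_regular \<times> mu_ideal q \<and>
    (\<forall>g\<in>Collect invertible. \<forall>y. (\<Sum>(\<phi>, p)\<leftarrow>L. \<phi> g * p y) = (\<Sum>(\<phi>, p)\<leftarrow>L'. \<phi> g * p y))"
  proof (rule tensor_elimination)
    show "(\<lambda>y. f y - c * g y) \<in> mu_ideal q" if "f \<in> mu_ideal q" "g \<in> mu_ideal q" for f c g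
      using that by (intro mu_ideal_diff mu_ideal_scale)
    show "(\<lambda>y. c * f y) \<in> frame_regular" if "f \<in> frame_regular" for c f
      using frame_regular_mult[OF frame_regular_const that] .
    show "(\<lambda>y. \<Sum>(\<phi>, p)\<leftarrow>L. \<phi> g * p y) \<in> mu_ideal q" if "g \<in> Collect invertible" for g
      using a that L(2) by (simp add: semi_inv_def tensor_sum_def)
  qed (use L(1) in \<open>auto intro: frame_regular_diff\<close>)
  then obtain L' where L': "set L' \<subseteq> frame_regular \<times> mu_ideal q"
    "\<And>g y. invertible g \<Longrightarrow> tensor_sum L g y = tensor_sum L' g y"
    unfolding tensor_sum_def by blast
  obtain e \<psi> where \<psi>: "\<psi> \<in> mu_ideal q"
    "\<And>y. frame_det y \<noteq> 0 \<Longrightarrow> \<psi> y = frame_det y ^ e * tensor_sum L' (matrix_inv (frame y)) y"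
    using frame_regular_clear[OF L'(1)] by blast
  \<comment> \<open>The additional factor \<open>frame_det y\<close> on both sides makes the
    identity hold where \<open>frame_det y = 0\<close> even if the other exponents are zero;
    elsewhere it is the substituted defect multiplied out.\<close>
  have "frame_det y ^ (e + 1) * (a y * frame_det y ^ m - b y * frame_det y ^ n) =
      - (frame_det y ^ (n + m + 1)) * \<psi> y" for y
  proof (cases "frame_det y = 0")
    case False
    let ?D = "frame_det y" and ?d = "det (matrix_inv (frame y))"
    have "\<psi> y = ?D ^ e * (a (normal_form y) - ?d ^ n * a y)"
      using \<psi>(2)[OF False] L'(2)[OF invertible_matrix_inv[OF invertible_frame[OF False]]] L(2)
      by (simp add: normal_form_def)
    moreover have "b y = ?D ^ m * a (normal_form y)"
      using b False by (simp add: normal_lift_def)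
    moreover have "?D ^ n * ?d ^ n = 1"
      using det_frame_inv[OF False] by (simp flip: power_mult_distrib)
    moreover have "D * E * (a * M - M * X * p) = - (D * (p * M) * (E * (X - s * a)))"
      if "p * s = 1" for D E M X a p s :: complex
    proof -
      have "D * (p * M) * (E * (s * a)) = D * M * E * (p * s * a)"
        by (simp add: mult_ac)
      then show ?thesis
        by (simp add: that algebra_simps)
    qed
    ultimately show ?thesis
      by (simp add: power_add)
  qed simp
  moreover have "(\<lambda>y. - (frame_det y ^ (n + m + 1)) * \<psi> y) \<in> mu_ideal q"
    by (intro mu_ideal_mult \<psi>(1) polys_uminus polys_power) simp
  ultimately show ?thesis by (intro exI[of _ "e + 1"]) simp
qed

end

section \<open>The local ring\<close>

lemma semi_inv_polys: "f \<in> semi_inv q n \<Longrightarrow> f \<in> polys"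
  by (simp add: semi_inv_def)

lemma semi_inv_const: "(\<lambda>y. c) \<in> semi_inv q 0"
  by (simp add: semi_inv_def)

lemma semi_inv_zero: "(\<lambda>y. 0) \<in> semi_inv q n"
  by (simp add: semi_inv_def)

lemma semi_inv_exact:
  assumes "f \<in> polys" "\<And>g y. invertible g \<Longrightarrow> f (act g y) = det g ^ n * f y"
  shows "f \<in> semi_inv q n"
  using assms by (simp add: semi_inv_def)

lemma semi_inv_add:
  assumes "f \<in> semi_inv q n" "f' \<in> semi_inv q n"
  shows "(\<lambda>y. f y + f' y) \<in> semi_inv q n"
proof -
  have "(\<lambda>y. (f (act g y) + f' (act g y)) - det g ^ n * (f y + f' y)) \<in> mu_ideal q" if "invertible g" for g
  proof -
    have "(\<lambda>y. (f (act g y) - det g ^ n * f y) + (f' (act g y) - det g ^ n * f' y)) \<in> mu_ideal q"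
      using assms that by (intro mu_ideal_add) (auto simp: semi_inv_def)
    then show ?thesis by (simp add: algebra_simps)
  qed
  then show ?thesis
    using assms by (simp add: semi_inv_def)
qed

lemma semi_inv_mult:
  assumes "f \<in> semi_inv q n" "f' \<in> semi_inv q n'"
  shows "(\<lambda>y. f y * f' y) \<in> semi_inv q (n + n')"
proof -
  have "(\<lambda>y. (f (act g y) * f' (act g y)) - det g ^ (n + n') * (f y * f' y)) \<in> mu_ideal q" if "invertible g" for g
  proof -
    \<comment> \<open>The defect of a product telescopes into the defects of its factors.\<close>
    have "(\<lambda>y. f' (act g y) * (f (act g y) - det g ^ n * f y) +
        (det g ^ n * f y) * (f' (act g y) - det g ^ n' * f' y)) \<in> mu_ideal q"
      using assms that by (intro mu_ideal_add mu_ideal_mult) (auto simp: semi_inv_def intro: polys_act)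
    then show ?thesis by (simp add: algebra_simps power_add)
  qed
  then show ?thesis
    using assms by (simp add: semi_inv_def)
qed

lemma semi_inv_scale: "f \<in> semi_inv q n \<Longrightarrow> (\<lambda>y. c * f y) \<in> semi_inv q n"
  using semi_inv_mult[OF semi_inv_const[of c]] by simp

lemma semi_inv_diff: "f \<in> semi_inv q n \<Longrightarrow> f' \<in> semi_inv q n \<Longrightarrow> (\<lambda>y. f y - f' y) \<in> semi_inv q n"
  using semi_inv_add[OF _ semi_inv_scale[of f' q n "-1"], of f] by simp

context adhm_point
begin

lemma act_one: "act (mat 1) y = y"
  by (simp add: act_def matrix_inv_mat_1)

lemma x_in_orbit: "x \<in> orbit x"
  unfolding orbit_def by (auto intro!: exI[of _ "mat 1"] simp: act_one invertible_det_nz)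

text \<open>Elements of \<open>mu_ideal\<close> vanish at \<open>x\<close>, so the congruence
  becomes an equality along the orbit of \<open>x\<close>. Nonvanishing on the orbit is then decided
  at \<open>x\<close> alone.\<close>

lemma semi_inv_at:
  assumes "f \<in> semi_inv q n" "invertible g"
  shows "f (act g x) = det g ^ n * f x"
  using mu_ideal_vanish[OF _ mu_zero, of "\<lambda>y. f (act g y) - det g ^ n * f y"] assms
  by (simp add: semi_inv_def)

lemma semi_inv_orbit_nonzero:
  assumes "f \<in> semi_inv q n"
  shows "(\<forall>y\<in>orbit x. f y \<noteq> 0) \<longleftrightarrow> f x \<noteq> 0"
  using semi_inv_at[OF assms] x_in_orbit by (auto simp: orbit_def invertible_det_nz)

lemma normal_lift_semi_inv: "normal_lift a b n \<Longrightarrow> b \<in> semi_inv q n"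
  by (intro semi_inv_exact normal_lift_act) (auto dest: normal_liftD)

lemma frame_det_semi_inv: "(\<lambda>y. frame_det y ^ n) \<in> semi_inv q n"
  by (intro semi_inv_exact) (auto simp: frame_det_act power_mult_distrib)

section \<open>Fractions at the orbit and their equivalence\<close>

abbreviation "fracs \<equiv> fractions q (orbit x)"
abbreviation "rel \<equiv> frac_rel q (orbit x)"
abbreviation "L \<equiv> local_ring q (orbit x)"

lemma fracs_iff: "(a, f) \<in> fracs \<longleftrightarrow> (\<exists>n. a \<in> semi_inv q n \<and> f \<in> semi_inv q n \<and> f x \<noteq> 0)"
  unfolding fractions_def using semi_inv_orbit_nonzero by auto

lemma rel_iff: "((a, f), (b, g)) \<in> rel \<longleftrightarrow> (a, f) \<in> fracs \<and> (b, g) \<in> fracs \<and>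
    (\<exists>n h. h \<in> semi_inv q n \<and> h x \<noteq> 0 \<and> (\<lambda>y. h y * (a y * g y - b y * f y)) \<in> mu_ideal q)"
proof -
  have "h \<in> semi_inv q n \<and> (\<forall>y\<in>orbit x. h y \<noteq> 0) \<and> P \<longleftrightarrow> h \<in> semi_inv q n \<and> h x \<noteq> 0 \<and> P" for h n P
    using semi_inv_orbit_nonzero by blast
  then show ?thesis
    by (simp add: frac_rel_def)
qed

lemma fracs_polys: "(a, f) \<in> fracs \<Longrightarrow> a \<in> polys" "(a, f) \<in> fracs \<Longrightarrow> f \<in> polys"
  by (auto simp: fracs_iff semi_inv_polys)

lemma fracs_nonzero: "(a, f) \<in> fracs \<Longrightarrow> f x \<noteq> 0"
  by (auto simp: fracs_iff)

lemma fracs_add: "(a, f) \<in> fracs \<Longrightarrow> (b, g) \<in> fracs \<Longrightarrow> (\<lambda>y. a y * g y + b y * f y, \<lambda>y. f y * g y) \<in> fracs"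
  unfolding fracs_iff
proof (elim exE conjE)
  fix n m assume *: "a \<in> semi_inv q n" "f \<in> semi_inv q n" "b \<in> semi_inv q m" "g \<in> semi_inv q m"
    and "f x \<noteq> 0" "g x \<noteq> 0"
  moreover have "(\<lambda>y. a y * g y + b y * f y) \<in> semi_inv q (n + m)"
    using semi_inv_mult[OF *(1,4)] semi_inv_mult[OF *(3,2)] by (intro semi_inv_add) (simp_all add: add.commute)
  ultimately show "\<exists>n. (\<lambda>y. a y * g y + b y * f y) \<in> semi_inv q n \<and> (\<lambda>y. f y * g y) \<in> semi_inv q n \<and> f x * g x \<noteq> 0"
    using semi_inv_mult[OF *(2,4)] by auto
qed

lemma fracs_mult: "(a, f) \<in> fracs \<Longrightarrow> (b, g) \<in> fracs \<Longrightarrow> (\<lambda>y. a y * b y, \<lambda>y. f y * g y) \<in> fracs"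
  unfolding fracs_iff by (auto intro: semi_inv_mult)

lemma fracs_smult: "(a, f) \<in> fracs \<Longrightarrow> (\<lambda>y. c * a y, f) \<in> fracs"
  unfolding fracs_iff using semi_inv_scale by blast

lemma fracs_const: "(\<lambda>y. c, \<lambda>y. 1) \<in> fracs"
  unfolding fracs_iff using semi_inv_const by force

lemma relI:
  assumes "(a, f) \<in> fracs" "(b, g) \<in> fracs" "\<And>y. a y * g y = b y * f y"
  shows "((a, f), (b, g)) \<in> rel"
  unfolding rel_iff using assms semi_inv_const[of 1 q]
  by (auto intro!: exI[of _ 0] exI[of _ "\<lambda>y. 1"])

text \<open>The common pattern for symmetry, transitivity and well-definedness: the new cross
  difference, times a multiplier nonzero at \<open>x\<close>, is a polynomial combination of known
  elements of \<open>mu_ideal\<close>. When one such element is enough, it is passed twice, with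
  coefficient 0 the second time.\<close>

lemma rel_combine:
  assumes "(a, f) \<in> fracs" "(b, g) \<in> fracs"
    and "h \<in> semi_inv q n" "h x \<noteq> 0" "u \<in> mu_ideal q" "w \<in> mu_ideal q" "p \<in> polys" "r \<in> polys"
    and "\<And>y. h y * (a y * g y - b y * f y) = p y * u y + r y * w y"
  shows "((a, f), (b, g)) \<in> rel"
proof -
  have "(\<lambda>y. p y * u y + r y * w y) \<in> mu_ideal q"
    using assms by (intro mu_ideal_add mu_ideal_mult)
  moreover have "(\<lambda>y. h y * (a y * g y - b y * f y)) = (\<lambda>y. p y * u y + r y * w y)"
    using assms(9) by (simp add: fun_eq_iff)
  ultimately have "(\<lambda>y. h y * (a y * g y - b y * f y)) \<in> mu_ideal q"
    by simp
  then show ?thesis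
    using assms(1-4) unfolding rel_iff by blast
qed

lemma equiv_rel: "equiv fracs rel"
proof (rule equivI)
  show "rel \<subseteq> fracs \<times> fracs"
    by (auto simp: rel_iff)
  show "refl_on fracs rel"
    by (rule refl_onI) (auto intro: relI)
  show "sym rel"
  proof (rule symI, clarify)
    fix a f b g assume *: "((a, f), (b, g)) \<in> rel"
    then obtain n h where h: "h \<in> semi_inv q n" "h x \<noteq> 0" "(\<lambda>y. h y * (a y * g y - b y * f y)) \<in> mu_ideal q"
      by (auto simp: rel_iff)
    have fr: "(a, f) \<in> fracs" "(b, g) \<in> fracs" using * by (auto simp: rel_iff)
    show "((b, g), (a, f)) \<in> rel"
      by (rule rel_combine[OF fr(2,1) h(1,2) h(3) h(3) polys.const[of "-1"] polys.const[of 0]])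
        (simp add: algebra_simps)
  qed
  show "trans rel"
  proof (rule transI, clarify)
    fix a f b g c k assume *: "((a, f), (b, g)) \<in> rel" "((b, g), (c, k)) \<in> rel"
    have fr: "(a, f) \<in> fracs" "(b, g) \<in> fracs" "(c, k) \<in> fracs" using * by (auto simp: rel_iff)
    obtain n h where h: "h \<in> semi_inv q n" "h x \<noteq> 0" "(\<lambda>y. h y * (a y * g y - b y * f y)) \<in> mu_ideal q"
      using * by (auto simp: rel_iff)
    obtain n' h' where h': "h' \<in> semi_inv q n'" "h' x \<noteq> 0" "(\<lambda>y. h' y * (b y * k y - c y * g y)) \<in> mu_ideal q"
      using * by (auto simp: rel_iff)
    obtain m where g: "g \<in> semi_inv q m" "g x \<noteq> 0" using fr(2) by (auto simp: fracs_iff)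
    note pol = fracs_polys[OF fr(1)] fracs_polys[OF fr(3)] semi_inv_polys[OF h(1)] semi_inv_polys[OF h'(1)]
    \<comment> \<open>The middle denominator \<open>g\<close> joins the multiplier:
      \<open>h h' g (a k - c f)\<close> equals \<open>h' k\<close> times the first ideal element
      plus \<open>h f\<close> times the second.\<close>
    show "((a, f), (c, k)) \<in> rel"
      by (rule rel_combine[OF fr(1,3) semi_inv_mult[OF semi_inv_mult[OF h(1) h'(1)] g(1)] _ h(3) h'(3)
            polys.mult[OF pol(6,4)] polys.mult[OF pol(5,2)]])
        (simp_all add: h h' g algebra_simps)
  qed
qed

section \<open>Germs and the operations of the local ring\<close>

definition germ_of :: "(('k, 'r) adhm \<Rightarrow> complex) \<Rightarrow> (('k, 'r) adhm \<Rightarrow> complex) \<Rightarrow> ('k, 'r) germ" where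
  "germ_of a f = rel `` {(a, f)}"

lemma germ_of_eq_iff:
  "(a, f) \<in> fracs \<Longrightarrow> (b, g) \<in> fracs \<Longrightarrow> germ_of a f = germ_of b g \<longleftrightarrow> ((a, f), (b, g)) \<in> rel"
  unfolding germ_of_def by (rule eq_equiv_class_iff[OF equiv_rel])

lemma germ_of_eqI:
  "(a, f) \<in> fracs \<Longrightarrow> (b, g) \<in> fracs \<Longrightarrow> (\<And>y. a y * g y = b y * f y) \<Longrightarrow> germ_of a f = germ_of b g"
  by (simp add: germ_of_eq_iff relI)

lemma mem_germ_of: "(b, g) \<in> germ_of a f \<longleftrightarrow> ((a, f), (b, g)) \<in> rel"
  by (simp add: germ_of_def)

lemma carrier_L: "carrier L = {germ_of a f | a f. (a, f) \<in> fracs}"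
  by (auto simp: local_ring_def quotient_def germ_of_def)

lemma zero_L: "\<zero>\<^bsub>L\<^esub> = germ_of (\<lambda>y. 0) (\<lambda>y. 1)"
  and one_L: "\<one>\<^bsub>L\<^esub> = germ_of (\<lambda>y. 1) (\<lambda>y. 1)"
  by (simp_all add: local_ring_def germ_of_def)

text \<open>The ring operations are unions over all representatives; such a union collapses to one
  germ as soon as the result is independent of the representative.\<close>

lemma UN_germ_of:
  assumes "(a, f) \<in> fracs" "\<And>b g. ((a, f), (b, g)) \<in> rel \<Longrightarrow> F b g = (X :: 'z set)"
  shows "(\<Union>(b, g)\<in>germ_of a f. F b g) = X"
proof -
  have "(a, f) \<in> germ_of a f"
    using assms(1) by (simp add: mem_germ_of relI)
  moreover have "(case p of (b, g) \<Rightarrow> F b g) = X" if "p \<in> germ_of a f" for p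
    using that assms(2) by (cases p) (simp add: mem_germ_of)
  ultimately show ?thesis
    by (intro SUP_eq_const) auto
qed

lemma add_L:
  assumes 1: "(a, f) \<in> fracs" and 2: "(b, g) \<in> fracs"
  shows "germ_of a f \<oplus>\<^bsub>L\<^esub> germ_of b g = germ_of (\<lambda>y. a y * g y + b y * f y) (\<lambda>y. f y * g y)"
proof -
  have "germ_of (\<lambda>y. a' y * g' y + b' y * f' y) (\<lambda>y. f' y * g' y) =
      germ_of (\<lambda>y. a y * g y + b y * f y) (\<lambda>y. f y * g y)"
    if *: "((a, f), (a', f')) \<in> rel" "((b, g), (b', g')) \<in> rel" for a' f' b' g'
  proof -
    obtain n h where h: "h \<in> semi_inv q n" "h x \<noteq> 0" "(\<lambda>y. h y * (a y * f' y - a' y * f y)) \<in> mu_ideal q"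
      using * by (auto simp: rel_iff)
    obtain n' h' where h': "h' \<in> semi_inv q n'" "h' x \<noteq> 0" "(\<lambda>y. h' y * (b y * g' y - b' y * g y)) \<in> mu_ideal q"
      using * by (auto simp: rel_iff)
    have 3: "(a', f') \<in> fracs" "(b', g') \<in> fracs" using * by (auto simp: rel_iff)
    have "((\<lambda>y. a y * g y + b y * f y, \<lambda>y. f y * g y), (\<lambda>y. a' y * g' y + b' y * f' y, \<lambda>y. f' y * g' y)) \<in> rel"
    proof (rule rel_combine[OF fracs_add[OF 1 2] fracs_add[OF 3] semi_inv_mult[OF h(1) h'(1)] _ h(3) h'(3)])
      show "(\<lambda>y. h' y * (g y * g' y)) \<in> polys" "(\<lambda>y. h y * (f y * f' y)) \<in> polys"
        by (intro polys.mult semi_inv_polys[OF h(1)] semi_inv_polys[OF h'(1)] fracs_polys[OF 1]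
            fracs_polys[OF 2] fracs_polys[OF 3(1)] fracs_polys[OF 3(2)])+
    qed (use h h' in \<open>simp_all add: algebra_simps\<close>)
    then show ?thesis
      using germ_of_eq_iff[OF fracs_add[OF 1 2] fracs_add[OF 3]] by simp
  qed
  then show ?thesis
    using 1 2 by (simp add: local_ring_def flip: germ_of_def) (intro UN_germ_of; simp)
qed

lemma mult_L:
  assumes 1: "(a, f) \<in> fracs" and 2: "(b, g) \<in> fracs"
  shows "germ_of a f \<otimes>\<^bsub>L\<^esub> germ_of b g = germ_of (\<lambda>y. a y * b y) (\<lambda>y. f y * g y)"
proof -
  have "germ_of (\<lambda>y. a' y * b' y) (\<lambda>y. f' y * g' y) = germ_of (\<lambda>y. a y * b y) (\<lambda>y. f y * g y)"
    if *: "((a, f), (a', f')) \<in> rel" "((b, g), (b', g')) \<in> rel" for a' f' b' g'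
  proof -
    obtain n h where h: "h \<in> semi_inv q n" "h x \<noteq> 0" "(\<lambda>y. h y * (a y * f' y - a' y * f y)) \<in> mu_ideal q"
      using * by (auto simp: rel_iff)
    obtain n' h' where h': "h' \<in> semi_inv q n'" "h' x \<noteq> 0" "(\<lambda>y. h' y * (b y * g' y - b' y * g y)) \<in> mu_ideal q"
      using * by (auto simp: rel_iff)
    have 3: "(a', f') \<in> fracs" "(b', g') \<in> fracs" using * by (auto simp: rel_iff)
    have "((\<lambda>y. a y * b y, \<lambda>y. f y * g y), (\<lambda>y. a' y * b' y, \<lambda>y. f' y * g' y)) \<in> rel"
    \<comment> \<open>Telescoping: \<open>a b f' g' - a' b' f g\<close> is
      \<open>b g' (a f' - a' f) + a' f (b g' - b' g)\<close>.\<close>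
    proof (rule rel_combine[OF fracs_mult[OF 1 2] fracs_mult[OF 3] semi_inv_mult[OF h(1) h'(1)] _ h(3) h'(3)])
      show "(\<lambda>y. h' y * (b y * g' y)) \<in> polys" "(\<lambda>y. h y * (a' y * f y)) \<in> polys"
        by (intro polys.mult semi_inv_polys[OF h(1)] semi_inv_polys[OF h'(1)] fracs_polys[OF 1]
            fracs_polys[OF 2] fracs_polys[OF 3(1)] fracs_polys[OF 3(2)])+
    qed (use h h' in \<open>simp_all add: algebra_simps\<close>)
    then show ?thesis
      using germ_of_eq_iff[OF fracs_mult[OF 1 2] fracs_mult[OF 3]] by simp
  qed
  then show ?thesis
    using 1 2 by (simp add: local_ring_def flip: germ_of_def) (intro UN_germ_of; simp)
qed

lemma smult_L:
  assumes 1: "(a, f) \<in> fracs"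
  shows "c \<odot>\<^bsub>L\<^esub> germ_of a f = germ_of (\<lambda>y. c * a y) f"
proof -
  have "germ_of (\<lambda>y. c * a' y) f' = germ_of (\<lambda>y. c * a y) f" if *: "((a, f), (a', f')) \<in> rel" for a' f'
  proof -
    obtain n h where h: "h \<in> semi_inv q n" "h x \<noteq> 0" "(\<lambda>y. h y * (a y * f' y - a' y * f y)) \<in> mu_ideal q"
      using * by (auto simp: rel_iff)
    have 3: "(a', f') \<in> fracs" using * by (auto simp: rel_iff)
    have "((\<lambda>y. c * a y, f), (\<lambda>y. c * a' y, f')) \<in> rel"
      by (rule rel_combine[OF fracs_smult[OF 1] fracs_smult[OF 3] h(1,2) h(3) h(3) polys.const[of c] polys.const[of 0]])
        (simp add: algebra_simps)
    then show ?thesis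
      using germ_of_eq_iff[OF fracs_smult[OF 1, of c] fracs_smult[OF 3, of c]] by simp
  qed
  then show ?thesis
    using 1 by (simp add: local_ring_def flip: germ_of_def) (intro UN_germ_of; simp)
qed

lemma rel_value: "((a, f), (b, g)) \<in> rel \<Longrightarrow> a x * g x = b x * f x"
  using mu_ideal_vanish[OF _ mu_zero] by (fastforce simp: rel_iff)

text \<open>If the numerator is nonzero at \<open>x\<close>, the swapped pair is again a fraction
  and is the inverse. Conversely the value at \<open>x\<close> is multiplicative, so a unit cannot
  have value zero.\<close>

lemma Units_L: "(a, f) \<in> fracs \<Longrightarrow> germ_of a f \<in> Units L \<longleftrightarrow> a x \<noteq> 0"
proof
  assume 1: "(a, f) \<in> fracs" and "a x \<noteq> 0"
  then have 2: "(f, a) \<in> fracs" using fracs_iff by blast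
  have "germ_of (\<lambda>y. a y * f y) (\<lambda>y. f y * a y) = \<one>\<^bsub>L\<^esub>" "germ_of (\<lambda>y. f y * a y) (\<lambda>y. a y * f y) = \<one>\<^bsub>L\<^esub>"
    unfolding one_L
    by (rule germ_of_eqI[OF fracs_mult[OF 1 2] fracs_const] germ_of_eqI[OF fracs_mult[OF 2 1] fracs_const];
        simp add: mult.commute)+
  then show "germ_of a f \<in> Units L"
    using 1 2 unfolding Units_def carrier_L mult_L[OF 1 2, symmetric] mult_L[OF 2 1, symmetric] by blast
next
  assume 1: "(a, f) \<in> fracs" and "germ_of a f \<in> Units L"
  then obtain b g where 2: "(b, g) \<in> fracs" "germ_of a f \<otimes>\<^bsub>L\<^esub> germ_of b g = \<one>\<^bsub>L\<^esub>"
    by (auto simp: Units_def carrier_L)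
  then have "((\<lambda>y. a y * b y, \<lambda>y. f y * g y), (\<lambda>y. 1, \<lambda>y. 1)) \<in> rel"
    using 1 fracs_mult[OF 1 2(1)] fracs_const[of 1] by (simp add: mult_L one_L germ_of_eq_iff)
  from rel_value[OF this] show "a x \<noteq> 0"
    using fracs_nonzero[OF 1] fracs_nonzero[OF 2(1)] by auto
qed

lemma nonunits_L: "nonunits L = {germ_of a f | a f. (a, f) \<in> fracs \<and> a x = 0}"
  unfolding nonunits_def carrier_L using Units_L by auto

section \<open>The maximal ideal and its square\<close>

abbreviation "mxl \<equiv> L\<lparr>carrier := nonunits L\<rparr>"

lemma nonunitsE:
  assumes "A \<in> nonunits L"
  obtains a f where "A = germ_of a f" "(a, f) \<in> fracs" "a x = 0"
  using assms unfolding nonunits_L by blast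

lemma nonunitsI: "(a, f) \<in> fracs \<Longrightarrow> a x = 0 \<Longrightarrow> germ_of a f \<in> nonunits L"
  unfolding nonunits_L by blast

lemma cmodule_mxl: "cmodule mxl"
proof (rule cmoduleI)
  note simps = add_L smult_L zero_L fracs_add fracs_smult fracs_const
  show "A \<oplus>\<^bsub>mxl\<^esub> B \<in> carrier mxl" if "A \<in> carrier mxl" "B \<in> carrier mxl" for A B
    using that by (auto elim!: nonunitsE intro!: nonunitsI simp: simps)
  show "\<zero>\<^bsub>mxl\<^esub> \<in> carrier mxl"
    by (simp add: zero_L nonunitsI fracs_const)
  show "c \<odot>\<^bsub>mxl\<^esub> A \<in> carrier mxl" if "A \<in> carrier mxl" for c A
    using that by (auto elim!: nonunitsE intro!: nonunitsI simp: simps)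
  fix A B C c d assume "A \<in> carrier mxl" and "B \<in> carrier mxl" and "C \<in> carrier mxl"
  then obtain a f b g e h where A: "A = germ_of a f" and B: "B = germ_of b g" and C: "C = germ_of e h"
    and 1: "(a, f) \<in> fracs" and 2: "(b, g) \<in> fracs" and 3: "(e, h) \<in> fracs"
    by (auto elim!: nonunitsE)
  have "germ_of a f \<oplus>\<^bsub>L\<^esub> germ_of b g \<oplus>\<^bsub>L\<^esub> germ_of e h = germ_of a f \<oplus>\<^bsub>L\<^esub> (germ_of b g \<oplus>\<^bsub>L\<^esub> germ_of e h)"
    unfolding add_L[OF 1 2] add_L[OF 2 3] add_L[OF fracs_add[OF 1 2] 3] add_L[OF 1 fracs_add[OF 2 3]]
    by (rule germ_of_eqI[OF fracs_add[OF fracs_add[OF 1 2] 3] fracs_add[OF 1 fracs_add[OF 2 3]]])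
      (simp add: algebra_simps)
  then show "A \<oplus>\<^bsub>mxl\<^esub> B \<oplus>\<^bsub>mxl\<^esub> C = A \<oplus>\<^bsub>mxl\<^esub> (B \<oplus>\<^bsub>mxl\<^esub> C)"
    by (simp add: A B C)
  have "germ_of a f \<oplus>\<^bsub>L\<^esub> germ_of b g = germ_of b g \<oplus>\<^bsub>L\<^esub> germ_of a f"
    unfolding add_L[OF 1 2] add_L[OF 2 1]
    by (rule germ_of_eqI[OF fracs_add[OF 1 2] fracs_add[OF 2 1]]) (simp add: algebra_simps)
  then show "A \<oplus>\<^bsub>mxl\<^esub> B = B \<oplus>\<^bsub>mxl\<^esub> A"
    by (simp add: A B)
  show "\<zero>\<^bsub>mxl\<^esub> \<oplus>\<^bsub>mxl\<^esub> A = A"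
    using add_L[OF fracs_const[of 0] 1] by (simp add: A zero_L)
  have "germ_of (\<lambda>y. 0 * a y) f = \<zero>\<^bsub>L\<^esub>"
    unfolding zero_L by (rule germ_of_eqI[OF fracs_smult[OF 1] fracs_const]) simp
  then show "0 \<odot>\<^bsub>mxl\<^esub> A = \<zero>\<^bsub>mxl\<^esub>"
    by (simp add: A smult_L[OF 1])
  have "germ_of (\<lambda>y. (c + d) * a y) f = germ_of (\<lambda>y. c * a y) f \<oplus>\<^bsub>L\<^esub> germ_of (\<lambda>y. d * a y) f"
    unfolding add_L[OF fracs_smult[OF 1] fracs_smult[OF 1]]
    by (rule germ_of_eqI[OF fracs_smult[OF 1] fracs_add[OF fracs_smult[OF 1] fracs_smult[OF 1]]])
      (simp add: algebra_simps)
  then show "(c + d) \<odot>\<^bsub>mxl\<^esub> A = c \<odot>\<^bsub>mxl\<^esub> A \<oplus>\<^bsub>mxl\<^esub> d \<odot>\<^bsub>mxl\<^esub> A"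
    by (simp add: A smult_L[OF 1])
  have "c \<odot>\<^bsub>L\<^esub> (germ_of a f \<oplus>\<^bsub>L\<^esub> germ_of b g) = c \<odot>\<^bsub>L\<^esub> germ_of a f \<oplus>\<^bsub>L\<^esub> c \<odot>\<^bsub>L\<^esub> germ_of b g"
    unfolding smult_L[OF 1] smult_L[OF 2] add_L[OF 1 2] add_L[OF fracs_smult[OF 1] fracs_smult[OF 2]]
      smult_L[OF fracs_add[OF 1 2]]
    by (rule germ_of_eqI[OF fracs_smult[OF fracs_add[OF 1 2]] fracs_add[OF fracs_smult[OF 1] fracs_smult[OF 2]]])
      (simp add: algebra_simps)
  then show "c \<odot>\<^bsub>mxl\<^esub> (A \<oplus>\<^bsub>mxl\<^esub> B) = c \<odot>\<^bsub>mxl\<^esub> A \<oplus>\<^bsub>mxl\<^esub> c \<odot>\<^bsub>mxl\<^esub> B"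
    by (simp add: A B)
  show "(c * d) \<odot>\<^bsub>mxl\<^esub> A = c \<odot>\<^bsub>mxl\<^esub> (d \<odot>\<^bsub>mxl\<^esub> A)"
    by (simp add: A smult_L[OF 1] smult_L[OF fracs_smult[OF 1]] mult.assoc)
  show "1 \<odot>\<^bsub>mxl\<^esub> A = A"
    by (simp add: A smult_L[OF 1])
qed

abbreviation "mxl2 \<equiv> nonunits L \<cdot>\<^bsub>L\<^esub> nonunits L"

lemma mxl2_induct [consumes 1, case_names prod sum]:
  assumes "A \<in> mxl2"
    and "\<And>a f b g. (a, f) \<in> fracs \<Longrightarrow> (b, g) \<in> fracs \<Longrightarrow> a x = 0 \<Longrightarrow> b x = 0 \<Longrightarrow>
      P (germ_of (\<lambda>y. a y * b y) (\<lambda>y. f y * g y))"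
    and "\<And>A B. A \<in> mxl2 \<Longrightarrow> P A \<Longrightarrow> B \<in> mxl2 \<Longrightarrow> P B \<Longrightarrow> P (A \<oplus>\<^bsub>L\<^esub> B)"
  shows "P A"
  using assms(1)
proof (induction rule: ideal_prod.induct)
  case (prod i j)
  then show ?case using assms(2) by (auto elim!: nonunitsE simp: mult_L)
qed (use assms(3) in auto)

lemma mxl2I:
  "(a, f) \<in> fracs \<Longrightarrow> (b, g) \<in> fracs \<Longrightarrow> a x = 0 \<Longrightarrow> b x = 0 \<Longrightarrow>
    germ_of (\<lambda>y. a y * b y) (\<lambda>y. f y * g y) \<in> mxl2"
  using ideal_prod.prod[OF nonunitsI nonunitsI, of a f b g L] by (simp add: mult_L)

lemma csubmodule_mxl2: "csubmodule mxl mxl2"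
proof -
  note M = cmoduleD[OF cmodule_mxl]
  have sub: "A \<in> nonunits L" if "A \<in> mxl2" for A
    using that
  proof (induction rule: mxl2_induct)
    case (prod a f b g)
    then show ?case by (intro nonunitsI fracs_mult) auto
  next
    case (sum A B)
    then show ?case using M(1)[of A B] by simp
  qed
  have "c \<odot>\<^bsub>L\<^esub> A \<in> mxl2" if "A \<in> mxl2" for c A
    using that
  proof (induction rule: mxl2_induct)
    case (prod a f b g)
    then show ?case
      using mxl2I[OF fracs_smult[OF prod(1), of c] prod(2)] by (simp add: smult_L fracs_mult mult.assoc)
  next
    case (sum A B)
    then show ?case
      using M(9)[of A B c] sub by (auto intro: ideal_prod.sum)
  qed
  moreover have "\<zero>\<^bsub>L\<^esub> \<in> mxl2"
    using mxl2I[OF fracs_const[of 0] fracs_const[of 0]] by (simp add: zero_L)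
  ultimately show ?thesis
    using sub cmodule_mxl by (auto simp: csubmodule_def intro: ideal_prod.sum)
qed

text \<open>The quotient rule at a point where the numerator vanishes. The choice of a
  representative is harmless for \<open>v\<close> in the kernel of \<open>d_mu\<close>.\<close>

definition germ_deriv :: "('k, 'r) adhm \<Rightarrow> ('k, 'r) germ \<Rightarrow> complex" where
  "germ_deriv v A = (case SOME p. p \<in> A of (a, f) \<Rightarrow> dir_deriv a x v / f x)"

text \<open>Equivalence puts \<open>h (a g - b f)\<close> into \<open>mu_ideal\<close>, so its
  derivative along \<open>v\<close> is zero. Since \<open>a\<close> and \<open>b\<close> vanish at
  \<open>x\<close>, only \<open>h (da g - db f)\<close> survives there, and \<open>h\<close> can be
  cancelled.\<close>

lemma germ_deriv:
  assumes "d_mu q x v = 0" "(a, f) \<in> fracs" "a x = 0"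
  shows "germ_deriv v (germ_of a f) = dir_deriv a x v / f x"
proof -
  have "dir_deriv b x v / g x = dir_deriv a x v / f x" if *: "((a, f), (b, g)) \<in> rel" for b g
  proof -
    obtain n h where h: "h \<in> semi_inv q n" "h x \<noteq> 0" "(\<lambda>y. h y * (a y * g y - b y * f y)) \<in> mu_ideal q"
      using * by (auto simp: rel_iff)
    have 2: "(b, g) \<in> fracs" using * by (auto simp: rel_iff)
    have "b x = 0" using rel_value[OF *] assms(3) fracs_nonzero[OF assms(2)] by simp
    note pol = fracs_polys[OF assms(2)] fracs_polys[OF 2] semi_inv_polys[OF h(1)]
    have "dir_deriv (\<lambda>y. h y * (a y * g y - b y * f y)) x v = 0"
      by (rule dir_deriv_mu_ideal[OF h(3) mu_zero assms(1)])
    then have "dir_deriv a x v * g x = dir_deriv b x v * f x"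
      using pol h(2) \<open>b x = 0\<close> assms(3) by (simp add: dir_deriv_mult dir_deriv_diff)
    then show ?thesis
      using fracs_nonzero[OF 2] fracs_nonzero[OF assms(2)] by (simp add: field_simps)
  qed
  moreover have "(SOME p. p \<in> germ_of a f) \<in> germ_of a f"
    by (rule someI[of _ "(a, f)"]) (simp add: mem_germ_of relI assms)
  ultimately show ?thesis
    unfolding germ_deriv_def by (auto simp: mem_germ_of split: prod.splits)
qed

lemma functional_germ_deriv:
  assumes "d_mu q x v = 0"
  shows "functional mxl (germ_deriv v)"
  unfolding functional_def
proof (intro conjI ballI allI)
  fix A B assume "A \<in> carrier mxl" "B \<in> carrier mxl"
  then obtain a f b g where *: "A = germ_of a f" "(a, f) \<in> fracs" "a x = 0"
    "B = germ_of b g" "(b, g) \<in> fracs" "b x = 0"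
    by (auto elim!: nonunitsE)
  have "dir_deriv (\<lambda>y. a y * g y + b y * f y) x v = dir_deriv a x v * g x + dir_deriv b x v * f x"
    using * by (simp add: dir_deriv_add dir_deriv_mult fracs_polys)
  then show "germ_deriv v (A \<oplus>\<^bsub>mxl\<^esub> B) = germ_deriv v A + germ_deriv v B"
    using * fracs_add[OF *(2,5)] fracs_nonzero[OF *(2)] fracs_nonzero[OF *(5)]
    by (simp add: germ_deriv[OF assms] add_L field_simps)
next
  fix c A assume "A \<in> carrier mxl"
  then obtain a f where *: "A = germ_of a f" "(a, f) \<in> fracs" "a x = 0"
    by (auto elim!: nonunitsE)
  then show "germ_deriv v (c \<odot>\<^bsub>mxl\<^esub> A) = c * germ_deriv v A"
    using fracs_smult[OF *(2), of c]
    by (simp add: germ_deriv[OF assms] smult_L dir_deriv_scale fracs_polys)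
qed

lemma germ_deriv_mxl2:
  assumes "d_mu q x v = 0" "A \<in> mxl2"
  shows "germ_deriv v A = 0"
  using assms(2)
proof (induction rule: mxl2_induct)
  case (prod a f b g)
  then show ?case
    by (simp add: germ_deriv[OF assms(1)] fracs_mult dir_deriv_mult fracs_polys)
next
  case (sum A B)
  then have "A \<in> nonunits L" "B \<in> nonunits L"
    using csubmoduleD(2)[OF csubmodule_mxl2] by auto
  then show ?case
    using functional_germ_deriv[OF assms(1)] sum by (simp add: functional_def)
qed

definition tangent_map :: "('k, 'r) adhm \<Rightarrow> ('k, 'r) germ set \<Rightarrow> complex" where
  "tangent_map v = quotient_lift mxl mxl2 (germ_deriv v)"

lemma tangent_space_eq: "tangent_space q (orbit x) = dual_module (quotient_module mxl mxl2)"
  by (simp add: tangent_space_def zariski_tangent_def)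

lemma tangent_map_germ:
  assumes "d_mu q x v = 0" "(a, f) \<in> fracs" "a x = 0"
  shows "tangent_map v (mxl2 +>\<^bsub>mxl\<^esub> germ_of a f) = dir_deriv a x v / f x"
  unfolding tangent_map_def
  using quotient_lift_coset[OF csubmodule_mxl2 functional_germ_deriv[OF assms(1)] germ_deriv_mxl2[OF assms(1)]]
    germ_deriv[OF assms] nonunitsI[OF assms(2,3)] by simp

lemma tangent_map_closed:
  "d_mu q x v = 0 \<Longrightarrow> tangent_map v \<in> carrier (tangent_space q (orbit x))"
  unfolding tangent_map_def tangent_space_eq
  by (intro quotient_lift_dual csubmodule_mxl2 functional_germ_deriv germ_deriv_mxl2)

lemma tangent_space_eqI:
  assumes "\<delta> \<in> carrier (tangent_space q (orbit x))" "\<epsilon> \<in> carrier (tangent_space q (orbit x))"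
    and "\<And>a f. (a, f) \<in> fracs \<Longrightarrow> a x = 0 \<Longrightarrow>
      \<delta> (mxl2 +>\<^bsub>mxl\<^esub> germ_of a f) = \<epsilon> (mxl2 +>\<^bsub>mxl\<^esub> germ_of a f)"
  shows "\<delta> = \<epsilon>"
  by (rule dual_quotient_eqI[of _ mxl mxl2])
    (use assms in \<open>auto simp: tangent_space_eq elim!: nonunitsE\<close>)

end

section \<open>The tangent space\<close>

lemma adjugate_mat_1: "adjugate (mat 1 :: complex^'n^'n) = mat 1"
proof -
  have "invertible (mat 1 :: complex^'n^'n)" by (simp add: invertible_det_nz)
  then show ?thesis by (simp add: adjugate_eq matrix_inv_mat_1 vec_eq_iff)
qed

text \<open>Near 0 the inverse is given by the adjugate formula \<open>c\<close>, which is visibly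
  differentiable; its derivative is found by differentiating
  \<open>g t ** c t = mat 1\<close>.\<close>

lemma infinitesimal_inverse:
  fixes \<xi> :: "complex^'k^'k"
  defines "g \<equiv> \<lambda>t. mat 1 + mscale t \<xi>"
  obtains c where "c 0 = mat 1" "matrix_deriv g \<xi>" "matrix_deriv c (- \<xi>)"
    "\<forall>\<^sub>F t in nhds 0. invertible (g t) \<and> matrix_inv (g t) = c t"
proof -
  \<comment> \<open>The curve of matrices is placed in the first component of a curve of triples, so
    that \<open>dir_deriv_curve\<close> applies to the determinant and the adjugate as
    polynomials.\<close>
  define z :: "complex \<Rightarrow> ('k, 'k) adhm" where "z t = (g t, 0, 0, 0)" for t
  have g': "matrix_deriv g \<xi>"
    unfolding matrix_deriv_def g_def by (auto intro!: derivative_eq_intros)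
  have z: "curve z (mat 1, 0, 0, 0) (\<xi>, 0, 0, 0)"
    using g' by (simp add: curve_def z_def) (simp add: g_def vec_eq_iff)
  have g0: "g 0 = mat 1" by (simp add: g_def vec_eq_iff)
  define c where "c t = mscale (inverse (det (g t))) (adjugate (g t))" for t
  have c0: "c 0 = mat 1" by (simp add: c_def g0 adjugate_mat_1 vec_eq_iff)
  have "\<exists>d. ((\<lambda>t. det (g t)) has_field_derivative d) (at 0)"
    using dir_deriv_curve[OF polys_det[OF poly_matrix_coord(1)] z] by (auto simp: z_def)
  then obtain d where d: "((\<lambda>t. det (g t)) has_field_derivative d) (at 0)" by blast
  have "\<exists>e. ((\<lambda>t. adjugate (g t) $ i $ j) has_field_derivative e) (at 0)" for i j
    using dir_deriv_curve[OF poly_matrix_adjugate[OF poly_matrix_coord(1), unfolded poly_matrix_def, rule_format] z, of i j]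
    by (auto simp: z_def)
  then obtain e where e: "\<And>i j. ((\<lambda>t. adjugate (g t) $ i $ j) has_field_derivative e i j) (at 0)"
    by metis
  have "\<exists>C. ((\<lambda>t. c t $ i $ j) has_field_derivative C) (at 0)" for i j
    unfolding c_def mscale_nth
    using DERIV_mult[OF DERIV_inverse_fun[OF d] e[of i j]] g0 by auto
  then obtain C where C: "\<And>i j. ((\<lambda>t. c t $ i $ j) has_field_derivative C i j) (at 0)"
    by metis
  define C' :: "complex^'k^'k" where "C' = (\<chi> i j. C i j)"
  have c': "matrix_deriv c C'"
    using C by (simp add: matrix_deriv_def C'_def)
  have "\<forall>\<^sub>F t in at 0. det (g t) \<noteq> 0"
    using DERIV_isCont[OF d] by (intro tendsto_imp_eventually_ne[of _ 1]) (simp_all add: isCont_def g0)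
  then have "\<forall>\<^sub>F t in nhds 0. det (g t) \<noteq> 0"
    by (simp add: eventually_nhds_conv_at g0)
  then have ev: "\<forall>\<^sub>F t in nhds 0. invertible (g t) \<and> matrix_inv (g t) = c t"
  proof (rule eventually_mono)
    fix t assume t: "det (g t) \<noteq> 0"
    then have "invertible (g t)" by (simp add: invertible_det_nz)
    then show "invertible (g t) \<and> matrix_inv (g t) = c t"
      using t by (simp add: c_def adjugate_eq vec_eq_iff)
  qed
  have "\<xi> + C' = 0"
  proof -
    have "matrix_deriv (\<lambda>t. g t ** c t) (\<xi> + C')"
      using matrix_deriv_mult[OF g' c'] by (simp add: c0 g0)
    then have 1: "((\<lambda>t. (g t ** c t) $ i $ j) has_field_derivative (\<xi> + C') $ i $ j) (at 0)" for i j
      by (simp add: matrix_deriv_def)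
    have 2: "\<forall>\<^sub>F t in nhds 0. (g t ** c t) $ i $ j = mat 1 $ i $ j" for i j
      using ev by (rule eventually_mono) (metis matrix_inv_cancel(1))
    have "((\<lambda>t. mat 1 $ i $ j) has_field_derivative (\<xi> + C') $ i $ j) (at (0::complex))" for i j
      using 1[of i j] DERIV_cong_ev[OF refl 2[of i j] refl] by simp
    then have "(\<xi> + C') $ i $ j = 0" for i j
      using DERIV_unique[OF _ DERIV_const] by blast
    then show ?thesis by (simp add: vec_eq_iff)
  qed
  then have "C' = - \<xi>" by (simp add: eq_neg_iff_add_eq_0 add.commute)
  then show thesis
    using that[of c] c0 g' c' ev by simp
qed

lemma d_phi_def:
  "d_phi x \<xi> = (\<xi> ** adhm_B1 x - adhm_B1 x ** \<xi>, \<xi> ** adhm_B2 x - adhm_B2 x ** \<xi>, \<xi> ** adhm_I x,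
    - (adhm_J x ** \<xi>))"
  by (cases x) simp

section \<open>The kernel of the tangent map\<close>

context adhm_point
begin

text \<open>The curve \<open>act (mat 1 + mscale t \<xi>) x\<close> has velocity
  \<open>d_phi x \<xi>\<close>, and a semi-invariant vanishing at \<open>x\<close> is zero along
  it.\<close>

lemma dir_deriv_d_phi:
  assumes a: "a \<in> semi_inv q n" "a x = 0"
  shows "dir_deriv a x (d_phi x \<xi>) = 0"
proof -
  define g where "g t = mat 1 + mscale t \<xi>" for t
  obtain c where c: "c 0 = mat 1" "matrix_deriv g \<xi>" "matrix_deriv c (- \<xi>)"
    "\<forall>\<^sub>F t in nhds 0. invertible (g t) \<and> matrix_inv (g t) = c t"
    using infinitesimal_inverse[of \<xi>] unfolding g_def[abs_def] by blast
  have g0: "g 0 = mat 1" by (simp add: g_def vec_eq_iff)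
  \<comment> \<open>Written with \<open>c t\<close> in place of the inverse, so that
    differentiability is immediate; it agrees with the orbit curve for small
    \<open>t\<close>.\<close>
  define y where "y t = (g t ** adhm_B1 x ** c t, g t ** adhm_B2 x ** c t, g t ** adhm_I x, adhm_J x ** c t)" for t
  have conj: "matrix_deriv (\<lambda>t. g t ** B ** c t) (\<xi> ** B - B ** \<xi>)" for B
    using matrix_deriv_mult[OF matrix_deriv_mult[OF c(2) matrix_deriv_const[of B]] c(3)]
    by (simp add: c(1) g0 matrix_mult_uminus_right)
  have gI: "matrix_deriv (\<lambda>t. g t ** adhm_I x) (\<xi> ** adhm_I x)"
    using matrix_deriv_mult[OF c(2) matrix_deriv_const[of "adhm_I x"]] by simp
  have Jc: "matrix_deriv (\<lambda>t. adhm_J x ** c t) (- (adhm_J x ** \<xi>))"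
    using matrix_deriv_mult[OF matrix_deriv_const[of "adhm_J x"] c(3)] by (simp add: matrix_mult_uminus_right)
  have "curve y x (d_phi x \<xi>)"
    using conj gI Jc by (simp add: curve_def y_def d_phi_def c(1) g0)
  then have "((\<lambda>t. a (y t)) has_field_derivative dir_deriv a x (d_phi x \<xi>)) (at 0)"
    using semi_inv_polys[OF a(1)] by (rule dir_deriv_curve[rotated])
  moreover have "\<forall>\<^sub>F t in nhds 0. a (y t) = 0"
    using c(4)
  proof (rule eventually_mono)
    fix t assume t: "invertible (g t) \<and> matrix_inv (g t) = c t"
    then have "y t = act (g t) x" by (simp add: y_def act_def)
    then show "a (y t) = 0" using semi_inv_at[OF a(1), of "g t"] t a(2) by simp
  qed
  ultimately have "((\<lambda>t. 0) has_field_derivative dir_deriv a x (d_phi x \<xi>)) (at (0::complex))"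
    using DERIV_cong_ev[OF refl _ refl, of "\<lambda>t. a (y t)" "\<lambda>t. 0"] by blast
  then show ?thesis
    using DERIV_unique[OF _ DERIV_const] by blast
qed

text \<open>The form, free of denominators, of the statement that \<open>a o normal_form\<close> has
  derivative zero along \<open>v\<close>: subtracting \<open>a x * frame_det ^ n\<close> from
  \<open>b\<close> gives a numerator vanishing at \<open>x\<close>, to which the hypothesis
  applies.\<close>

lemma dir_deriv_normal_lift:
  assumes v: "\<And>a f. (a, f) \<in> fracs \<Longrightarrow> a x = 0 \<Longrightarrow> dir_deriv a x v = 0"
    and b: "normal_lift a b n"
  shows "dir_deriv b x v = a x * dir_deriv (\<lambda>y. frame_det y ^ n) x v"
proof -
  have "(\<lambda>y. b y - a x * frame_det y ^ n, \<lambda>y. frame_det y ^ n) \<in> fracs"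
    unfolding fracs_iff
    using semi_inv_diff[OF normal_lift_semi_inv[OF b] semi_inv_scale[OF frame_det_semi_inv]]
      frame_det_semi_inv
    by (intro exI[of _ n]) simp
  then have "dir_deriv (\<lambda>y. b y - a x * frame_det y ^ n) x v = 0"
    by (rule v) (simp add: normal_lift_x[OF b])
  then show ?thesis
    using normal_liftD(1)[OF b] by (simp add: dir_deriv_diff dir_deriv_scale)
qed

text \<open>Recovers \<open>A y\<close> from its value on the normal form by conjugating with the
  frame, with denominators cleared so that the identity can be differentiated.\<close>

lemma frame_endo_lift: "frame y ** endo_lift A y = mscale (frame_det y ^ 2) (A y ** frame y)"
proof (cases "frame_det y = 0")
  case False
  then show ?thesis
    by (simp add: endo_lift_def frame_adj_eq mscale_mult_left mscale_mult_right matrix_mul_assoc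
        matrix_inv_cancel invertible_frame) (simp add: vec_eq_iff power2_eq_square)
qed (simp add: endo_lift_def vec_eq_iff matrix_matrix_mult_def)

lemma frame_I_lift: "frame y ** I_lift y = mscale (frame_det y ^ 2) (adhm_I y)"
proof (cases "frame_det y = 0")
  case False
  then show ?thesis
    by (simp add: I_lift_def frame_adj_eq mscale_mult_left mscale_mult_right matrix_mul_assoc
        matrix_inv_cancel invertible_frame) (simp add: vec_eq_iff power2_eq_square)
qed (simp add: I_lift_def vec_eq_iff matrix_matrix_mult_def)

lemma killed_imp_d_phi:
  assumes v: "\<And>a f. (a, f) \<in> fracs \<Longrightarrow> a x = 0 \<Longrightarrow> dir_deriv a x v = 0"
  shows "v \<in> range (d_phi x)"
proof -
  define \<xi> where "\<xi> = matrix_dir_deriv frame x v"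
  have mscale_1: "mscale 1 A = A" for A :: "complex^'n^'m"
    by (simp add: vec_eq_iff)
  have endo: "matrix_dir_deriv A x v = \<xi> ** A x - A x ** \<xi>"
    if A: "poly_matrix A" "\<And>i j. normal_lift (\<lambda>y. A y $ i $ j) (\<lambda>y. endo_lift A y $ i $ j) 2" for A
  proof -
    let ?s = "dir_deriv (\<lambda>y. frame_det y ^ 2) x v"
    have x: "endo_lift A x = A x"
      by (simp add: vec_eq_iff normal_lift_x[OF A(2)])
    have lift: "matrix_dir_deriv (endo_lift A) x v = mscale ?s (A x)"
      by (simp add: vec_eq_iff matrix_dir_deriv_def dir_deriv_normal_lift[OF v A(2)])
    \<comment> \<open>The derivative of \<open>frame_endo_lift\<close> is computed on both sides.
      The derivative of \<open>frame_det ^ 2\<close> enters each as the same multiple of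
      \<open>A x\<close> and cancels.\<close>
    have "matrix_dir_deriv (\<lambda>y. frame y ** endo_lift A y) x v = \<xi> ** A x + mscale ?s (A x)"
      using matrix_dir_deriv_mult[OF frame(1) poly_matrix_endo_lift[OF A(1)], of x v]
      by (simp add: x lift frame(3) \<xi>_def)
    moreover have "matrix_dir_deriv (\<lambda>y. frame y ** endo_lift A y) x v =
        mscale ?s (A x) + (matrix_dir_deriv A x v + A x ** \<xi>)"
      unfolding frame_endo_lift
      using matrix_dir_deriv_mscale[of "\<lambda>y. frame_det y ^ 2" "\<lambda>y. A y ** frame y" x v]
        matrix_dir_deriv_mult[OF A(1) frame(1), of x v] poly_matrix_mult[OF A(1) frame(1)]
      by (simp add: frame(3) \<xi>_def mscale_1)
    ultimately show ?thesis
      by (simp add: algebra_simps)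
  qed
  have "adhm_B1 v = \<xi> ** adhm_B1 x - adhm_B1 x ** \<xi>"
    using endo[OF poly_matrix_coord(1) normal_lift_B1] by simp
  moreover have "adhm_B2 v = \<xi> ** adhm_B2 x - adhm_B2 x ** \<xi>"
    using endo[OF poly_matrix_coord(2) normal_lift_B2] by simp
  moreover have "adhm_I v = \<xi> ** adhm_I x"
  proof -
    let ?s = "dir_deriv (\<lambda>y. frame_det y ^ 2) x v"
    have x: "I_lift x = adhm_I x"
      by (simp add: vec_eq_iff normal_lift_x[OF normal_lift_I])
    have lift: "matrix_dir_deriv I_lift x v = mscale ?s (adhm_I x)"
      by (simp add: vec_eq_iff matrix_dir_deriv_def dir_deriv_normal_lift[OF v normal_lift_I])
    have "matrix_dir_deriv (\<lambda>y. frame y ** I_lift y) x v = \<xi> ** adhm_I x + mscale ?s (adhm_I x)"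
      using matrix_dir_deriv_mult[OF frame(1) poly_matrix_I_lift, of x v]
      by (simp add: x lift frame(3) \<xi>_def)
    moreover have "matrix_dir_deriv (\<lambda>y. frame y ** I_lift y) x v = mscale ?s (adhm_I x) + adhm_I v"
      unfolding frame_I_lift
      using matrix_dir_deriv_mscale[of "\<lambda>y. frame_det y ^ 2" "\<lambda>y. adhm_I y" x v]
      by (simp add: mscale_1)
    ultimately show ?thesis
      by (simp add: algebra_simps)
  qed
  moreover have "adhm_J v = - (adhm_J x ** \<xi>)"
  proof -
    let ?s = "dir_deriv frame_det x v"
    have lift: "matrix_dir_deriv J_lift x v = mscale ?s (adhm_J x)"
      using dir_deriv_normal_lift[OF v normal_lift_J] by (simp add: vec_eq_iff matrix_dir_deriv_def)
    have "matrix_dir_deriv J_lift x v = mscale ?s (adhm_J x) + (adhm_J v + adhm_J x ** \<xi>)"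
      unfolding J_lift_def[abs_def]
      using matrix_dir_deriv_mscale[OF polys_frame_det(2) poly_matrix_mult[OF poly_matrix_coord(4) frame(1)], of x v]
        matrix_dir_deriv_mult[OF poly_matrix_coord(4) frame(1), of x v]
      by (simp add: frame(3) \<xi>_def mscale_1)
    then show ?thesis
      using lift by (simp add: eq_neg_iff_add_eq_0)
  qed
  ultimately have "v = d_phi x \<xi>"
    by (simp add: d_phi_def prod_eq_iff)
  then show ?thesis by blast
qed

section \<open>Surjectivity of the tangent map\<close>

lemma zero_germ: "(\<lambda>y. 0, f) \<in> fracs \<Longrightarrow> germ_of (\<lambda>y. 0) f = \<zero>\<^bsub>L\<^esub>"
  unfolding zero_L by (rule germ_of_eqI[OF _ fracs_const]) auto

text \<open>Numerator of \<open>b / frame_det ^ n\<close> minus its value at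
  \<open>x\<close>.\<close>

abbreviation shifted :: "(('k, 'r) adhm \<Rightarrow> complex) \<Rightarrow> nat \<Rightarrow> ('k, 'r) adhm \<Rightarrow> complex" where
  "shifted b n \<equiv> \<lambda>y. b y - b x * frame_det y ^ n"

lemma shifted_fracs: "b \<in> semi_inv q n \<Longrightarrow> (shifted b n, \<lambda>y. frame_det y ^ n) \<in> fracs"
  unfolding fracs_iff using semi_inv_diff[OF _ semi_inv_scale[OF frame_det_semi_inv]] frame_det_semi_inv
  by (intro exI[of _ n]) simp

text \<open>Both lifts represent \<open>a o normal_form\<close>, so the germ depends on
  \<open>a\<close> only and a lift may be exchanged for a more convenient one.\<close>

lemma normal_lift_shifted_eq:
  assumes "normal_lift a b n" "normal_lift a b' n'"
  shows "germ_of (shifted b n) (\<lambda>y. frame_det y ^ n) = germ_of (shifted b' n') (\<lambda>y. frame_det y ^ n')"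
proof (rule germ_of_eqI)
  fix y
  have "b y * frame_det y ^ n' = b' y * frame_det y ^ n"
    using normal_liftD(2,3)[OF assms(1)] normal_liftD(2,3)[OF assms(2)] by (cases "frame_det y = 0") simp_all
  then show "shifted b n y * frame_det y ^ n' = shifted b' n' y * frame_det y ^ n"
    using normal_lift_x[OF assms(1)] normal_lift_x[OF assms(2)] by (simp add: algebra_simps)
qed (use assms in \<open>auto intro: shifted_fracs normal_lift_semi_inv\<close>)

lemma tangent_map_surj:
  assumes \<delta>: "\<delta> \<in> carrier (tangent_space q (orbit x))"
  shows "\<exists>v. d_mu q x v = 0 \<and> tangent_map v = \<delta>"
proof -
  define \<phi> where "\<phi> A = \<delta> (mxl2 +>\<^bsub>mxl\<^esub> A)" for A
  have \<phi>_fun: "functional mxl \<phi>" and \<phi>0: "\<And>A. A \<in> mxl2 \<Longrightarrow> \<phi> A = 0"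
    using dual_quotient_functional[OF csubmodule_mxl2, of \<delta>] \<delta> unfolding tangent_space_eq \<phi>_def[abs_def] by auto
  have \<phi>_add: "\<phi> (A \<oplus>\<^bsub>L\<^esub> B) = \<phi> A + \<phi> B" if "A \<in> nonunits L" "B \<in> nonunits L" for A B
    using \<phi>_fun that by (simp add: functional_def)
  have \<phi>_smult: "\<phi> (c \<odot>\<^bsub>L\<^esub> A) = c * \<phi> A" if "A \<in> nonunits L" for c A
    using \<phi>_fun that by (simp add: functional_def)
  have \<phi>_zero: "\<phi> \<zero>\<^bsub>L\<^esub> = 0"
    using functional_zero[OF cmodule_mxl \<phi>_fun] by simp
  \<comment> \<open>On lifts of \<open>a\<close> this is the tangent vector applied to
    \<open>a o normal_form\<close> minus its value at \<open>x\<close>: a derivation in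
    \<open>a\<close>.\<close>
  define \<nu> where "\<nu> b n = \<phi> (germ_of (shifted b n) (\<lambda>y. frame_det y ^ n))" for b n
  have \<nu>_eq: "\<nu> b n = \<nu> b' n'" if "normal_lift a b n" "normal_lift a b' n'" for a b n b' n'
    using normal_lift_shifted_eq[OF that] by (simp add: \<nu>_def)
  \<comment> \<open>The components are the values of this derivation on the coordinates; a
    derivation on polynomials is determined by them.\<close>
  define v :: "('k, 'r) adhm" where "v =
    ((\<chi> i j. \<nu> (\<lambda>y. endo_lift adhm_B1 y $ i $ j) 2), (\<chi> i j. \<nu> (\<lambda>y. endo_lift (\<lambda>y. adhm_B2 y) y $ i $ j) 2),
     (\<chi> i s. \<nu> (\<lambda>y. I_lift y $ i $ s) 2), (\<chi> s i. \<nu> (\<lambda>y. J_lift y $ s $ i) 1))"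
  have main: "\<nu> b n = dir_deriv a x v" if "a \<in> polys" "normal_lift a b n" for a b n
    using that
  proof (induction arbitrary: b n rule: polys_induct)
    case (const c)
    have "(\<lambda>y. 0, \<lambda>y. frame_det y ^ 1) \<in> fracs"
      using shifted_fracs[OF semi_inv_zero, of 1] by simp
    then have "\<nu> (\<lambda>y. c * frame_det y) 1 = 0"
      by (simp add: \<nu>_def zero_germ \<phi>_zero)
    then show ?case
      using \<nu>_eq[OF const normal_lift_const] by simp
  next
    case (B1 i j)
    then show ?case using \<nu>_eq[OF B1 normal_lift_B1] by (simp add: v_def)
  next
    case (B2 i j)
    then show ?case using \<nu>_eq[OF B2 normal_lift_B2] by (simp add: v_def)
  next
    case (I i s)
    then show ?case using \<nu>_eq[OF I normal_lift_I] by (simp add: v_def)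
  next
    case (J s i)
    then show ?case using \<nu>_eq[OF J normal_lift_J] by (simp add: v_def)
  next
    case (add f g)
    obtain b1 n1 b2 n2 where lift: "normal_lift f b1 n1" "normal_lift g b2 n2"
      using normal_lift_exists add.hyps by metis
    note 1 = shifted_fracs[OF normal_lift_semi_inv[OF lift(1)]]
    note 2 = shifted_fracs[OF normal_lift_semi_inv[OF lift(2)]]
    let ?b = "\<lambda>y. frame_det y ^ n2 * b1 y + frame_det y ^ n1 * b2 y"
    have "germ_of (shifted ?b (n1 + n2)) (\<lambda>y. frame_det y ^ (n1 + n2)) =
        germ_of (shifted b1 n1) (\<lambda>y. frame_det y ^ n1) \<oplus>\<^bsub>L\<^esub> germ_of (shifted b2 n2) (\<lambda>y. frame_det y ^ n2)"
      unfolding add_L[OF 1 2]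
      by (intro arg_cong2[of _ _ _ _ germ_of]) (simp_all add: fun_eq_iff power_add algebra_simps)
    then have "\<nu> ?b (n1 + n2) = \<nu> b1 n1 + \<nu> b2 n2"
      unfolding \<nu>_def using \<phi>_add[OF nonunitsI[OF 1] nonunitsI[OF 2]] by simp
    then show ?case
      using \<nu>_eq[OF add.prems normal_lift_add[OF lift]] add.IH(1)[OF lift(1)] add.IH(2)[OF lift(2)] add.hyps
      by (simp add: dir_deriv_add)
  next
    case (mult f g)
    obtain b1 n1 b2 n2 where lift: "normal_lift f b1 n1" "normal_lift g b2 n2"
      using normal_lift_exists mult.hyps by metis
    note 1 = shifted_fracs[OF normal_lift_semi_inv[OF lift(1)]]
    note 2 = shifted_fracs[OF normal_lift_semi_inv[OF lift(2)]]
    let ?b = "\<lambda>y. b1 y * b2 y"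
    let ?P = "germ_of (shifted b1 n1) (\<lambda>y. frame_det y ^ n1)"
    let ?Q = "germ_of (shifted b2 n2) (\<lambda>y. frame_det y ^ n2)"
    let ?PQ = "germ_of (\<lambda>y. shifted b1 n1 y * shifted b2 n2 y) (\<lambda>y. frame_det y ^ n1 * frame_det y ^ n2)"
    note lin = fracs_add[OF fracs_smult[OF 1, of "b2 x"] fracs_smult[OF 2, of "b1 x"]]
    have PQ: "?P \<in> nonunits L" "?Q \<in> nonunits L" "?PQ \<in> mxl2"
      using nonunitsI[OF 1] nonunitsI[OF 2] mxl2I[OF 1 2] by simp_all
    have PQ': "?PQ \<in> nonunits L" using PQ(3) csubmoduleD(2)[OF csubmodule_mxl2] by auto
    note M = cmoduleD[OF cmodule_mxl]
    have closed: "b2 x \<odot>\<^bsub>L\<^esub> ?P \<in> nonunits L" "b1 x \<odot>\<^bsub>L\<^esub> ?Q \<in> nonunits L"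
      using M(6)[of ?P "b2 x"] M(6)[of ?Q "b1 x"] PQ by simp_all
    then have closed': "b2 x \<odot>\<^bsub>L\<^esub> ?P \<oplus>\<^bsub>L\<^esub> b1 x \<odot>\<^bsub>L\<^esub> ?Q \<in> nonunits L"
      using M(1) by simp
    \<comment> \<open>Leibniz rule: \<open>p q - p(x) q(x)\<close> is
      \<open>(p - p(x)) (q - q(x))\<close>, an element of the square of the maximal ideal, plus
      \<open>q(x) (p - p(x)) + p(x) (q - q(x))\<close>.\<close>
    have "germ_of (shifted ?b (n1 + n2)) (\<lambda>y. frame_det y ^ (n1 + n2)) =
        ?PQ \<oplus>\<^bsub>L\<^esub> (b2 x \<odot>\<^bsub>L\<^esub> ?P \<oplus>\<^bsub>L\<^esub> b1 x \<odot>\<^bsub>L\<^esub> ?Q)"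
      unfolding smult_L[OF 1] smult_L[OF 2] add_L[OF fracs_smult[OF 1] fracs_smult[OF 2]]
        add_L[OF fracs_mult[OF 1 2] lin]
      by (rule germ_of_eqI[OF shifted_fracs[OF semi_inv_mult[OF normal_lift_semi_inv[OF lift(1)]
              normal_lift_semi_inv[OF lift(2)]]] fracs_add[OF fracs_mult[OF 1 2] lin]])
        (simp add: power_add algebra_simps)
    then have "\<nu> ?b (n1 + n2) = b2 x * \<nu> b1 n1 + b1 x * \<nu> b2 n2"
      unfolding \<nu>_def using \<phi>_add[OF PQ' closed'] \<phi>_add[OF closed] \<phi>_smult PQ \<phi>0[OF PQ(3)] by simp
    then show ?case
      using \<nu>_eq[OF mult.prems normal_lift_mult[OF lift]] mult.IH(1)[OF lift(1)] mult.IH(2)[OF lift(2)]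
        mult.hyps normal_lift_x[OF lift(1)] normal_lift_x[OF lift(2)]
      by (simp add: dir_deriv_mult)
  qed
  have ker: "d_mu q x v = 0"
  proof -
    have "dir_deriv (\<lambda>y. mu_c q y $ i $ j) x v = 0" for i j
    proof -
      let ?b = "\<lambda>y. endo_lift (mu_c q) y $ i $ j"
      have b: "normal_lift (\<lambda>y. mu_c q y $ i $ j) ?b 2" by (rule normal_lift_mu)
      then have bx: "?b x = 0" using normal_lift_x[OF b] mu_zero by simp
      have fr: "(?b, \<lambda>y. frame_det y ^ 2) \<in> fracs"
        using shifted_fracs[OF normal_lift_semi_inv[OF b]] bx by simp
      have "((?b, \<lambda>y. frame_det y ^ 2), (\<lambda>y. 0, \<lambda>y. 1)) \<in> rel"
        unfolding rel_iff using fr fracs_const[of 0] endo_lift_mu_ideal semi_inv_const[of 1 q]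
        by (intro conjI exI[of _ 0] exI[of _ "\<lambda>y. 1"]) simp_all
      then have "germ_of ?b (\<lambda>y. frame_det y ^ 2) = \<zero>\<^bsub>L\<^esub>"
        unfolding zero_L using germ_of_eq_iff[OF fr fracs_const] by simp
      then have "\<nu> ?b 2 = 0"
        by (simp add: \<nu>_def bx \<phi>_zero)
      then show ?thesis
        using main[OF polys_mu_c b] by simp
    qed
    then show ?thesis
      using matrix_dir_deriv_mu_c[of q x v] by (simp add: vec_eq_iff matrix_dir_deriv_def)
  qed
  have "tangent_map v = \<delta>"
  proof (rule tangent_space_eqI[OF tangent_map_closed[OF ker] \<delta>])
    fix a f assume fr: "(a, f) \<in> fracs" and ax: "a x = 0"
    obtain n where a: "a \<in> semi_inv q n" and f: "f \<in> semi_inv q n" "f x \<noteq> 0"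
      using fr by (auto simp: fracs_iff)
    obtain b m where b: "normal_lift a b m"
      using normal_lift_exists[OF semi_inv_polys[OF a]] by blast
    have bx: "b x = 0" using normal_lift_x[OF b] ax by simp
    have aD: "(a, \<lambda>y. frame_det y ^ n) \<in> fracs"
      using shifted_fracs[OF a] ax by simp
    have bD: "(b, \<lambda>y. frame_det y ^ m) \<in> fracs"
      using shifted_fracs[OF normal_lift_semi_inv[OF b]] bx by simp
    obtain j where j: "(\<lambda>y. frame_det y ^ j * (a y * frame_det y ^ m - b y * frame_det y ^ n)) \<in> mu_ideal q"
      using semi_inv_normal_lift[OF a b] by blast
    have "((a, \<lambda>y. frame_det y ^ n), (b, \<lambda>y. frame_det y ^ m)) \<in> rel"
      unfolding rel_iff using aD bD j frame_det_semi_inv[of j]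
      by (intro conjI exI[of _ j] exI[of _ "\<lambda>y. frame_det y ^ j"]) simp_all
    then have "germ_of a (\<lambda>y. frame_det y ^ n) = germ_of b (\<lambda>y. frame_det y ^ m)"
      using germ_of_eq_iff[OF aD bD] by simp
    then have 1: "\<phi> (germ_of a (\<lambda>y. frame_det y ^ n)) = dir_deriv a x v"
      using main[OF semi_inv_polys[OF a] b] by (simp add: \<nu>_def bx)
    \<comment> \<open>Changes the denominator: \<open>a / frame_det ^ n\<close> differs from
      \<open>f x\<close> times \<open>a / f\<close> by the product of \<open>a / f\<close> with
      \<open>f / frame_det ^ n - f x\<close>, and both factors vanish at \<open>x\<close>.\<close>
    let ?R = "germ_of (\<lambda>y. a y * shifted f n y) (\<lambda>y. f y * frame_det y ^ n)"
    have R: "?R \<in> mxl2"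
      by (rule mxl2I[OF fr shifted_fracs[OF f(1)] ax]) simp
    have "germ_of a (\<lambda>y. frame_det y ^ n) = ?R \<oplus>\<^bsub>L\<^esub> f x \<odot>\<^bsub>L\<^esub> germ_of a f"
      unfolding smult_L[OF fr] add_L[OF fracs_mult[OF fr shifted_fracs[OF f(1)]] fracs_smult[OF fr]]
      by (rule germ_of_eqI[OF aD fracs_add[OF fracs_mult[OF fr shifted_fracs[OF f(1)]] fracs_smult[OF fr]]])
        (simp add: algebra_simps)
    moreover have "f x \<odot>\<^bsub>L\<^esub> germ_of a f \<in> nonunits L"
      using cmoduleD(6)[OF cmodule_mxl, of "germ_of a f" "f x"] nonunitsI[OF fr ax] by simp
    ultimately have "\<phi> (germ_of a (\<lambda>y. frame_det y ^ n)) = f x * \<phi> (germ_of a f)"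
      using \<phi>_add[of ?R "f x \<odot>\<^bsub>L\<^esub> germ_of a f"] \<phi>_smult[OF nonunitsI[OF fr ax]] \<phi>0[OF R]
        R csubmoduleD(2)[OF csubmodule_mxl2] by auto
    then show "tangent_map v (mxl2 +>\<^bsub>mxl\<^esub> germ_of a f) = \<delta> (mxl2 +>\<^bsub>mxl\<^esub> germ_of a f)"
      using 1 f(2) by (simp add: tangent_map_germ[OF ker fr ax] \<phi>_def field_simps)
  qed
  then show ?thesis using ker by blast
qed

section \<open>Linearity and the final isomorphism\<close>

lemma d_mu_add: "d_mu q x (v + w) = d_mu q x v + d_mu q x w"
  and d_mu_scale: "d_mu q x (adhm_scale c v) = mscale c (d_mu q x v)"
  by (simp_all add: vec_eq_iff matrix_dir_deriv_def dir_deriv_vec_add dir_deriv_vec_scale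
      flip: matrix_dir_deriv_mu_c)

lemma cmodule_adhm_kernel: "cmodule (adhm_kernel q x)"
proof (rule cmoduleI)
  have zero: "d_mu q x 0 = 0" using d_mu_add[of 0 0] by simp
  show "\<zero>\<^bsub>adhm_kernel q x\<^esub> \<in> carrier (adhm_kernel q x)"
    by (simp add: adhm_kernel_def zero)
  show "c \<odot>\<^bsub>adhm_kernel q x\<^esub> v \<in> carrier (adhm_kernel q x)" if "v \<in> carrier (adhm_kernel q x)" for c v
    using that by (simp add: adhm_kernel_def d_mu_scale vec_eq_iff)
qed (simp_all add: adhm_kernel_def d_mu_add adhm_scale_def prod_eq_iff vec_eq_iff algebra_simps)

lemma cmodule_tangent_space: "cmodule (tangent_space q (orbit x))"
  unfolding tangent_space_eq by (intro cmodule_dual cmodule_quotient csubmodule_mxl2)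

lemma tangent_map_zero_iff:
  assumes v: "d_mu q x v = 0"
  shows "tangent_map v = \<zero>\<^bsub>tangent_space q (orbit x)\<^esub> \<longleftrightarrow> v \<in> range (d_phi x)"
proof -
  have germ: "mxl2 +>\<^bsub>mxl\<^esub> germ_of a f \<in> a_rcosets\<^bsub>mxl\<^esub> mxl2" if "(a, f) \<in> fracs" "a x = 0" for a f
    using nonunitsI[OF that] by (simp add: quotient_carrier)
  show ?thesis
  proof
    assume 0: "tangent_map v = \<zero>\<^bsub>tangent_space q (orbit x)\<^esub>"
    show "v \<in> range (d_phi x)"
    proof (rule killed_imp_d_phi)
      fix a f assume fr: "(a, f) \<in> fracs" "a x = 0"
      then show "dir_deriv a x v = 0"
        using 0 tangent_map_germ[OF v fr] germ[OF fr] fracs_nonzero[OF fr(1)]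
        by (simp add: tangent_space_eq)
    qed
  next
    assume "v \<in> range (d_phi x)"
    then obtain \<xi> where \<xi>: "v = d_phi x \<xi>" by blast
    show "tangent_map v = \<zero>\<^bsub>tangent_space q (orbit x)\<^esub>"
    proof (rule tangent_space_eqI[OF tangent_map_closed[OF v] cmoduleD(2)[OF cmodule_tangent_space]])
      fix a f assume fr: "(a, f) \<in> fracs" "a x = 0"
      then have "dir_deriv a x v = 0"
        unfolding \<xi> fracs_iff using dir_deriv_d_phi by blast
      then show "tangent_map v (mxl2 +>\<^bsub>mxl\<^esub> germ_of a f) =
          \<zero>\<^bsub>tangent_space q (orbit x)\<^esub> (mxl2 +>\<^bsub>mxl\<^esub> germ_of a f)"
        using tangent_map_germ[OF v fr] germ[OF fr] by (simp add: tangent_space_eq)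
    qed
  qed
qed

lemma isomorphic_tangent_space_H1: "isomorphic_spaces (tangent_space q (orbit x)) (H1 q x)"
  unfolding H1_def
proof (rule isomorphic_spaces_quotient[OF cmodule_adhm_kernel cmodule_tangent_space, of tangent_map])
  note T = cmoduleD[OF cmodule_tangent_space]
  have germ: "mxl2 +>\<^bsub>mxl\<^esub> germ_of a f \<in> a_rcosets\<^bsub>mxl\<^esub> mxl2" if "(a, f) \<in> fracs" "a x = 0" for a f
    using nonunitsI[OF that] by (simp add: quotient_carrier)
  show closed: "tangent_map v \<in> carrier (tangent_space q (orbit x))" if "v \<in> carrier (adhm_kernel q x)" for v
    using that by (simp add: adhm_kernel_def tangent_map_closed)
  show "tangent_map (v \<oplus>\<^bsub>adhm_kernel q x\<^esub> w) = tangent_map v \<oplus>\<^bsub>tangent_space q (orbit x)\<^esub> tangent_map w"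
    if "v \<in> carrier (adhm_kernel q x)" "w \<in> carrier (adhm_kernel q x)" for v w
  proof (rule tangent_space_eqI)
    fix a f assume fr: "(a, f) \<in> fracs" "a x = 0"
    have "d_mu q x v = 0" "d_mu q x w = 0" using that by (simp_all add: adhm_kernel_def)
    then show "tangent_map (v \<oplus>\<^bsub>adhm_kernel q x\<^esub> w) (mxl2 +>\<^bsub>mxl\<^esub> germ_of a f) =
        (tangent_map v \<oplus>\<^bsub>tangent_space q (orbit x)\<^esub> tangent_map w) (mxl2 +>\<^bsub>mxl\<^esub> germ_of a f)"
      using germ[OF fr] fracs_polys[OF fr(1)]
      by (simp add: adhm_kernel_def tangent_space_eq tangent_map_germ[OF _ fr] d_mu_add
          dir_deriv_vec_add add_divide_distrib)
  qed (use that T(1) closed cmoduleD(1)[OF cmodule_adhm_kernel] in blast)+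
  show "tangent_map (c \<odot>\<^bsub>adhm_kernel q x\<^esub> v) = c \<odot>\<^bsub>tangent_space q (orbit x)\<^esub> tangent_map v"
    if "v \<in> carrier (adhm_kernel q x)" for c v
  proof (rule tangent_space_eqI)
    fix a f assume fr: "(a, f) \<in> fracs" "a x = 0"
    have v: "d_mu q x v = 0" using that by (simp add: adhm_kernel_def)
    then have "d_mu q x (adhm_scale c v) = 0" by (simp add: d_mu_scale vec_eq_iff)
    with v show "tangent_map (c \<odot>\<^bsub>adhm_kernel q x\<^esub> v) (mxl2 +>\<^bsub>mxl\<^esub> germ_of a f) =
        (c \<odot>\<^bsub>tangent_space q (orbit x)\<^esub> tangent_map v) (mxl2 +>\<^bsub>mxl\<^esub> germ_of a f)"
      using germ[OF fr] fracs_polys[OF fr(1)]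
      by (simp add: adhm_kernel_def tangent_space_eq tangent_map_germ[OF _ fr] dir_deriv_vec_scale)
  qed (use that T(6) closed cmoduleD(6)[OF cmodule_adhm_kernel] in blast)+
  show "\<exists>v\<in>carrier (adhm_kernel q x). tangent_map v = \<delta>" if "\<delta> \<in> carrier (tangent_space q (orbit x))" for \<delta>
    using tangent_map_surj[OF that] by (auto simp: adhm_kernel_def)
  show "range (d_phi x) = {v \<in> carrier (adhm_kernel q x). tangent_map v = \<zero>\<^bsub>tangent_space q (orbit x)\<^esub>}"
  proof (rule Set.set_eqI)
    fix v
    have "d_mu q x v = 0" if "v \<in> range (d_phi x)"
      using that d_mu_d_phi[OF mu_zero] by auto
    then show "v \<in> range (d_phi x) \<longleftrightarrow>
        v \<in> {v \<in> carrier (adhm_kernel q x). tangent_map v = \<zero>\<^bsub>tangent_space q (orbit x)\<^esub>}"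
      using tangent_map_zero_iff[of v] by (auto simp only: adhm_kernel_def partial_object.simps mem_Collect_eq)
  qed
qed

end

theorem theorem6p14:
  fixes \<theta> q :: complex
    and x :: "('k::finite, 'r::finite) adhm"
    and E :: "('k, 'r) adhm set"
  assumes "q = exp (\<i> / 2 * \<theta>)"
    and "stable x" and "mu_c q x = 0"
    and "E \<in> moduli_space q" and "E = orbit x"
  shows "isomorphic_spaces (tangent_space q E) (H1 q x)"
proof -
  interpret adhm_point q x
    using assms by unfold_locales
  show ?thesis
    using isomorphic_tangent_space_H1 by (simp add: assms(5))
qed

end
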